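(* Let $M$ be any of the following (countably infinite) homogeneous structures. Then there is no m.e.c. with an ultraproduct elementarily equivalent to $M$. (i) Any homogeneous structure whose theory has the strict order property. (ii) Any unstable homogeneous graph. (iii) Any homogeneous tournament. (iv) The digraph $Q_n$, for each $n\ge3$. (v) The generic bipartite graph, with the two parts named by unary predicates.
   Context: A countable structure over a relational language is homogeneous if every isomorphism between finite substructures extends to an automorphism. A theory has the strict order property if some model has an interpretable partial order containing an infinite totally ordered subset. Digraphs here have an irreflexive, antisymmetric arc relation. $I_n$ is the digraph on $n$ vertices with no arcs, and $Q_n$ is the universal homogeneous $I_n$-free digraph (the countable homogeneous digraph whose finite induced subdigraphs are exactly the finite digraphs not embedding $I_n$). The generic bipartite graph is the unique countably infinite structure with an equivalence relation $E$ (with two classes, the bipartition) and a symmetric irreflexive relation $R$ holding only between $E$-inequivalent pairs, such that for any two finite disjoint subsets $A,B$ of one part there is a vertex in the other part adjacent to all vertices of $A$ and to no vertices of $B$. Definition of m.e.c. Let $\mathcal{C}$ be a class of finite $L$-structures. For a tuple $\bar y$ of variables, $(\mathcal{C},\bar y)$ denotes the set of pairs $(M,\bar a)$ with $M\in\mathcal{C}$, $\bar a\in M^{|\bar y|}$. A partition $\Pi$ of $(\mathcal{C},\bar y)$ is $\emptyset$-definable if for each $\pi\in\Pi$ there is a parameter-free $L$-formula $\phi_\pi(\bar y)$ with $\phi_\pi(M^{|\bar y|})=\{\bar b\in M^{|\bar{y}|}:(M,\bar b)\in\pi\}$ for all $M\in\mathcal{C}$. $\mathcal{C}$ is a multidimensional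 exact class (m.e.c.) if for every $L$-formula $\phi(\bar x;\bar y)$ there is a finite $\emptyset$-definable partition $\Pi$ of $(\mathcal{C},\bar y)$ and functions $h_\pi:\mathcal{C}\to\mathbb{R}^{\geq 0}$ ($\pi\in\Pi$) such that $|\phi(M^{|\bar x|};\bar b)|=h_\pi(M)$ for all $(M,\bar b)\in\pi$. *)

theory Defs
  imports Complex_Main "HOL-Library.Countable_Set" "HOL-Library.Disjoint_Sets"
begin

section \<open>First-order logic over a relational language\<close>

text \<open>
  A relational language is a type of relation symbols together with an arity function
  \<open>ar\<close>. Formulas use de Bruijn indices: variables are natural numbers that index into
  a list of values, and \<open>Exists\<close> pushes a value onto the front of that list. Hence a formula
  \<open>\<phi>(x\<^sub>0,\<dots>,x\<^sub>n\<^sub>-\<^sub>1)\<close> is one with \<open>wff ar n \<phi>\<close>, and it is evaluated at lists of length \<open>n\<close>.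
  A formula \<open>\<phi>(x;y)\<close> with a split of its free variables into tuples of lengths \<open>k\<close> and \<open>l\<close>
  is a formula with \<open>wff ar (k + l) \<phi>\<close>, evaluated at \<open>a @ b\<close>.
\<close>

datatype 'r form =
    Eq nat nat
  | Rel 'r "nat list"
  | Neg "'r form"
  | Conj "'r form" "'r form"
  | Exists "'r form"

fun wff :: "('r \<Rightarrow> nat) \<Rightarrow> nat \<Rightarrow> 'r form \<Rightarrow> bool" where
  "wff ar n (Eq i j) \<longleftrightarrow> i < n \<and> j < n"
| "wff ar n (Rel r is) \<longleftrightarrow> length is = ar r \<and> (\<forall>i\<in>set is. i < n)"
| "wff ar n (Neg \<phi>) \<longleftrightarrow> wff ar n \<phi>"
| "wff ar n (Conj \<phi> \<psi>) \<longleftrightarrow> wff ar n \<phi> \<and> wff ar n \<psi>"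
| "wff ar n (Exists \<phi>) \<longleftrightarrow> wff ar (Suc n) \<phi>"

record ('r, 'a) rel_struct =
  univ :: "'a set"
  rel :: "'r \<Rightarrow> 'a list set"

definition tuples :: "('r, 'a) rel_struct \<Rightarrow> nat \<Rightarrow> 'a list set" where
  "tuples M n = {xs. set xs \<subseteq> univ M \<and> length xs = n}"

definition is_structure :: "('r \<Rightarrow> nat) \<Rightarrow> ('r, 'a) rel_struct \<Rightarrow> bool" where
  "is_structure ar M \<longleftrightarrow> univ M \<noteq> {} \<and> (\<forall>r. rel M r \<subseteq> tuples M (ar r))"

fun sat :: "('r, 'a) rel_struct \<Rightarrow> 'a list \<Rightarrow> 'r form \<Rightarrow> bool" where
  "sat M e (Eq i j) \<longleftrightarrow> e ! i = e ! j"
| "sat M e (Rel r is) \<longleftrightarrow> map (\<lambda>i. e ! i) is \<in> rel M r"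
| "sat M e (Neg \<phi>) \<longleftrightarrow> \<not> sat M e \<phi>"
| "sat M e (Conj \<phi> \<psi>) \<longleftrightarrow> sat M e \<phi> \<and> sat M e \<psi>"
| "sat M e (Exists \<phi>) \<longleftrightarrow> (\<exists>a\<in>univ M. sat M (a # e) \<phi>)"

definition theory_of :: "('r \<Rightarrow> nat) \<Rightarrow> ('r, 'a) rel_struct \<Rightarrow> 'r form set" where
  "theory_of ar M = {\<phi>. wff ar 0 \<phi> \<and> sat M [] \<phi>}"

definition is_model :: "('r \<Rightarrow> nat) \<Rightarrow> ('r, 'a) rel_struct \<Rightarrow> 'r form set \<Rightarrow> bool" where
  "is_model ar M T \<longleftrightarrow> is_structure ar M \<and> (\<forall>\<phi>\<in>T. sat M [] \<phi>)"

definition elem_equiv ::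
    "('r \<Rightarrow> nat) \<Rightarrow> ('r, 'a) rel_struct \<Rightarrow> ('r, 'b) rel_struct \<Rightarrow> bool" where
  "elem_equiv ar M N \<longleftrightarrow> theory_of ar M = theory_of ar N"


section \<open>Isomorphisms and homogeneity\<close>

definition substructure :: "('r, 'a) rel_struct \<Rightarrow> 'a set \<Rightarrow> ('r, 'a) rel_struct" where
  "substructure M S = \<lparr>univ = S, rel = (\<lambda>r. {xs \<in> rel M r. set xs \<subseteq> S})\<rparr>"

definition isomorphism ::
    "('r \<Rightarrow> nat) \<Rightarrow> ('r, 'a) rel_struct \<Rightarrow> ('r, 'b) rel_struct \<Rightarrow> ('a \<Rightarrow> 'b) \<Rightarrow> bool" where
  "isomorphism ar M N f \<longleftrightarrow>
     bij_betw f (univ M) (univ N) \<and>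
     (\<forall>r. \<forall>xs\<in>tuples M (ar r). xs \<in> rel M r \<longleftrightarrow> map f xs \<in> rel N r)"

definition embeds ::
    "('r \<Rightarrow> nat) \<Rightarrow> ('r, 'a) rel_struct \<Rightarrow> ('r, 'b) rel_struct \<Rightarrow> bool" where
  "embeds ar M N \<longleftrightarrow> (\<exists>S\<subseteq>univ N. \<exists>f. isomorphism ar M (substructure N S) f)"

definition homogeneous :: "('r \<Rightarrow> nat) \<Rightarrow> ('r, 'a) rel_struct \<Rightarrow> bool" where
  "homogeneous ar M \<longleftrightarrow>
     is_structure ar M \<and> countable (univ M) \<and>
     (\<forall>A B f. A \<subseteq> univ M \<and> B \<subseteq> univ M \<and> finite A \<and> finite B \<and>
        isomorphism ar (substructure M A) (substructure M B) f \<longrightarrow>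
        (\<exists>g. isomorphism ar M M g \<and> (\<forall>x\<in>A. g x = f x)))"

definition countably_infinite_structure :: "('r \<Rightarrow> nat) \<Rightarrow> ('r, 'a) rel_struct \<Rightarrow> bool" where
  "countably_infinite_structure ar M \<longleftrightarrow>
     is_structure ar M \<and> countable (univ M) \<and> infinite (univ M)"


section \<open>Strict order property and stability\<close>

text \<open>Definability is with parameters \<open>c\<close>.\<close>

definition definable :: "('r \<Rightarrow> nat) \<Rightarrow> ('r, 'a) rel_struct \<Rightarrow> nat \<Rightarrow> 'a list set \<Rightarrow> bool" where
  "definable ar M n X \<longleftrightarrow>
     (\<exists>m \<phi> c. wff ar (n + m) \<phi> \<and> c \<in> tuples M m \<and> X = {a \<in> tuples M n. sat M (a @ c) \<phi>})"

definition definable_rel ::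
    "('r \<Rightarrow> nat) \<Rightarrow> ('r, 'a) rel_struct \<Rightarrow> nat \<Rightarrow> ('a list \<times> 'a list) set \<Rightarrow> bool" where
  "definable_rel ar M n R \<longleftrightarrow>
     R \<subseteq> tuples M n \<times> tuples M n \<and> definable ar M (n + n) {x @ y | x y. (x, y) \<in> R}"

text \<open>
  The partially ordered set \<open>(D // E, P)\<close> is interpretable in \<open>M\<close>: \<open>D\<close> is a definable set of
  \<open>n\<close>-tuples, \<open>E\<close> a definable equivalence relation on \<open>D\<close>, and the preimage of \<open>P\<close> in
  \<open>D \<times> D\<close> is definable.
\<close>

definition interpretable_partial_order ::
    "('r \<Rightarrow> nat) \<Rightarrow> ('r, 'a) rel_struct \<Rightarrow> nat \<Rightarrow> 'a list set \<Rightarrow> ('a list \<times> 'a list) set \<Rightarrow>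
     ('a list set \<times> 'a list set) set \<Rightarrow> bool" where
  "interpretable_partial_order ar M n D E P \<longleftrightarrow>
     definable ar M n D \<and> definable_rel ar M n E \<and> equiv D E \<and>
     partial_order_on (D // E) P \<and>
     definable_rel ar M n {(x, y) \<in> D \<times> D. (E `` {x}, E `` {y}) \<in> P}"

text \<open>
  The two properties below assert that some model of the theory \<open>T\<close> behaves in a certain way.
  Since a model lives on some type, that type is passed as an argument. In a theorem that has
  such a property as a hypothesis, leaving the type variable free lets the model have an
  arbitrary type.
\<close>

definition strict_order_property :: "'n itself \<Rightarrow> ('r \<Rightarrow> nat) \<Rightarrow> 'r form set \<Rightarrow> bool" where
  "strict_order_property _ ar T \<longleftrightarrow>
     (\<exists>N :: ('r, 'n) rel_struct. is_model ar N T \<and>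
        (\<exists>n D E P S. interpretable_partial_order ar N n D E P \<and>
           S \<subseteq> D // E \<and> infinite S \<and> total_on S P))"

text \<open>A theory is unstable if some formula has the order property in some model of it.\<close>

definition unstable :: "'n itself \<Rightarrow> ('r \<Rightarrow> nat) \<Rightarrow> 'r form set \<Rightarrow> bool" where
  "unstable _ ar T \<longleftrightarrow>
     (\<exists>N :: ('r, 'n) rel_struct. is_model ar N T \<and>
        (\<exists>k l \<phi> (a :: nat \<Rightarrow> 'n list) (b :: nat \<Rightarrow> 'n list).
           wff ar (k + l) \<phi> \<and>
           (\<forall>i. a i \<in> tuples N k) \<and> (\<forall>j. b j \<in> tuples N l) \<and>
           (\<forall>i j. sat N (a i @ b j) \<phi> \<longleftrightarrow> i < j)))"


section \<open>Ultraproducts\<close>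

definition ultrafilter :: "'i filter \<Rightarrow> bool" where
  "ultrafilter U \<longleftrightarrow>
     U \<noteq> bot \<and> (\<forall>P. eventually P U \<or> eventually (\<lambda>i. \<not> P i) U)"

definition direct_product :: "('i \<Rightarrow> ('r, 'a) rel_struct) \<Rightarrow> ('i \<Rightarrow> 'a) set" where
  "direct_product N = {f. \<forall>i. f i \<in> univ (N i)}"

definition ultra_eq ::
    "'i filter \<Rightarrow> ('i \<Rightarrow> ('r, 'a) rel_struct) \<Rightarrow> (('i \<Rightarrow> 'a) \<times> ('i \<Rightarrow> 'a)) set" where
  "ultra_eq U N =
     {(f, g) \<in> direct_product N \<times> direct_product N. eventually (\<lambda>i. f i = g i) U}"

definition ultraproduct ::
    "('r \<Rightarrow> nat) \<Rightarrow> 'i filter \<Rightarrow> ('i \<Rightarrow> ('r, 'a) rel_struct) \<Rightarrow>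
     ('r, ('i \<Rightarrow> 'a) set) rel_struct" where
  "ultraproduct ar U N =
     \<lparr>univ = direct_product N // ultra_eq U N,
      rel = (\<lambda>r. {map (\<lambda>f. ultra_eq U N `` {f}) fs | fs.
                    set fs \<subseteq> direct_product N \<and> length fs = ar r \<and>
                    eventually (\<lambda>i. map (\<lambda>f. f i) fs \<in> rel (N i) r) U})\<rparr>"


section \<open>Multidimensional exact classes\<close>

definition class_tuples :: "('r, 'a) rel_struct set \<Rightarrow> nat \<Rightarrow> (('r, 'a) rel_struct \<times> 'a list) set" where
  "class_tuples C l = {(M, b). M \<in> C \<and> b \<in> tuples M l}"

definition definable_partition ::
    "('r \<Rightarrow> nat) \<Rightarrow> ('r, 'a) rel_struct set \<Rightarrow> nat \<Rightarrow>
     (('r, 'a) rel_struct \<times> 'a list) set set \<Rightarrow> bool" where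
  "definable_partition ar C l \<P> \<longleftrightarrow>
     partition_on (class_tuples C l) \<P> \<and>
     (\<forall>\<pi>\<in>\<P>. \<exists>\<psi>. wff ar l \<psi> \<and>
        (\<forall>M\<in>C. {b \<in> tuples M l. sat M b \<psi>} = {b \<in> tuples M l. (M, b) \<in> \<pi>}))"

definition mec :: "('r \<Rightarrow> nat) \<Rightarrow> ('r, 'a) rel_struct set \<Rightarrow> bool" where
  "mec ar C \<longleftrightarrow>
     (\<forall>M\<in>C. is_structure ar M \<and> finite (univ M)) \<and>
     (\<forall>k l \<phi>. wff ar (k + l) \<phi> \<longrightarrow>
        (\<exists>\<P> (h :: (('r, 'a) rel_struct \<times> 'a list) set \<Rightarrow> ('r, 'a) rel_struct \<Rightarrow> real).
           finite \<P> \<and> definable_partition ar C l \<P> \<and>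
           (\<forall>\<pi>\<in>\<P>. \<forall>M\<in>C. h \<pi> M \<ge> 0) \<and>
           (\<forall>\<pi>\<in>\<P>. \<forall>(M, b)\<in>\<pi>. real (card {a \<in> tuples M k. sat M (a @ b) \<phi>}) = h \<pi> M)))"

text \<open>
  The members of the class have their elements in the first type argument, and the ultraproducts
  are indexed by the second one.
\<close>

definition equiv_to_mec_ultraproduct ::
    "'a itself \<Rightarrow> 'i itself \<Rightarrow> ('r \<Rightarrow> nat) \<Rightarrow> ('r, 'm) rel_struct \<Rightarrow> bool" where
  "equiv_to_mec_ultraproduct _ _ ar M \<longleftrightarrow>
     (\<exists>(C :: ('r, 'a) rel_struct set) (U :: 'i filter) (N :: 'i \<Rightarrow> ('r, 'a) rel_struct).
        mec ar C \<and> ultrafilter U \<and> (\<forall>i. N i \<in> C) \<and> elem_equiv ar (ultraproduct ar U N) M)"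


section \<open>Graphs, digraphs and tournaments\<close>

datatype arc_lang = Arc

definition arc_ar :: "arc_lang \<Rightarrow> nat" where
  "arc_ar s = 2"

definition arcs :: "(arc_lang, 'a) rel_struct \<Rightarrow> ('a \<times> 'a) set" where
  "arcs M = {(x, y). [x, y] \<in> rel M Arc}"

definition is_graph :: "(arc_lang, 'a) rel_struct \<Rightarrow> bool" where
  "is_graph M \<longleftrightarrow> is_structure arc_ar M \<and> irrefl (arcs M) \<and> sym (arcs M)"

text \<open>
  Antisymmetry of the arc relation of a digraph means that there are never arcs in both
  directions between two distinct vertices.
\<close>

definition is_digraph :: "(arc_lang, 'a) rel_struct \<Rightarrow> bool" where
  "is_digraph M \<longleftrightarrow> is_structure arc_ar M \<and> irrefl (arcs M) \<and> antisym (arcs M)"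

definition is_tournament :: "(arc_lang, 'a) rel_struct \<Rightarrow> bool" where
  "is_tournament M \<longleftrightarrow> is_digraph M \<and> total_on (univ M) (arcs M)"

definition indep_digraph :: "nat \<Rightarrow> (arc_lang, nat) rel_struct" where
  "indep_digraph n = \<lparr>univ = {..<n}, rel = (\<lambda>_. {})\<rparr>"

text \<open>
  \<open>M\<close> is (a copy of) \<open>Q\<^sub>n\<close>. Every finite digraph has a copy with vertices in \<open>nat\<close>, so it is
  enough to let \<open>D\<close> range over those.
\<close>

definition is_Q :: "nat \<Rightarrow> (arc_lang, 'a) rel_struct \<Rightarrow> bool" where
  "is_Q n M \<longleftrightarrow>
     is_digraph M \<and> homogeneous arc_ar M \<and>
     (\<forall>D :: (arc_lang, nat) rel_struct. is_digraph D \<and> finite (univ D) \<longrightarrow>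
        (embeds arc_ar D M \<longleftrightarrow> \<not> embeds arc_ar (indep_digraph n) D))"


section \<open>The generic bipartite graph\<close>

definition generic_bipartite :: "'a set \<Rightarrow> ('a \<times> 'a) set \<Rightarrow> ('a \<times> 'a) set \<Rightarrow> bool" where
  "generic_bipartite V E R \<longleftrightarrow>
     countable V \<and> infinite V \<and>
     equiv V E \<and> card (V // E) = 2 \<and>
     R \<subseteq> V \<times> V \<and> sym R \<and> irrefl R \<and> R \<inter> E = {} \<and>
     (\<forall>X\<in>V // E. \<forall>A B. finite A \<and> finite B \<and> A \<subseteq> X \<and> B \<subseteq> X \<and> A \<inter> B = {} \<longrightarrow>
        (\<exists>v\<in>V - X. (\<forall>a\<in>A. (v, a) \<in> R) \<and> (\<forall>b\<in>B. (v, b) \<notin> R)))"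

datatype bip_lang = SameSide | Adj | Left | Right

fun bip_ar :: "bip_lang \<Rightarrow> nat" where
  "bip_ar SameSide = 2"
| "bip_ar Adj = 2"
| "bip_ar Left = 1"
| "bip_ar Right = 1"

text \<open>The expansion of the generic bipartite graph by unary predicates for its two parts.\<close>

definition is_generic_bipartite :: "(bip_lang, 'a) rel_struct \<Rightarrow> bool" where
  "is_generic_bipartite M \<longleftrightarrow>
     is_structure bip_ar M \<and>
     (let E = {(x, y). [x, y] \<in> rel M SameSide};
          R = {(x, y). [x, y] \<in> rel M Adj};
          P = {x. [x] \<in> rel M Left};
          Q = {x. [x] \<in> rel M Right}
      in generic_bipartite (univ M) E R \<and> P \<noteq> Q \<and> univ M // E = {P, Q})"

end

theory Submission
  imports Defs "HOL-Library.Ramsey"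
begin

text \<open>
Let \<open>N i\<close> be members of a multidimensional exact class with an ultraproduct elementarily equivalent to
\<open>M\<close>. By the theorem of Los, a first-order sentence holds in \<open>M\<close> if and only if it holds in almost
all \<open>N i\<close>. If \<open>\<theta>(y,y')\<close> forces the tuples \<open>y\<close> and \<open>y'\<close> of \<open>M\<close> to satisfy the same formulas, then in
almost all \<open>N i\<close> it forces them to lie in the same part of the partition belonging to a given formula
\<open>\<phi>(x;y)\<close>; so the sets \<open>\<phi>(x;y)\<close> and \<open>\<phi>(x;y')\<close> have exactly the same size (\<open>equal_counts\<close>). If \<open>M\<close> is
homogeneous in a finite language, \<open>\<theta>\<close> can say that \<open>y\<close> and \<open>y'\<close> have isomorphic induced structures.
Thus almost all \<open>N i\<close> are finite structures in which the number of one-point extensions of a short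
tuple depends on its isomorphism type only (\<open>tuple_regular\<close>), and which agree with \<open>M\<close> on any given
sentence. In each case such finite structures are too small or too special.

\<^item> Strict order property: along a chain in a definable preorder the sets of predecessors strictly
  increase in size, while the sizes of the sets defined by one formula in one member of the class are
  boundedly many.

\<^item> Tournaments: a nonempty regular tournament has odd size. This applies to the tournament itself and
  to every atom over at most two of its vertices, and parity leaves only the cyclic triangle
  (\<open>tuple_regular_tournament_card\<close>).

\<^item> \<open>Q\<^sub>n\<close>: the common nonneighbours of \<open>n - 2\<close> independent vertices form a tournament, so this case
  reduces to the previous one.

\<^item> Generic bipartite graph: the two sides are the points and blocks of a design whose dual is also a
  design, so they have the same size. The same holds after removing a point and passing to the
  blocks through it, or to the blocks that avoid it, which is contradictory
  (\<open>finite_generic_bipartite_False\<close>). Homogeneity of the generic bipartite graph comes from a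
  back-and-forth argument, in the form that the system of finite partial isomorphisms preserves the
  truth of formulas.

\<^item> Graphs: call a graph degenerate if adjacency or nonadjacency, completed by equality, is an
  equivalence relation. A homogeneous degenerate graph is stable, by Ramsey's theorem. A finite
  nondegenerate graph with prescribed extension numbers for up to seven vertices has at most nine
  vertices (\<open>tuple_regular_graph_card\<close>).

The last statement is a weak form of Cameron's theorem on \<open>5\<close>-regular graphs, with the following
proof. The graph is strongly regular, with eigenvalues \<open>e\<close> and \<open>f\<close> other than its valency. Let \<open>t j\<close> be
the number of common neighbours of three vertices that span \<open>j\<close> edges. Double counting shows that the
second differences \<open>t 2 - 2 * t 1 + t 0\<close> and \<open>t 3 - 2 * t 2 + t 1\<close> are among \<open>e\<close>, \<open>f\<close>
(\<open>second_difference_eigenvalue\<close>). If they differ, the parameters are those of a pseudo or negative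
Latin square graph; if they agree, those of a Smith graph. In both cases the neighbourhood and the
set of nonneighbours of a vertex are strongly regular with computable integral eigenvalues, and they
inherit the regularity assumption. Two steps of descent exclude the Smith graphs
(\<open>smith_graph_False\<close>). Hence a Latin square graph on \<open>n = (e - f)\<^sup>2\<close> vertices has both subconstituents
of the same kind, and comparing the numbers of vertices leaves the lattice graph on nine vertices
(\<open>latin_graph_card\<close>). Triangle-free graphs and subconstituents that are degenerate need a separate
treatment (\<open>has_triangle\<close>, \<open>lattice_parameters\<close>).
\<close>

section \<open>Extension numbers of tuples\<close>

definition same_type :: "('a \<Rightarrow> 'a \<Rightarrow> bool) \<Rightarrow> 'a list \<Rightarrow> 'a list \<Rightarrow> bool" where
  "same_type R xs ys \<longleftrightarrow> length xs = length ys \<and>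
     (\<forall>i<length xs. \<forall>j<length xs. (xs ! i = xs ! j \<longleftrightarrow> ys ! i = ys ! j) \<and>
        (R (xs ! i) (xs ! j) \<longleftrightarrow> R (ys ! i) (ys ! j)))"

text \<open>
The one-point extensions of \<open>xs\<close> by vertices outside \<open>xs\<close>, with prescribed arcs to and from each
entry. A list \<open>ps\<close> of the wrong length yields the empty set.
\<close>

definition ext :: "'a set \<Rightarrow> ('a \<Rightarrow> 'a \<Rightarrow> bool) \<Rightarrow> 'a list \<Rightarrow> (bool \<times> bool) list \<Rightarrow> 'a set" where
  "ext V R xs ps = {v \<in> V. list_all2 (\<lambda>x p. v \<noteq> x \<and> (R v x, R x v) = p) xs ps}"

definition tuple_regular :: "nat \<Rightarrow> 'a set \<Rightarrow> ('a \<Rightarrow> 'a \<Rightarrow> bool) \<Rightarrow> bool" where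
  "tuple_regular t V R \<longleftrightarrow> finite V \<and>
     (\<forall>xs ys ps. set xs \<subseteq> V \<and> set ys \<subseteq> V \<and> length xs \<le> t \<and> same_type R xs ys \<longrightarrow>
        card (ext V R xs ps) = card (ext V R ys ps))"

lemma tuple_regular_mono: "tuple_regular t V R \<Longrightarrow> s \<le> t \<Longrightarrow> tuple_regular s V R"
  unfolding tuple_regular_def by (meson le_trans)

lemma tuple_regularD:
  assumes "tuple_regular t V R" "set xs \<subseteq> V" "set ys \<subseteq> V" "length xs \<le> t" "same_type R xs ys"
  shows "card (ext V R xs ps) = card (ext V R ys ps)"
  using assms unfolding tuple_regular_def by blast

lemma ext_append:
  assumes "length ps = length as"
  shows "ext V R (as @ xs) (ps @ qs) = ext (ext V R as ps) R xs qs"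
  using assms by (auto simp: ext_def list_all2_append)

lemma ext_length_neq: "length ps \<noteq> length xs \<Longrightarrow> ext V R xs ps = {}"
  by (auto simp: ext_def dest: list_all2_lengthD)

lemma ext_subset: "ext V R xs ps \<subseteq> V"
  by (auto simp: ext_def)

lemma same_type_append_ext:
  assumes "same_type R xs ys" "set xs \<subseteq> ext V R as ps" "set ys \<subseteq> ext V R as ps"
  shows "same_type R (as @ xs) (as @ ys)"
proof -
  have len: "length xs = length ys" using assms(1) by (simp add: same_type_def)
  have rel: "v \<noteq> as ! i \<and> (R v (as ! i), R (as ! i) v) = ps ! i"
    if "v \<in> ext V R as ps" "i < length as" for v i
    using that by (auto simp: ext_def list_all2_conv_all_nth)
  have mem: "xs ! i \<in> ext V R as ps" "ys ! i \<in> ext V R as ps" if "i < length xs" for i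
    using assms(2,3) that len by auto
  have "R (xs ! i) (as ! j) = R (ys ! i) (as ! j)" "R (as ! j) (xs ! i) = R (as ! j) (ys ! i)"
    "xs ! i \<noteq> as ! j" "ys ! i \<noteq> as ! j" "as ! j \<noteq> xs ! i" "as ! j \<noteq> ys ! i"
    if "i < length xs" "j < length as" for i j
    using rel[OF mem(1)[OF that(1)] that(2)] rel[OF mem(2)[OF that(1)] that(2)] by (metis prod.inject)+
  then show ?thesis
    using assms(1) len by (auto simp: same_type_def nth_append)
qed

text \<open>
An extension of \<open>xs\<close> inside the atom \<open>ext V R as ps\<close> is an extension of \<open>as @ xs\<close> in \<open>V\<close>; and tuples of the
atom with the same type keep the same type when \<open>as\<close> is put in front of them. This is the
source of all descents below.
\<close>

lemma tuple_regular_ext: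
  assumes "tuple_regular (length as + t) V R" "set as \<subseteq> V"
  shows "tuple_regular t (ext V R as ps) R"
  unfolding tuple_regular_def
proof (intro conjI allI impI; (elim conjE)?)
  show "finite (ext V R as ps)"
    using assms by (simp add: tuple_regular_def ext_def)
  fix xs ys qs
  assume *: "set xs \<subseteq> ext V R as ps" "set ys \<subseteq> ext V R as ps" "length xs \<le> t" "same_type R xs ys"
  show "card (ext (ext V R as ps) R xs qs) = card (ext (ext V R as ps) R ys qs)"
  proof (cases "length ps = length as")
    case True
    have "card (ext V R (as @ xs) (ps @ qs)) = card (ext V R (as @ ys) (ps @ qs))"
      using * assms(2) ext_subset[of V R as ps]
      by (intro tuple_regularD[OF assms(1)] same_type_append_ext[OF *(4,1,2)]) auto
    then show ?thesis by (simp add: ext_append True)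
  next
    case False
    then show ?thesis by (simp add: ext_length_neq) (simp add: ext_def)
  qed
qed

section \<open>Tournaments with prescribed extension numbers\<close>

definition tournament_on :: "'a set \<Rightarrow> ('a \<Rightarrow> 'a \<Rightarrow> bool) \<Rightarrow> bool" where
  "tournament_on V R \<longleftrightarrow> finite V \<and> (\<forall>x\<in>V. \<not> R x x) \<and>
     (\<forall>x\<in>V. \<forall>y\<in>V. x \<noteq> y \<longrightarrow> (R x y \<longleftrightarrow> \<not> R y x))"

lemma tournament_on_subset: "tournament_on V R \<Longrightarrow> W \<subseteq> V \<Longrightarrow> tournament_on W R"
  unfolding tournament_on_def by (meson finite_subset subsetD)

lemma tournament_on_asym: "tournament_on V R \<Longrightarrow> x \<in> V \<Longrightarrow> y \<in> V \<Longrightarrow> R x y \<Longrightarrow> \<not> R y x"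
  unfolding tournament_on_def by metis

lemma tournament_on_flip:
  "tournament_on V R \<Longrightarrow> a \<in> V \<Longrightarrow> v \<in> V \<Longrightarrow> v \<noteq> a \<Longrightarrow> R v a \<longleftrightarrow> \<not> R a v"
  unfolding tournament_on_def by metis

text \<open>
The numbers of arcs counted at their sources and at their targets agree, so the constant out-degree
and the constant in-degree are the same.
\<close>

lemma regular_tournament_degrees:
  assumes T: "tournament_on V R" and reg: "tuple_regular 1 V R" and a: "a \<in> V"
  shows "card V = 2 * card {v \<in> V. R a v} + 1" "card {v \<in> V. R v a} = card {v \<in> V. R a v}"
proof -
  have fin: "finite V" using T by (simp add: tournament_on_def)
  have ext1: "ext V R [x] [(True, False)] = {v \<in> V. R v x}"
    "ext V R [x] [(False, True)] = {v \<in> V. R x v}" if "x \<in> V" for x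
    using tournament_on_asym[OF T] that by (auto simp: ext_def)
  have "same_type R [x] [a]" if "x \<in> V" for x
    using T a that by (auto simp: same_type_def tournament_on_def)
  then have c: "card (ext V R [x] ps) = card (ext V R [a] ps)" if "x \<in> V" for x ps
    using that a by (intro tuple_regularD[OF reg]) auto
  have const: "card {v \<in> V. R v x} = card {v \<in> V. R v a}"
    "card {v \<in> V. R x v} = card {v \<in> V. R a v}" if "x \<in> V" for x
    using c[OF that, of "[(True, False)]"] c[OF that, of "[(False, True)]"]
    unfolding ext1[OF that] ext1[OF a] by simp_all
  have "(\<Sum>x\<in>V. card {v \<in> V. R v x}) = (\<Sum>x\<in>V. card {v \<in> V. R x v})"
    using sum_multicount_gen[OF fin fin, of R "\<lambda>x. card {v \<in> V. R v x}"] by simp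
  then have "card V * card {v \<in> V. R v a} = card V * card {v \<in> V. R a v}"
    using const by simp
  moreover have "card V > 0" using fin a by (auto simp: card_gt_0_iff)
  ultimately show eq: "card {v \<in> V. R v a} = card {v \<in> V. R a v}" by simp
  have "V = insert a ({v \<in> V. R v a} \<union> {v \<in> V. R a v})"
    using T a by (auto simp: tournament_on_def)
  also have "card \<dots> = Suc (card {v \<in> V. R v a} + card {v \<in> V. R a v})"
  proof (subst card_insert_disjoint)
    show "a \<notin> {v \<in> V. R v a} \<union> {v \<in> V. R a v}" using T a by (simp add: tournament_on_def)
    have "{v \<in> V. R v a} \<inter> {v \<in> V. R a v} = {}" using tournament_on_asym[OF T _ a] by blast
    then show "Suc (card ({v \<in> V. R v a} \<union> {v \<in> V. R a v})) = Suc (card {v \<in> V. R v a} + card {v \<in> V. R a v})"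
      using fin by (simp add: card_Un_disjoint)
  qed (use fin in simp)
  finally show "card V = 2 * card {v \<in> V. R a v} + 1" using eq by simp
qed

text \<open>
Every atom over at most two vertices is again a regular tournament, so it is empty or of odd size.
Parity then forces, for every arc, that only the atom of the vertices completing it to a cyclic
triangle is inhabited, and regularity makes that atom a single vertex.
\<close>

lemma tuple_regular_tournament_card:
  assumes T: "tournament_on V R" and reg: "tuple_regular 3 V R" and V: "card V \<ge> 2"
  shows "card V = 3"
proof -
  have fin: "finite V" using T by (simp add: tournament_on_def)
  obtain x y where "x \<in> V" "y \<in> V" "x \<noteq> y"
    using V card_le_Suc0_iff_eq[OF fin] by fastforce
  then obtain a b where ab: "a \<in> V" "b \<in> V" "a \<noteq> b" "R a b" "\<not> R b a"
    using T unfolding tournament_on_def by metis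
  have reg1: "tuple_regular 1 V R" using tuple_regular_mono[OF reg] by simp
  have odd_or_empty: "W = {} \<or> odd (card W)" if "tuple_regular 1 W R" "W \<subseteq> V" for W
  proof (cases "W = {}")
    case False
    then obtain c where "c \<in> W" by blast
    with regular_tournament_degrees(1)[OF tournament_on_subset[OF T that(2)] that(1)] show ?thesis by auto
  qed simp
  define n where "n p q = card {v \<in> V. v \<noteq> a \<and> v \<noteq> b \<and> (R a v \<longleftrightarrow> p) \<and> (R b v \<longleftrightarrow> q)}" for p q
  have parity: "n p q = 0 \<or> odd (n p q)" for p q
  proof -
    have "{v \<in> V. v \<noteq> a \<and> v \<noteq> b \<and> (R a v \<longleftrightarrow> p) \<and> (R b v \<longleftrightarrow> q)} =
      ext V R [a, b] [(\<not> p, p), (\<not> q, q)]"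
      using tournament_on_flip[OF T ab(1)] tournament_on_flip[OF T ab(2)] by (auto simp: ext_def)
    moreover have "tuple_regular 1 (ext V R [a, b] [(\<not> p, p), (\<not> q, q)]) R"
      using reg ab by (intro tuple_regular_ext) (simp_all add: eval_nat_numeral)
    ultimately show ?thesis unfolding n_def
      using odd_or_empty[OF _ ext_subset] by fastforce
  qed
  define d where "d = card {v \<in> V. R a v}"
  have cV: "card V = 2 * d + 1" using regular_tournament_degrees(1)[OF T reg1 ab(1)] by (simp add: d_def)
  have d: "card {v \<in> V. R a v} = d" "card {v \<in> V. R v a} = d" "card {v \<in> V. R b v} = d" "card {v \<in> V. R v b} = d"
    using regular_tournament_degrees[OF T reg1 ab(1)] regular_tournament_degrees[OF T reg1 ab(2)] cV
    by (simp_all add: d_def)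
  have nn: "n p q = card {v \<in> V. v \<noteq> a \<and> v \<noteq> b \<and> (R a v \<longleftrightarrow> p) \<and> (R b v \<longleftrightarrow> q)}" for p q
    by (simp add: n_def)
  let ?S = "\<lambda>p q. {v \<in> V. v \<noteq> a \<and> v \<noteq> b \<and> (R a v \<longleftrightarrow> p) \<and> (R b v \<longleftrightarrow> q)}"
  have finS: "finite (?S p q)" for p q using fin by simp
  have irr: "\<not> R a a" "\<not> R b b" using T ab(1,2) unfolding tournament_on_def by blast+
  have e1: "d = 1 + n True True + n True False"
  proof -
    have "{v \<in> V. R a v} = insert b (?S True True \<union> ?S True False)"
      using irr ab by auto
    also have "card \<dots> = 1 + n True True + n True False"
      unfolding nn using fin by (subst card_insert_disjoint) (auto simp: card_Un_disjoint disjoint_iff)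
    finally show ?thesis using d by simp
  qed
  have e3: "d = n True True + n False True"
  proof -
    have "{v \<in> V. R b v} = ?S True True \<union> ?S False True"
      using irr ab by auto
    also have "card \<dots> = n True True + n False True"
      unfolding nn using fin by (auto simp: card_Un_disjoint disjoint_iff)
    finally show ?thesis using d by simp
  qed
  have "odd d"
  proof -
    have "{v \<in> V. R a v} = ext V R [a] [(False, True)]"
      using tournament_on_flip[OF T ab(1)] irr by (auto simp: ext_def)
    moreover have "tuple_regular 1 (ext V R [a] [(False, True)]) R"
      using tuple_regular_mono[OF reg, of 2] ab by (intro tuple_regular_ext) (simp_all add: eval_nat_numeral)
    moreover have "b \<in> {v \<in> V. R a v}" using ab by simp
    ultimately show ?thesis unfolding d_def
      using odd_or_empty[OF _ ext_subset] by fastforce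
  qed
  \<comment> \<open>The vertices \<open>v\<close> with \<open>b \<rightarrow> v \<rightarrow> a\<close> are one more than those with \<open>a \<rightarrow> v \<rightarrow> b\<close>, so there are an odd number of the former and an even number of the latter.\<close>
  have "n False True = 1 + n True False" using e1 e3 by simp
  then have "n True False = 0" using parity[of False True] parity[of True False] by presburger
  moreover have "n True True = 0" using calculation \<open>odd d\<close> e1 parity[of True True] by presburger
  ultimately show ?thesis using cV e1 by simp
qed

section \<open>Counting common neighbours\<close>

definition graph_on :: "'a set \<Rightarrow> ('a \<Rightarrow> 'a \<Rightarrow> bool) \<Rightarrow> bool" where
  "graph_on V R \<longleftrightarrow> finite V \<and> (\<forall>x\<in>V. \<not> R x x) \<and> (\<forall>x\<in>V. \<forall>y\<in>V. R x y \<longrightarrow> R y x)"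

text \<open>
The entries of the adjacency matrix, as integers, so that counts become sums of products.
\<close>

definition adj :: "('a \<Rightarrow> 'a \<Rightarrow> bool) \<Rightarrow> 'a \<Rightarrow> 'a \<Rightarrow> int" where
  "adj R x y = of_bool (R x y)"

text \<open>
Strong regularity. It is also satisfied by complete and empty graphs, with \<open>m\<close> respectively \<open>l\<close>
arbitrary.
\<close>

definition srg :: "'a set \<Rightarrow> ('a \<Rightarrow> 'a \<Rightarrow> bool) \<Rightarrow> int \<Rightarrow> int \<Rightarrow> int \<Rightarrow> bool" where
  "srg V R k l m \<longleftrightarrow>
     (\<forall>x\<in>V. (\<Sum>v\<in>V. adj R x v) = k) \<and>
     (\<forall>x\<in>V. \<forall>y\<in>V. x \<noteq> y \<longrightarrow> (\<Sum>v\<in>V. adj R x v * adj R y v) = (if R x y then l else m))"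

text \<open>
The number of common neighbours of three vertices shall depend only on how many edges they span,
which determines the induced graph up to isomorphism.
\<close>

definition triple_counts :: "'a set \<Rightarrow> ('a \<Rightarrow> 'a \<Rightarrow> bool) \<Rightarrow> (nat \<Rightarrow> int) \<Rightarrow> bool" where
  "triple_counts V R t \<longleftrightarrow>
     (\<forall>x\<in>V. \<forall>y\<in>V. \<forall>z\<in>V. x \<noteq> y \<and> x \<noteq> z \<and> y \<noteq> z \<longrightarrow>
        (\<Sum>v\<in>V. adj R x v * adj R y v * adj R z v) =
          t (of_bool (R x y) + of_bool (R x z) + of_bool (R y z)))"

definition compl :: "('a \<Rightarrow> 'a \<Rightarrow> bool) \<Rightarrow> 'a \<Rightarrow> 'a \<Rightarrow> bool" where
  "compl R x y \<longleftrightarrow> x \<noteq> y \<and> \<not> R x y"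

definition nb :: "'a set \<Rightarrow> ('a \<Rightarrow> 'a \<Rightarrow> bool) \<Rightarrow> 'a \<Rightarrow> 'a set" where
  "nb V R a = {v \<in> V. R a v}"

text \<open>
The two subconstituents at \<open>a\<close> are its neighbourhood \<open>nb V R a\<close> and its set of nonneighbours
\<open>conb V R a\<close>.
\<close>

abbreviation conb :: "'a set \<Rightarrow> ('a \<Rightarrow> 'a \<Rightarrow> bool) \<Rightarrow> 'a \<Rightarrow> 'a set" where
  "conb V R \<equiv> nb V (compl R)"

definition has_path :: "'a set \<Rightarrow> ('a \<Rightarrow> 'a \<Rightarrow> bool) \<Rightarrow> bool" where
  "has_path V R \<longleftrightarrow> (\<exists>x\<in>V. \<exists>y\<in>V. \<exists>z\<in>V. y \<noteq> z \<and> R x y \<and> R x z \<and> \<not> R y z)"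

definition has_tri :: "'a set \<Rightarrow> ('a \<Rightarrow> 'a \<Rightarrow> bool) \<Rightarrow> bool" where
  "has_tri V R \<longleftrightarrow> (\<exists>x\<in>V. \<exists>y\<in>V. \<exists>z\<in>V. R x y \<and> R x z \<and> R y z)"

text \<open>
The absence of an induced path on three vertices (\<open>has_path\<close>) means that adjacency is an equivalence relation up to
equality, and dually for the complement. A triangle of the complement (\<open>has_tri V (compl R)\<close>) is a
coclique of size three.
\<close>

definition nondeg :: "'a set \<Rightarrow> ('a \<Rightarrow> 'a \<Rightarrow> bool) \<Rightarrow> bool" where
  "nondeg V R \<longleftrightarrow> has_path V R \<and> has_path V (compl R)"

lemma graph_onD:
  assumes "graph_on V R"
  shows "finite V" "x \<in> V \<Longrightarrow> \<not> R x x" "x \<in> V \<Longrightarrow> y \<in> V \<Longrightarrow> R x y \<longleftrightarrow> R y x"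
    "x \<in> V \<Longrightarrow> adj R x x = 0" "x \<in> V \<Longrightarrow> y \<in> V \<Longrightarrow> adj R x y = adj R y x"
  using assms by (auto simp: graph_on_def adj_def)

lemma graph_on_subset: "graph_on V R \<Longrightarrow> W \<subseteq> V \<Longrightarrow> graph_on W R"
  unfolding graph_on_def by (meson finite_subset subsetD)

lemma adj_sq [simp]: "adj R x y * adj R x y = adj R x y"
  by (simp add: adj_def)

lemma adj_simps: "R x y \<Longrightarrow> adj R x y = 1" "\<not> R x y \<Longrightarrow> adj R x y = 0"
  by (auto simp: adj_def)

lemma nb_subset: "nb V R a \<subseteq> V" by (auto simp: nb_def)

lemma graph_on_compl: "graph_on V R \<Longrightarrow> graph_on V (compl R)"
  by (auto simp: graph_on_def compl_def)

lemma compl_compl: "graph_on V R \<Longrightarrow> x \<in> V \<Longrightarrow> y \<in> V \<Longrightarrow> compl (compl R) x y \<longleftrightarrow> R x y"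
  by (auto simp: graph_on_def compl_def)

lemma adj_compl: "graph_on V R \<Longrightarrow> x \<in> V \<Longrightarrow> y \<in> V \<Longrightarrow>
  adj (compl R) x y = 1 - adj R x y - of_bool (x = y)"
  by (auto simp: graph_on_def compl_def adj_def)

lemma sum_nb: "finite V \<Longrightarrow> (\<Sum>v\<in>nb V R a. f v) = (\<Sum>v\<in>V. adj R a v * f v)"
  unfolding nb_def adj_def
  by (simp add: Int_def)

lemma sum_delta_int: "finite V \<Longrightarrow> a \<in> V \<Longrightarrow> (\<Sum>v\<in>V. of_bool (v = a) * f v) = (f a :: int)"
  by (simp add: of_bool_def if_distrib[of "\<lambda>x. x * _"] sum.delta cong: if_cong)

text \<open>
The matrix equation \<open>A\<^sup>2 = m J + (l - m) A + (k - m) I\<close>.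
\<close>

lemma srg_sum:
  assumes "graph_on V R" "srg V R k l m" "x \<in> V" "y \<in> V"
  shows "(\<Sum>v\<in>V. adj R x v * adj R y v) = m + (l - m) * adj R x y + (k - m) * of_bool (x = y)"
proof (cases "x = y")
  case True
  then show ?thesis using assms by (simp add: srg_def graph_onD(4))
next
  case False
  then show ?thesis using assms by (auto simp: srg_def adj_def)
qed

text \<open>
Let \<open>g\<close> be the indicator function of the common neighbours of \<open>a\<close> and \<open>x\<close>. If triples have prescribed
numbers of common neighbours, then the adjacency matrix \<open>A\<close> maps \<open>g\<close> to a combination of \<open>1\<close>, of the
rows of \<open>a\<close> and \<open>x\<close>, of \<open>g\<close> and of the unit vectors at \<open>a\<close> and \<open>x\<close>. The identity evaluates \<open>A\<^sup>2 g\<close> at \<open>u\<close>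
in two ways, once through \<open>A g\<close> and once through the quadratic equation of \<open>A\<close>.
\<close>

lemma common_neighbour_identity:
  assumes G: "graph_on V R" and S: "srg V R k l m"
    and ax: "a \<in> V" "x \<in> V" "a \<noteq> x"
    and g: "g = (\<Sum>v\<in>V. adj R a v * adj R x v)"
    and T: "\<forall>w\<in>V. w \<noteq> a \<and> w \<noteq> x \<longrightarrow>
      (\<Sum>v\<in>V. adj R w v * (adj R a v * adj R x v)) =
        d0 + d1 * (adj R a w + adj R x w) + d2 * (adj R a w * adj R x w)"
    and u: "u \<in> V" "u \<noteq> a" "u \<noteq> x"
  shows "(k - m) * (adj R a u * adj R x u)
      + (l - m) * (\<Sum>v\<in>V. adj R u v * (adj R a v * adj R x v)) + m * g =
    d0 * k + d1 * (2 * m + (l - m) * (adj R a u + adj R x u))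
      + d2 * (\<Sum>v\<in>V. adj R u v * (adj R a v * adj R x v))
      + (g - d0 - d1 * adj R a x) * (adj R a u + adj R x u)"
proof -
  have fin: "finite V" using G by (simp add: graph_on_def)
  let ?A = "adj R"
  define h where "h v = ?A a v * ?A x v" for v
  let ?T = "\<lambda>w. \<Sum>v\<in>V. ?A w v * h v"
  define d3 where "d3 = g - d0 - d1 * ?A a x"
  have Tw: "?T w = d0 + d1 * (?A a w + ?A x w) + d2 * h w + d3 * (of_bool (w = a) + of_bool (w = x))"
    if w: "w \<in> V" for w
  proof -
    consider "w = a" | "w = x" | "w \<noteq> a" "w \<noteq> x" by blast
    then show ?thesis
    proof cases
      case 1
      have "?T a = g" unfolding g h_def by (intro sum.cong refl) (simp add: mult.assoc[symmetric])
      then show ?thesis using 1 ax graph_onD(4,5)[OF G] by (simp add: d3_def h_def)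
    next
      case 2
      have "?T x = g" unfolding g h_def
        by (intro sum.cong refl) (simp add: mult.left_commute[of "?A x _" "?A a _"])
      then show ?thesis using 2 ax graph_onD(4)[OF G] by (simp add: d3_def h_def)
    next
      case 3
      then show ?thesis using T w by (simp add: h_def)
    qed
  qed
  have "(\<Sum>w\<in>V. ?A u w * ?T w) = (\<Sum>v\<in>V. (\<Sum>w\<in>V. ?A u w * ?A v w) * h v)"
  proof -
    have "(\<Sum>w\<in>V. ?A u w * ?T w) = (\<Sum>w\<in>V. \<Sum>v\<in>V. ?A u w * ?A w v * h v)"
      by (simp add: sum_distrib_left mult.assoc)
    also have "\<dots> = (\<Sum>v\<in>V. \<Sum>w\<in>V. ?A u w * ?A w v * h v)" by (rule sum.swap)
    also have "\<dots> = (\<Sum>v\<in>V. (\<Sum>w\<in>V. ?A u w * ?A v w) * h v)"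
      using graph_onD(5)[OF G] by (auto simp: sum_distrib_right intro!: sum.cong)
    finally show ?thesis .
  qed
  also have "\<dots> = (\<Sum>v\<in>V. m * h v + (l - m) * (?A u v * h v) + (k - m) * (of_bool (v = u) * h v))"
  proof (intro sum.cong refl)
    fix v assume "v \<in> V"
    show "(\<Sum>w\<in>V. ?A u w * ?A v w) * h v =
      m * h v + (l - m) * (?A u v * h v) + (k - m) * (of_bool (v = u) * h v)"
      unfolding srg_sum[OF G S u(1) \<open>v \<in> V\<close>] by (cases "u = v") (simp_all add: algebra_simps)
  qed
  also have "\<dots> = m * g + (l - m) * ?T u + (k - m) * h u"
    using sum_delta_int[OF fin u(1), of h]
    by (simp add: sum.distrib sum_distrib_left[symmetric] g h_def)
  finally have 1: "(\<Sum>w\<in>V. ?A u w * ?T w) = m * g + (l - m) * ?T u + (k - m) * h u" .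
  have "(\<Sum>w\<in>V. ?A u w * ?T w) = (\<Sum>w\<in>V. d0 * ?A u w + d1 * (?A u w * ?A a w) + d1 * (?A u w * ?A x w)
     + d2 * (?A u w * h w) + d3 * (of_bool (w = a) * ?A u w) + d3 * (of_bool (w = x) * ?A u w))"
    by (intro sum.cong refl) (simp only: Tw, simp only: algebra_simps)
  also have "\<dots> = d0 * k + d1 * (m + (l - m) * ?A a u) + d1 * (m + (l - m) * ?A x u)
     + d2 * ?T u + d3 * ?A a u + d3 * ?A x u"
  proof -
    have 1: "(\<Sum>w\<in>V. ?A u w * ?A y w) = m + (l - m) * ?A y u" if "y \<in> V" "u \<noteq> y" for y
      using srg_sum[OF G S u(1) that(1)] that(2) graph_onD(5)[OF G u(1) that(1)] by simp
    have 2: "(\<Sum>w\<in>V. of_bool (w = y) * ?A u w) = ?A y u" if "y \<in> V" for y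
      using sum_delta_int[OF fin that, of "?A u"] graph_onD(5)[OF G u(1) that] by simp
    have 3: "(\<Sum>w\<in>V. ?A u w) = k" using S u by (simp add: srg_def)
    show ?thesis
      by (simp only: sum.distrib sum_distrib_left[symmetric] 3 1[OF ax(1) u(2)] 1[OF ax(2) u(3)]
          2[OF ax(1)] 2[OF ax(2)])
  qed
  finally show ?thesis using 1 unfolding h_def d3_def by (simp add: algebra_simps)
qed

text \<open>
Comparing the identity at the three possible positions of \<open>u\<close> (adjacent to both, to one, to none of
\<open>a\<close> and \<open>x\<close>) shows that the second difference \<open>d2\<close> of the triple counts is an eigenvalue of the graph.
\<close>

lemma second_difference_eigenvalue:
  assumes G: "graph_on V R" and S: "srg V R k l m" and t: "triple_counts V R t"
    and ax: "a \<in> V" "x \<in> V" "a \<noteq> x"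
    and e: "e = of_bool (R a x)" and g: "g = (if R a x then l else m)"
    and d: "d0 = t e" "d1 = t (Suc e) - t e" "d2 = t (Suc (Suc e)) - 2 * t (Suc e) + t e"
    and u11: "\<exists>u\<in>V. R a u \<and> R x u"
    and u10: "\<exists>u\<in>V. u \<noteq> x \<and> R a u \<and> \<not> R x u"
    and u00: "\<exists>u\<in>V. u \<noteq> a \<and> u \<noteq> x \<and> \<not> R a u \<and> \<not> R x u"
  shows "d2 * d2 = (l - m) * d2 + (k - m)"
    "g - d0 - d1 * of_bool (R a x) = - d1 * d2"
    "(l - m) * d0 + m * g = d0 * k + 2 * d1 * m + d2 * d0"
proof -
  let ?A = "adj R"
  have g': "g = (\<Sum>v\<in>V. ?A a v * ?A x v)" using S ax g by (simp add: srg_def)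
  have T: "(\<Sum>v\<in>V. ?A w v * (?A a v * ?A x v)) =
        d0 + d1 * (?A a w + ?A x w) + d2 * (?A a w * ?A x w)"
    if "w \<in> V" "w \<noteq> a" "w \<noteq> x" for w
  proof -
    have "(\<Sum>v\<in>V. ?A w v * (?A a v * ?A x v)) = (\<Sum>v\<in>V. ?A a v * ?A x v * ?A w v)"
      by (simp add: mult.commute)
    also have "\<dots> = t (of_bool (R a x) + of_bool (R a w) + of_bool (R x w))"
      using t ax that unfolding triple_counts_def by metis
    finally show ?thesis by (auto simp: d e adj_def)
  qed
  then have "\<forall>w\<in>V. w \<noteq> a \<and> w \<noteq> x \<longrightarrow> (\<Sum>v\<in>V. ?A w v * (?A a v * ?A x v)) =
        d0 + d1 * (?A a w + ?A x w) + d2 * (?A a w * ?A x w)" by blast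
  note id = common_neighbour_identity[OF G S ax g' this]
  obtain u1 where u1: "u1 \<in> V" "R a u1" "R x u1" using u11 by blast
  obtain u2 where u2: "u2 \<in> V" "u2 \<noteq> x" "R a u2" "\<not> R x u2" using u10 by blast
  obtain u3 where u3: "u3 \<in> V" "u3 \<noteq> a" "u3 \<noteq> x" "\<not> R a u3" "\<not> R x u3" using u00 by blast
  have ne: "u1 \<noteq> a" "u1 \<noteq> x" "u2 \<noteq> a" using u1 u2 ax graph_onD(2)[OF G] by auto
  have i1: "(k - m) + (l - m) * (d0 + 2 * d1 + d2) + m * g =
      d0 * k + d1 * (2 * l) + d2 * (d0 + 2 * d1 + d2) + (g - d0 - d1 * ?A a x) * 2"
    using id[OF u1(1) ne(1,2)] T[OF u1(1) ne(1,2)] u1 by (simp add: adj_simps algebra_simps)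
  have i2: "(l - m) * (d0 + d1) + m * g =
      d0 * k + d1 * (m + l) + d2 * (d0 + d1) + (g - d0 - d1 * ?A a x)"
    using id[OF u2(1) ne(3) u2(2)] T[OF u2(1) ne(3) u2(2)] u2 by (simp add: adj_simps algebra_simps)
  have i3: "(l - m) * d0 + m * g = d0 * k + 2 * d1 * m + d2 * d0"
    using id[OF u3(1-3)] T[OF u3(1-3)] u3 by (simp add: adj_simps algebra_simps)
  show "(l - m) * d0 + m * g = d0 * k + 2 * d1 * m + d2 * d0" by (rule i3)
  have A: "?A a x = of_bool (R a x)" by (simp add: adj_def)
  show *: "g - d0 - d1 * of_bool (R a x) = - d1 * d2" using i2 i3 unfolding A by (simp add: algebra_simps)
  show "d2 * d2 = (l - m) * d2 + (k - m)" using i1 i2 i3 * unfolding A by (simp add: algebra_simps)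
qed

section \<open>Regularity of subconstituents and complements\<close>

lemma const_on_ex: "(\<And>x y. x \<in> S \<Longrightarrow> y \<in> S \<Longrightarrow> f x = f y) \<Longrightarrow> \<exists>k. \<forall>x\<in>S. f x = k"
  by metis

lemma tuple_regular_common:
  assumes G: "graph_on V R" and reg: "tuple_regular t V R"
    and xs: "set xs \<subseteq> V" "set ys \<subseteq> V" "length xs \<le> t" "same_type R xs ys"
  shows "card {v \<in> V. \<forall>x\<in>set xs. R x v} = card {v \<in> V. \<forall>x\<in>set ys. R x v}"
proof -
  have rep: "list_all2 P zs (replicate (length zs) c) \<longleftrightarrow> (\<forall>x\<in>set zs. P x c)" for P zs and c :: "bool \<times> bool"
    by (induction zs) auto
  have "v \<noteq> x \<and> (R v x, R x v) = (True, True) \<longleftrightarrow> R x v" if "v \<in> V" "x \<in> V" for x v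
    using graph_onD(2)[OF G that(1)] graph_onD(3)[OF G that] by auto
  then have "ext V R zs (replicate (length zs) (True, True)) = {v \<in> V. \<forall>x\<in>set zs. R x v}"
    if "set zs \<subseteq> V" for zs
    using that unfolding ext_def rep by blast
  from this[OF xs(1)] this[OF xs(2)] show ?thesis
    using tuple_regularD[OF reg xs, of "replicate (length xs) (True, True)"] xs(4)
    by (simp add: same_type_def)
qed

lemma same_type_graph:
  assumes G: "graph_on V R" and "set xs \<subseteq> V" "set ys \<subseteq> V" "distinct xs" "distinct ys"
    and len: "length xs = length ys"
    and R: "\<And>i j. i < j \<Longrightarrow> j < length xs \<Longrightarrow> R (xs ! i) (xs ! j) \<longleftrightarrow> R (ys ! i) (ys ! j)"
  shows "same_type R xs ys"
proof -
  have "R (xs ! i) (xs ! j) \<longleftrightarrow> R (ys ! i) (ys ! j)" if ij: "i < length xs" "j < length xs" for i j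
  proof -
    have V: "xs ! i \<in> V" "xs ! j \<in> V" "ys ! i \<in> V" "ys ! j \<in> V"
      using assms(2,3) ij len by auto
    consider "i < j" | "j < i" | "i = j" by linarith
    then show ?thesis
      by cases (use R ij graph_onD(3)[OF G V(1,2)] graph_onD(3)[OF G V(3,4)] graph_onD(2)[OF G V(1)]
          graph_onD(2)[OF G V(3)] in blast)+
  qed
  then show ?thesis
    using assms(4,5) len by (auto simp: same_type_def nth_eq_iff_index_eq)
qed

lemma sum_adj_card:
  assumes "finite V"
  shows "(\<Sum>v\<in>V. adj R x v) = int (card {v \<in> V. R x v})"
    "(\<Sum>v\<in>V. adj R x v * adj R y v) = int (card {v \<in> V. R x v \<and> R y v})"
    "(\<Sum>v\<in>V. adj R x v * adj R y v * adj R z v) = int (card {v \<in> V. R x v \<and> R y v \<and> R z v})"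
  using assms by (simp_all add: adj_def of_bool_conj[symmetric] Int_def conj_assoc)

lemma tuple_regular_srg:
  assumes G: "graph_on V R" and reg: "tuple_regular 2 V R"
  shows "\<exists>k l m. srg V R k l m"
proof -
  have fin: "finite V" using G by (simp add: graph_on_def)
  note c = tuple_regular_common[OF G reg]
  have "\<exists>k. \<forall>x\<in>V. (\<Sum>v\<in>V. adj R x v) = k"
  proof (rule const_on_ex)
    fix x y assume "x \<in> V" "y \<in> V"
    then show "(\<Sum>v\<in>V. adj R x v) = (\<Sum>v\<in>V. adj R y v)"
      using c[of "[x]" "[y]"] graph_onD(2)[OF G] by (simp add: sum_adj_card fin same_type_def)
  qed
  then obtain k where k: "\<forall>x\<in>V. (\<Sum>v\<in>V. adj R x v) = k" by blast
  have "\<exists>l. \<forall>p\<in>{p \<in> V \<times> V. fst p \<noteq> snd p \<and> R (fst p) (snd p) = b}.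
      (\<Sum>v\<in>V. adj R (fst p) v * adj R (snd p) v) = l" for b
  proof (rule const_on_ex)
    fix p q assume p: "p \<in> {p \<in> V \<times> V. fst p \<noteq> snd p \<and> R (fst p) (snd p) = b}"
      and q: "q \<in> {p \<in> V \<times> V. fst p \<noteq> snd p \<and> R (fst p) (snd p) = b}"
    then have "same_type R [fst p, snd p] [fst q, snd q]"
      by (intro same_type_graph[OF G]) (auto simp: less_Suc_eq)
    then show "(\<Sum>v\<in>V. adj R (fst p) v * adj R (snd p) v) = (\<Sum>v\<in>V. adj R (fst q) v * adj R (snd q) v)"
      using c[of "[fst p, snd p]" "[fst q, snd q]"] p q by (auto simp: sum_adj_card fin)
  qed
  then have "\<exists>l. \<forall>b. \<forall>p\<in>{p \<in> V \<times> V. fst p \<noteq> snd p \<and> R (fst p) (snd p) = b}.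
      (\<Sum>v\<in>V. adj R (fst p) v * adj R (snd p) v) = l b"
    by (intro choice allI)
  then obtain l where l: "\<And>b. \<forall>p\<in>{p \<in> V \<times> V. fst p \<noteq> snd p \<and> R (fst p) (snd p) = b}.
      (\<Sum>v\<in>V. adj R (fst p) v * adj R (snd p) v) = l b"
    by blast
  have "srg V R k (l True) (l False)"
    using k l[of True] l[of False] by (auto simp: srg_def)
  then show ?thesis by blast
qed

text \<open>
Two triples spanning the same number of edges have the same type after a permutation of one of them,
and the number of common neighbours is invariant under permutations.
\<close>

lemma tuple_regular_triple_counts:
  assumes G: "graph_on V R" and reg: "tuple_regular 3 V R"
  shows "\<exists>t. triple_counts V R t"
proof -
  have fin: "finite V" using G by (simp add: graph_on_def)
  define T where "T x y z = (\<Sum>v\<in>V. adj R x v * adj R y v * adj R z v)" for x y z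
  define N where "N x y z = (of_bool (R x y) + of_bool (R x z) + of_bool (R y z) :: nat)" for x y z
  define D where "D x y z \<longleftrightarrow> x \<in> V \<and> y \<in> V \<and> z \<in> V \<and> x \<noteq> y \<and> x \<noteq> z \<and> y \<noteq> z" for x y z
  have st: "T x y z = T a b c"
    if "D x y z" "D a b c" "R x y = R a b" "R x z = R a c" "R y z = R b c" for x y z a b c
  proof -
    have "same_type R [x, y, z] [a, b, c]"
      using that by (intro same_type_graph[OF G]) (auto simp: less_Suc_eq D_def numeral_3_eq_3)
    then show ?thesis
      using tuple_regular_common[OF G reg, of "[x, y, z]" "[a, b, c]"] that
      by (simp add: T_def D_def sum_adj_card fin)
  qed
  have perm: "T x y z = T y x z" "T x y z = T x z y" for x y z
    unfolding T_def by (auto intro!: sum.cong)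
  have "T x y z = T a b c" if d: "D x y z" "D a b c" "N x y z = N a b c" for x y z a b c
  proof -
    have dd: "D a c b" "D b a c" "D b c a" "D c a b" "D c b a" using d by (auto simp: D_def)
    have sym: "R b a = R a b" "R c a = R a c" "R c b = R b c"
      using d graph_onD(3)[OF G] by (auto simp: D_def)
    have p: "T a c b = T a b c" "T b a c = T a b c" "T b c a = T a b c" "T c a b = T a b c" "T c b a = T a b c"
      using perm by metis+
    show ?thesis
      using st[OF d(1,2)] st[OF d(1) dd(1)] st[OF d(1) dd(2)] st[OF d(1) dd(3)] st[OF d(1) dd(4)]
        st[OF d(1) dd(5)] d(3) unfolding N_def p sym
      by (cases "R x y"; cases "R x z"; cases "R y z"; cases "R a b"; cases "R a c"; cases "R b c") simp_all
  qed
  then have TT: "\<And>x y z a b c. D x y z \<Longrightarrow> D a b c \<Longrightarrow> N x y z = N a b c \<Longrightarrow> T x y z = T a b c" .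
  have "\<exists>k. \<forall>p\<in>{(x, y, z). D x y z \<and> N x y z = j}. (case p of (x, y, z) \<Rightarrow> T x y z) = k" for j
  proof (rule const_on_ex)
    fix p q assume *: "p \<in> {(x, y, z). D x y z \<and> N x y z = j}" "q \<in> {(x, y, z). D x y z \<and> N x y z = j}"
    obtain x y z a b c where "p = (x, y, z)" "q = (a, b, c)" by (cases p; cases q) auto
    then show "(case p of (x, y, z) \<Rightarrow> T x y z) = (case q of (x, y, z) \<Rightarrow> T x y z)"
      using * TT[of x y z a b c] by simp
  qed
  then have "\<exists>t. \<forall>j. \<forall>p\<in>{(x, y, z). D x y z \<and> N x y z = j}. (case p of (x, y, z) \<Rightarrow> T x y z) = t j"
    by (intro choice allI)
  then obtain t where "\<forall>j. \<forall>p\<in>{(x, y, z). D x y z \<and> N x y z = j}. (case p of (x, y, z) \<Rightarrow> T x y z) = t j"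
    by blast
  then have "T x y z = t (N x y z)" if "D x y z" for x y z
    using that by fastforce
  then have "triple_counts V R t"
    by (auto simp: triple_counts_def T_def N_def D_def)
  then show ?thesis by blast
qed

lemma nb_eq_ext:
  assumes "graph_on V R" "a \<in> V"
  shows "nb V R a = ext V R [a] [(True, True)]" "conb V R a = ext V R [a] [(False, False)]"
  using assms graph_onD(2,3)[OF assms(1)] by (auto simp: nb_def ext_def compl_def)

lemma tuple_regular_nb:
  assumes "graph_on V R" "a \<in> V" "tuple_regular (Suc t) V R"
  shows "tuple_regular t (nb V R a) R" "tuple_regular t (conb V R a) R"
  unfolding nb_eq_ext[OF assms(1,2)] using assms by (auto intro!: tuple_regular_ext)

lemma tuple_regular_compl:
  assumes G: "graph_on V R" and reg: "tuple_regular t V R"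
  shows "tuple_regular t V (compl R)"
proof -
  let ?n = "map (\<lambda>(p, q). (\<not> p, \<not> q))"
  have "v \<noteq> x \<and> (compl R v x, compl R x v) = p \<longleftrightarrow>
      v \<noteq> x \<and> (R v x, R x v) = (case p of (p, q) \<Rightarrow> (\<not> p, \<not> q))" for v x p
    by (cases p) (auto simp: compl_def)
  then have e: "ext V (compl R) xs ps = ext V R xs (?n ps)" for xs ps
    by (simp only: ext_def list_all2_map2)
  have "same_type R xs ys" if "set xs \<subseteq> V" "set ys \<subseteq> V" "same_type (compl R) xs ys" for xs ys
  proof -
    have "xs ! i \<in> V" "ys ! i \<in> V" if "i < length xs" for i
      using that \<open>set xs \<subseteq> V\<close> \<open>set ys \<subseteq> V\<close> \<open>same_type (compl R) xs ys\<close> by (auto simp: same_type_def)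
    then show ?thesis
      using that(3) graph_onD(2)[OF G] unfolding same_type_def compl_def by metis
  qed
  then show ?thesis
    using reg by (auto simp: tuple_regular_def e)
qed

section \<open>Parameters of nondegenerate graphs\<close>

text \<open>
Strongly regular graphs in terms of \<open>m\<close> and of the two roots \<open>e\<close>, \<open>f\<close> of \<open>X\<^sup>2 = (l - m) X + (k - m)\<close>,
which are the eigenvalues of the adjacency matrix on vectors with sum zero.
\<close>

abbreviation srgp :: "'a set \<Rightarrow> ('a \<Rightarrow> 'a \<Rightarrow> bool) \<Rightarrow> int \<Rightarrow> int \<Rightarrow> int \<Rightarrow> bool" where
  "srgp V R m e f \<equiv> srg V R (m - e * f) (m + e + f) m"

lemma sum_of_bool_eq_one: "finite V \<Longrightarrow> x \<in> V \<Longrightarrow> (\<Sum>v\<in>V. of_bool (x = v)) = (1::int)"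
  using sum_delta_int[of V x "\<lambda>_. 1"] by (simp add: eq_commute)

lemma srg_compl:
  assumes G: "graph_on V R" and S: "srg V R k l m" and n: "n = int (card V)"
  shows "srg V (compl R) (n - 1 - k) (n - 2 - 2 * k + m) (n - 2 * k + l)"
proof -
  have fin: "finite V" using G by (simp add: graph_on_def)
  let ?A = "adj R"
  note one = sum_of_bool_eq_one[OF fin]
  have d: "(\<Sum>v\<in>V. adj (compl R) x v) = n - 1 - k" if x: "x \<in> V" for x
  proof -
    have "(\<Sum>v\<in>V. adj (compl R) x v) = (\<Sum>v\<in>V. 1 - ?A x v - of_bool (x = v))"
      using x by (intro sum.cong refl) (simp add: adj_compl[OF G])
    also have "\<dots> = n - k - 1"
      unfolding sum_subtractf one[OF x] using S x n by (simp add: srg_def)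
    finally show ?thesis by simp
  qed
  have "(\<Sum>v\<in>V. adj (compl R) x v * adj (compl R) y v) = n - 2 - 2 * k +
     (\<Sum>v\<in>V. ?A x v * ?A y v) + 2 * ?A x y" if xy: "x \<in> V" "y \<in> V" "x \<noteq> y" for x y
  proof -
    have "(\<Sum>v\<in>V. adj (compl R) x v * adj (compl R) y v) =
      (\<Sum>v\<in>V. 1 - ?A x v - ?A y v - of_bool (x = v) - of_bool (y = v) + ?A x v * ?A y v
         + (of_bool (v = y) * ?A x v + of_bool (v = x) * ?A y v))"
      using xy by (intro sum.cong refl) (auto simp: adj_compl[OF G] algebra_simps)
    also have "\<dots> = n - k - k - 1 - 1 + (\<Sum>v\<in>V. ?A x v * ?A y v) + (?A x y + ?A y x)"
      unfolding sum_subtractf sum.distrib one[OF xy(1)] one[OF xy(2)]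
        sum_delta_int[OF fin xy(1)] sum_delta_int[OF fin xy(2)]
      using S xy n by (simp add: srg_def)
    finally show ?thesis using graph_onD(5)[OF G xy(1,2)] by simp
  qed
  then show ?thesis using S d unfolding srg_def by (auto simp: compl_def adj_def)
qed

lemma srg_card:
  assumes G: "graph_on V R" and S: "srg V R k l m" and V: "x \<in> V"
  shows "k * (k - 1 - l) = (int (card V) - 1 - k) * m"
proof -
  have fin: "finite V" using G by (simp add: graph_on_def)
  let ?A = "adj R"
  have k: "(\<Sum>y\<in>V. ?A v y) = k" if "v \<in> V" for v using S that by (simp add: srg_def)
  have "(\<Sum>y\<in>V. \<Sum>v\<in>V. ?A x v * ?A y v) = (\<Sum>v\<in>V. ?A x v * (\<Sum>y\<in>V. ?A v y))"
    using graph_onD(5)[OF G] by (subst sum.swap) (auto simp: sum_distrib_left intro!: sum.cong)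
  also have "\<dots> = k * k" using k V by (simp add: sum_distrib_right[symmetric])
  also have "(\<Sum>y\<in>V. \<Sum>v\<in>V. ?A x v * ?A y v) =
      (\<Sum>y\<in>V. m + (l - m) * ?A x y + (k - m) * of_bool (x = y))"
    using srg_sum[OF G S V] by (intro sum.cong refl) auto
  also have "\<dots> = int (card V) * m + (l - m) * k + (k - m)"
    using V k by (simp add: sum.distrib sum_distrib_left[symmetric] sum_of_bool_eq_one[OF fin])
  finally show ?thesis by (simp add: algebra_simps)
qed

lemma nondeg_compl: "graph_on V R \<Longrightarrow> nondeg V R \<Longrightarrow> nondeg V (compl R)"
  unfolding nondeg_def has_path_def by (simp add: compl_compl cong: bex_cong)

lemma srg_unique:
  assumes "nondeg V R" "srg V R k l m" "srg V R k' l' m'"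
  shows "k = k'" "l = l'" "m = m'"
proof -
  obtain x y z where *: "x \<in> V" "y \<in> V" "z \<in> V" "y \<noteq> z" "R x y" "\<not> R y z" 
    using assms(1) unfolding nondeg_def has_path_def by metis
  obtain u v w where "u \<in> V" "v \<in> V" "w \<in> V" "compl R u v" "compl R u w" "v \<noteq> w" "\<not> compl R v w"
    using assms(1) unfolding nondeg_def has_path_def by blast
  then have **: "v \<in> V" "w \<in> V" "v \<noteq> w" "R v w" by (auto simp: compl_def)
  show "k = k'" using assms(2,3) * unfolding srg_def by metis
  show "m = m'" using assms(2,3) * unfolding srg_def by metis
  show "l = l'" using assms(2,3) ** unfolding srg_def by metis
qed

lemma srg_path_bound:
  assumes G: "graph_on V R" and S: "srg V R k l m" and P: "has_path V R"
  shows "0 < m" "l + 1 < k"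
proof -
  have fin: "finite V" using G by (simp add: graph_on_def)
  obtain x y z where *: "x \<in> V" "y \<in> V" "z \<in> V" "y \<noteq> z" "R x y" "R x z" "\<not> R y z"
    using P unfolding has_path_def by blast
  then have ne: "x \<noteq> y" "x \<noteq> z" and sy: "R y x" "R z x" using graph_onD(2,3)[OF G] by blast+
  have "x \<in> {v \<in> V. R y v \<and> R z v}" using * sy by simp
  then have "0 < card {v \<in> V. R y v \<and> R z v}" using fin by (auto simp: card_gt_0_iff)
  moreover have "int (card {v \<in> V. R y v \<and> R z v}) = m"
    using S * unfolding srg_def sum_adj_card[OF fin] by metis
  ultimately show "0 < m" by linarith
  have "insert y (insert z {v \<in> V. R x v \<and> R y v}) \<subseteq> {v \<in> V. R x v}" using * by auto
  then have "card (insert y (insert z {v \<in> V. R x v \<and> R y v})) \<le> card {v \<in> V. R x v}"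
    using fin by (intro card_mono) auto
  then have "card {v \<in> V. R x v \<and> R y v} + 2 \<le> card {v \<in> V. R x v}"
    using fin * graph_onD(2)[OF G *(2)] by simp
  then show "l + 1 < k" using S * ne unfolding srg_def sum_adj_card[OF fin] by fastforce
qed

lemma srg_nondeg_bounds:
  assumes G: "graph_on V R" and S: "srg V R k l m" and P: "nondeg V R"
  shows "0 < m" "l + 1 < k" "m < k"
proof -
  show "0 < m" "l + 1 < k" using srg_path_bound[OF G S] P by (auto simp: nondeg_def)
  have "int (card V) - 2 - 2 * k + m + 1 < int (card V) - 1 - k"
    using srg_path_bound(2)[OF graph_on_compl[OF G] srg_compl[OF G S refl]] P by (simp add: nondeg_def)
  then show "m < k" by simp
qed

text \<open>
The bounds \<open>m < k\<close> and \<open>l + 1 < k\<close> say that \<open>e * f\<close> and \<open>(e + 1) * (f + 1)\<close> are negative.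
\<close>

lemma srgp_roots:
  assumes G: "graph_on V R" and S: "srgp V R m e f" and P: "nondeg V R"
  shows "0 < m" "1 \<le> e \<and> f \<le> -2 \<or> 1 \<le> f \<and> e \<le> -2"
proof -
  note b = srg_nondeg_bounds[OF G S P]
  show "0 < m" by (fact b)
  have ef: "e * f < 0" using b(3) by simp
  have "(e + 1) * (f + 1) < 0" using b(2) by (simp add: algebra_simps)
  then show "1 \<le> e \<and> f \<le> -2 \<or> 1 \<le> f \<and> e \<le> -2"
    using ef unfolding mult_less_0_iff by linarith
qed

lemma has_path_srgI:
  assumes G: "graph_on V R" and S: "srg V R k l m" and xy: "x \<in> V" "y \<in> V" "R x y" "l + 1 \<noteq> k"
  shows "has_path V R"
proof (rule ccontr)
  assume n: "\<not> has_path V R"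
  have fin: "finite V" using G by (simp add: graph_on_def)
  have "{v \<in> V. R x v} = insert y {v \<in> V. R x v \<and> R y v}"
    using n xy graph_onD(2,3)[OF G] unfolding has_path_def by blast
  then have "card {v \<in> V. R x v} = Suc (card {v \<in> V. R x v \<and> R y v})"
    using fin xy graph_onD(2)[OF G] by simp
  moreover have "x \<noteq> y" using xy graph_onD(2)[OF G] by auto
  ultimately show False using S xy unfolding srg_def sum_adj_card[OF fin] by force
qed

text \<open>
Conversely, a strongly regular graph that has an edge but no path on three vertices satisfies
\<open>l + 1 = k\<close>, hence \<open>(e + 1) * (f + 1) = 0\<close>; dually for the complement one gets \<open>m = k\<close>, hence \<open>e * f = 0\<close>.
\<close>

lemma nondeg_srgp:
  assumes G: "graph_on V R" and S: "srgp V R m e f"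
    and xy: "x \<in> V" "y \<in> V" "R x y" and uv: "u \<in> V" "v \<in> V" "compl R u v"
    and ef: "e \<noteq> 0" "f \<noteq> 0" "e \<noteq> -1" "f \<noteq> -1"
  shows "nondeg V R"
proof -
  have "(e + 1) * (f + 1) \<noteq> 0" "e * f \<noteq> 0" using ef by auto
  then have "m + e + f + 1 \<noteq> m - e * f" "m \<noteq> m - e * f" by (auto simp: algebra_simps)
  then show ?thesis
    using has_path_srgI[OF G S xy] has_path_srgI[OF graph_on_compl[OF G] srg_compl[OF G S refl] uv]
    by (auto simp: nondeg_def)
qed

lemma triple_countsD:
  assumes "triple_counts V R t" "x \<in> V" "y \<in> V" "z \<in> V" "x \<noteq> y" "x \<noteq> z" "y \<noteq> z"
  shows "(\<Sum>v\<in>V. adj R x v * adj R y v * adj R z v) =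
    t (of_bool (R x y) + of_bool (R x z) + of_bool (R y z))"
  using assms by (simp add: triple_counts_def)

lemma srg_nb:
  assumes G: "graph_on V R" and S: "srg V R k l m" and t: "triple_counts V R t" and a: "a \<in> V"
  shows "srg (nb V R a) R l (t 3) (t 2)"
proof -
  have fin: "finite V" using G by (simp add: graph_on_def)
  have mem: "x \<in> V" "R a x" "R x a" "x \<noteq> a" if "x \<in> nb V R a" for x
    using that a graph_onD(2,3)[OF G] by (auto simp: nb_def)
  have "(\<Sum>v\<in>nb V R a. adj R x v) = l" if "x \<in> nb V R a" for x
    using S a mem[OF that] by (simp add: sum_nb fin srg_def)
  moreover have "(\<Sum>v\<in>nb V R a. adj R x v * adj R y v) = (if R x y then t 3 else t 2)"
    if "x \<in> nb V R a" "y \<in> nb V R a" "x \<noteq> y" for x y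
  proof -
    have "(\<Sum>v\<in>nb V R a. adj R x v * adj R y v) = (\<Sum>v\<in>V. adj R a v * adj R x v * adj R y v)"
      by (simp add: sum_nb fin mult.assoc)
    also have "\<dots> = t (of_bool (R a x) + of_bool (R a y) + of_bool (R x y))"
      using triple_countsD[OF t a mem(1)[OF that(1)] mem(1)[OF that(2)]] mem(4)[OF that(1)]
        mem(4)[OF that(2)] that(3) by auto
    finally show ?thesis using mem[OF that(1)] mem[OF that(2)] by (simp add: numeral_eq_Suc)
  qed
  ultimately show ?thesis unfolding srg_def by blast
qed

lemma srg_conb:
  assumes G: "graph_on V R" and S: "srg V R k l m" and t: "triple_counts V R t" and a: "a \<in> V"
  shows "srg (conb V R a) R (k - m) (l - t 1) (m - t 0)"
proof -
  have fin: "finite V" using G by (simp add: graph_on_def)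
  have mem: "x \<in> V" "\<not> R a x" "adj R x a = 0" "x \<noteq> a" if "x \<in> conb V R a" for x
    using that a graph_onD(2,3)[OF G] by (auto simp: nb_def compl_def adj_def)
  have c: "(\<Sum>v\<in>conb V R a. f v) = (\<Sum>v\<in>V. f v) - (\<Sum>v\<in>V. adj R a v * f v) - f a" for f
  proof -
    have "(\<Sum>v\<in>conb V R a. f v) = (\<Sum>v\<in>V. f v - adj R a v * f v - of_bool (v = a) * f v)"
      unfolding sum_nb[OF fin]
      by (intro sum.cong refl) (auto simp: adj_compl[OF G a] algebra_simps)
    then show ?thesis by (simp only: sum_subtractf sum_delta_int[OF fin a])
  qed
  have "(\<Sum>v\<in>conb V R a. adj R x v) = k - m" if "x \<in> conb V R a" for x
    using S a mem[OF that] by (simp add: c srg_def)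
  moreover have "(\<Sum>v\<in>conb V R a. adj R x v * adj R y v) = (if R x y then l - t 1 else m - t 0)"
    if "x \<in> conb V R a" "y \<in> conb V R a" "x \<noteq> y" for x y
  proof -
    have "(\<Sum>v\<in>V. adj R a v * (adj R x v * adj R y v)) = (\<Sum>v\<in>V. adj R a v * adj R x v * adj R y v)"
      by (simp add: mult.assoc)
    also have "\<dots> = t (of_bool (R a x) + of_bool (R a y) + of_bool (R x y))"
      using triple_countsD[OF t a mem(1)[OF that(1)] mem(1)[OF that(2)]] mem(4)[OF that(1)]
        mem(4)[OF that(2)] that(3) by auto
    finally show ?thesis using mem[OF that(1)] mem[OF that(2)] S that(3) unfolding c srg_def
      by (simp add: numeral_eq_Suc)
  qed
  ultimately show ?thesis unfolding srg_def by blast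
qed

section \<open>Latin square and Smith parameters\<close>

lemma common_nb_ex:
  assumes "finite V" "0 < (\<Sum>v\<in>V. adj R x v * adj R y v)"
  shows "\<exists>u\<in>V. R x u \<and> R y u"
proof -
  have "{v \<in> V. R x v \<and> R y v} \<noteq> {}"
    using assms(2) unfolding sum_adj_card[OF assms(1)] by (metis card.empty less_irrefl of_nat_0)
  then show ?thesis by blast
qed

lemma private_nb_ex:
  assumes "finite V" "x \<in> V" "(\<Sum>v\<in>V. adj R a v * adj R x v) + 1 < (\<Sum>v\<in>V. adj R a v)"
  shows "\<exists>u\<in>V. u \<noteq> x \<and> R a u \<and> \<not> R x u"
proof (rule ccontr)
  assume "\<not> ?thesis"
  then have "{v \<in> V. R a v} \<subseteq> insert x {v \<in> V. R a v \<and> R x v}" by blast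
  then have "card {v \<in> V. R a v} \<le> card (insert x {v \<in> V. R a v \<and> R x v})"
    using assms(1) by (intro card_mono) auto
  also have "\<dots> \<le> Suc (card {v \<in> V. R a v \<and> R x v})" by (rule card_insert_le_m1) auto
  finally show False using assms(3) unfolding sum_adj_card[OF assms(1)] by linarith
qed

lemma private_nb_ex':
  assumes "finite V" "x \<in> V" "\<not> R a x" "(\<Sum>v\<in>V. adj R a v * adj R x v) < (\<Sum>v\<in>V. adj R a v)"
  shows "\<exists>u\<in>V. u \<noteq> x \<and> R a u \<and> \<not> R x u"
proof (rule ccontr)
  assume "\<not> ?thesis"
  then have "{v \<in> V. R a v} \<subseteq> {v \<in> V. R a v \<and> R x v}" using assms(3) by auto
  then have "card {v \<in> V. R a v} \<le> card {v \<in> V. R a v \<and> R x v}"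
    using assms(1) by (intro card_mono) auto
  then show False using assms(4) unfolding sum_adj_card[OF assms(1)] by linarith
qed

lemma has_tri_iff_srg:
  assumes G: "graph_on V R" and S: "srg V R k l m" and "x \<in> V" "y \<in> V" "R x y"
  shows "has_tri V R \<longleftrightarrow> 0 < l" "0 \<le> l"
proof -
  have fin: "finite V" using G by (simp add: graph_on_def)
  have ne: "u \<noteq> v" if "R u v" "u \<in> V" for u v using that graph_onD(2)[OF G] by blast
  have l: "l = int (card {w \<in> V. R u w \<and> R v w})" if "u \<in> V" "v \<in> V" "R u v" for u v
    using S that ne[OF that(3)] unfolding srg_def sum_adj_card[OF fin] by metis
  show "0 \<le> l" using l[OF assms(3-5)] by simp
  show "has_tri V R \<longleftrightarrow> 0 < l"
  proof
    assume "has_tri V R"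
    then obtain u v w where *: "u \<in> V" "v \<in> V" "w \<in> V" "R u v" "R u w" "R v w"
      unfolding has_tri_def by blast
    then have "{w \<in> V. R u w \<and> R v w} \<noteq> {}" by blast
    then show "0 < l" using l[OF *(1,2,4)] fin by (simp add: card_gt_0_iff)
  next
    assume "0 < l"
    then have "{w \<in> V. R x w \<and> R y w} \<noteq> {}" using l[OF assms(3-5)] by (metis card.empty less_irrefl of_nat_0)
    then show "has_tri V R" using assms unfolding has_tri_def by blast
  qed
qed

lemma nondeg_pairs:
  assumes "graph_on V R" "nondeg V R"
  obtains x y u v where "x \<in> V" "y \<in> V" "R x y" "u \<in> V" "v \<in> V" "compl R u v"
  using assms unfolding nondeg_def has_path_def by metis

text \<open>
The case of a nonadjacent pair; a coclique of size three provides a vertex adjacent to neither of its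
members.
\<close>

lemma nonedge_eigenvalue:
  assumes G: "graph_on V R" and S: "srg V R k l m" and t: "triple_counts V R t" and N: "nondeg V R"
    and I: "has_tri V (compl R)"
    and d: "e = t 2 - 2 * t 1 + t 0" "d = t 1 - t 0"
  shows "e * e = (l - m) * e + (k - m)" "m - t 0 = - d * e"
    "(l - m) * t 0 + m * m = t 0 * k + 2 * d * m + e * t 0"
proof -
  have fin: "finite V" using G by (simp add: graph_on_def)
  obtain u v where uv: "u \<in> V" "v \<in> V" "compl R u v" using nondeg_pairs[OF G N] by metis
  then have ne: "u \<noteq> v" "\<not> R u v" by (auto simp: compl_def)
  note b = srg_nondeg_bounds[OF G S N]
  have s: "(\<Sum>w\<in>V. adj R u w * adj R v w) = m" "(\<Sum>w\<in>V. adj R u w) = k"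
    using S uv ne by (auto simp: srg_def)
  have "0 < int (card V) - 2 - 2 * k + m"
    using has_tri_iff_srg[OF graph_on_compl[OF G] srg_compl[OF G S refl] uv] I by blast
  then have "0 < (\<Sum>w\<in>V. adj (compl R) u w * adj (compl R) v w)"
    using srg_compl[OF G S refl] uv ne unfolding srg_def by auto
  from common_nb_ex[OF fin this]
  have u00: "\<exists>w\<in>V. w \<noteq> u \<and> w \<noteq> v \<and> \<not> R u w \<and> \<not> R v w" by (auto simp: compl_def)
  have u11: "\<exists>w\<in>V. R u w \<and> R v w" using b s by (intro common_nb_ex fin) simp
  have u10: "\<exists>w\<in>V. w \<noteq> v \<and> R u w \<and> \<not> R v w" using b s uv ne by (intro private_nb_ex' fin) auto
  have D: "t 0 = t 0" "d = t (Suc 0) - t 0" "e = t (Suc (Suc 0)) - 2 * t (Suc 0) + t 0"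
    by (simp_all add: d numeral_2_eq_2)
  have E: "0 = of_bool (R u v)" "m = (if R u v then l else m)" using ne by auto
  note sd = second_difference_eigenvalue[OF G S t uv(1,2) ne(1) E D u11 u10 u00]
  show "e * e = (l - m) * e + (k - m)" by (rule sd(1))
  show "m - t 0 = - d * e" using sd(2) ne by simp
  show "(l - m) * t 0 + m * m = t 0 * k + 2 * d * m + e * t 0" by (rule sd(3))
qed

text \<open>
The case of an adjacent pair; a triangle provides a vertex adjacent to both of its members.
\<close>

lemma edge_eigenvalue:
  assumes G: "graph_on V R" and S: "srg V R k l m" and t: "triple_counts V R t" and N: "nondeg V R"
    and K: "has_tri V R"
    and d: "c = t 3 - 2 * t 2 + t 1"
  shows "c * c = (l - m) * c + (k - m)" "l - t 2 = - (t 2 - t 1) * c"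
proof -
  have fin: "finite V" using G by (simp add: graph_on_def)
  obtain u v where uv: "u \<in> V" "v \<in> V" "R u v" using nondeg_pairs[OF G N] by metis
  then have ne: "u \<noteq> v" using graph_onD(2)[OF G] by blast
  note b = srg_nondeg_bounds[OF G S N]
  have s: "(\<Sum>w\<in>V. adj R u w * adj R v w) = l" "(\<Sum>w\<in>V. adj R u w) = k"
    using S uv ne by (auto simp: srg_def)
  have "0 < int (card V) - 2 * k + l"
    using srg_nondeg_bounds(1)[OF graph_on_compl[OF G] srg_compl[OF G S refl] nondeg_compl[OF G N]] .
  then have "0 < (\<Sum>w\<in>V. adj (compl R) u w * adj (compl R) v w)"
    using srg_compl[OF G S refl] uv ne unfolding srg_def by (auto simp: compl_def)
  from common_nb_ex[OF fin this]
  have u00: "\<exists>w\<in>V. w \<noteq> u \<and> w \<noteq> v \<and> \<not> R u w \<and> \<not> R v w" by (auto simp: compl_def)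
  have u11: "\<exists>w\<in>V. R u w \<and> R v w"
    using has_tri_iff_srg[OF G S uv] K s by (intro common_nb_ex fin) simp
  have u10: "\<exists>w\<in>V. w \<noteq> v \<and> R u w \<and> \<not> R v w" using b s uv by (intro private_nb_ex fin) auto
  have D: "t 1 = t 1" "t 2 - t 1 = t (Suc 1) - t 1" "c = t (Suc (Suc 1)) - 2 * t (Suc 1) + t 1"
    by (simp_all add: d numeral_2_eq_2 numeral_3_eq_3)
  have E: "1 = of_bool (R u v)" "l = (if R u v then l else m)" using uv by auto
  note sd = second_difference_eigenvalue[OF G S t uv(1,2) ne E D u11 u10 u00]
  show "c * c = (l - m) * c + (k - m)" by (rule sd(1))
  show "l - t 2 = - (t 2 - t 1) * c" using sd(2) uv by simp
qed

text \<open>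
The parameters of pseudo and negative Latin square graphs. The integer \<open>d\<close> will be the difference
\<open>t 1 - t 0\<close> of triple counts.
\<close>

definition latin :: "int \<Rightarrow> int \<Rightarrow> int \<Rightarrow> int \<Rightarrow> bool" where
  "latin m e f d \<longleftrightarrow> m = e * (e + 1) \<and> (2 + e - f) * d = f * (1 + e)"

text \<open>
The parameters of Smith graphs, in which a Krein parameter vanishes.
\<close>

definition smith :: "int \<Rightarrow> int \<Rightarrow> int \<Rightarrow> int \<Rightarrow> bool" where
  "smith m e f d \<longleftrightarrow> m * (e * e + 2 * e - f) = f * (e + 1) * (f + e * e) \<and> 2 * d = f + e * e"

text \<open>
With \<open>e\<close> the second difference at nonadjacent pairs and \<open>c\<close> the one at adjacent pairs, all triple counts are
expressed by \<open>m\<close>, \<open>e\<close>, \<open>f\<close>, \<open>d\<close> and \<open>c\<close>, and two further relations remain. Eliminating \<open>d\<close> from them determines \<open>m\<close>.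
\<close>

lemma latin_or_smith_arith:
  fixes m e f d c :: int
  assumes "e \<noteq> 0" "f \<noteq> 0" "e + 1 \<noteq> 0" "c = e \<or> c = f"
    and 1: "f - (e + 2) * d = - (d + e) * c"
    and 2: "f * (m + e * d) + m * m = (m + e * d) * (m - e * f) + 2 * d * m"
  shows "c = f \<and> latin m e f d \<or> c = e \<and> smith m e f d"
  using assms(4)
proof
  assume c: "c = f"
  then have d: "(2 + e - f) * d = f * (1 + e)" using 1 by (simp add: algebra_simps)
  have "m * ((e + 2) * d - f * (e + 1)) = e * f * (e + 1) * d" using 2 by (simp add: algebra_simps)
  then have "m * ((e + 2) * ((2 + e - f) * d) - f * (e + 1) * (2 + e - f)) = e * f * (e + 1) * ((2 + e - f) * d)"
    by algebra
  then have "(f * f * (1 + e)) * m = (f * f * (1 + e)) * (e * (e + 1))" unfolding d by algebra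
  then have "m = e * (e + 1)" using assms by simp
  then show ?thesis using c d by (simp add: latin_def)
next
  assume c: "c = e"
  then have d: "2 * d = f + e * e" using 1 by (simp add: algebra_simps)
  have "m * ((e + 2) * (2 * d) - 2 * f * (e + 1)) = e * f * (e + 1) * (2 * d)"
    using 2 by (simp add: algebra_simps)
  then have "e * (m * (e * e + 2 * e - f)) = e * (f * (e + 1) * (f + e * e))" unfolding d by algebra
  then show ?thesis using c d assms by (simp add: smith_def)
qed

lemma triple_parameters:
  assumes G: "graph_on V R" and reg: "tuple_regular 3 V R" and N: "nondeg V R"
    and K: "has_tri V R" and I: "has_tri V (compl R)"
  obtains m e f d c t where "srgp V R m e f" "triple_counts V R t"
    "t 0 = m + e * d" "t 1 = m + (e + 1) * d" "t 2 = m + (e + 2) * d + e" "t 3 = t 2 + e + d + c"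
    "c = f \<and> latin m e f d \<or> c = e \<and> smith m e f d"
proof -
  obtain k l m where S: "srg V R k l m"
    using tuple_regular_srg[OF G tuple_regular_mono[OF reg]] by auto
  obtain t where t: "triple_counts V R t" using tuple_regular_triple_counts[OF G reg] by blast
  \<comment> \<open>The second differences \<open>e\<close> (at nonadjacent pairs) and \<open>c\<close> (at adjacent pairs) are eigenvalues.\<close>
  define e d c f where "e = t 2 - 2 * t 1 + t 0" and "d = t 1 - t 0"
    and "c = t 3 - 2 * t 2 + t 1" and "f = l - m - e"
  note ne = nonedge_eigenvalue[OF G S t N I e_def d_def]
  note ed = edge_eigenvalue[OF G S t N K c_def]
  have k: "k = m - e * f" using ne(1) by (simp add: f_def algebra_simps)
  have l: "l = m + e + f" by (simp add: f_def)
  have S': "srgp V R m e f" using S k l by simp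
  note r = srgp_roots[OF G S' N]
  have t0: "t 0 = m + e * d" using ne(2) by (simp add: algebra_simps)
  have t1: "t 1 = m + (e + 1) * d" using t0 by (simp add: d_def algebra_simps)
  have t2: "t 2 = m + (e + 2) * d + e" using t0 t1 by (simp add: e_def algebra_simps)
  have t3: "t 3 = t 2 + e + d + c" using t2 t1 by (simp add: c_def algebra_simps)
  have "(c - e) * (c - f) = 0" using ed(1) unfolding k l by (simp add: algebra_simps)
  then have c: "c = e \<or> c = f" by auto
  have "f - (e + 2) * d = - (d + e) * c" using ed(2) unfolding l t1 t2 by (simp add: algebra_simps)
  moreover have "f * (m + e * d) + m * m = (m + e * d) * (m - e * f) + 2 * d * m"
    using ne(3) unfolding l k t0 by (simp add: algebra_simps)
  ultimately have "c = f \<and> latin m e f d \<or> c = e \<and> smith m e f d"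
    using r c by (intro latin_or_smith_arith) auto
  with that S' t t0 t1 t2 t3 show ?thesis by blast
qed

text \<open>
Besides the parameters of the graph, \<open>latin_graph\<close> and \<open>smith_graph\<close> record those of the subconstituents: each of them
keeps an eigenvalue of the graph, and the other eigenvalue is \<open>e + d\<close> respectively \<open>f - d\<close>.
\<close>

definition latin_graph :: "'a set \<Rightarrow> ('a \<Rightarrow> 'a \<Rightarrow> bool) \<Rightarrow> int \<Rightarrow> int \<Rightarrow> int \<Rightarrow> int \<Rightarrow> bool" where
  "latin_graph V R m e f d \<longleftrightarrow> srgp V R m e f \<and> latin m e f d \<and>
     (\<forall>a\<in>V. srgp (nb V R a) R (m + (e + 2) * d + e) f (e + d) \<and>
            srgp (conb V R a) R (- e * d) e (f - d))"

definition smith_graph :: "'a set \<Rightarrow> ('a \<Rightarrow> 'a \<Rightarrow> bool) \<Rightarrow> int \<Rightarrow> int \<Rightarrow> int \<Rightarrow> int \<Rightarrow> bool" where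
  "smith_graph V R m e f d \<longleftrightarrow> srgp V R m e f \<and> smith m e f d \<and>
     (\<forall>a\<in>V. srgp (nb V R a) R (m + (e + 2) * d + e) e (e + d) \<and>
            srgp (conb V R a) R (- e * d) e (f - d))"

lemma latin_or_smith_graph:
  assumes G: "graph_on V R" and reg: "tuple_regular 3 V R" and N: "nondeg V R"
    and K: "has_tri V R" and I: "has_tri V (compl R)"
  shows "\<exists>m e f d. latin_graph V R m e f d \<or> smith_graph V R m e f d"
proof -
  obtain m e f d c t where S: "srgp V R m e f" and t: "triple_counts V R t"
    and ts: "t 0 = m + e * d" "t 1 = m + (e + 1) * d" "t 2 = m + (e + 2) * d + e" "t 3 = t 2 + e + d + c"
    and c: "c = f \<and> latin m e f d \<or> c = e \<and> smith m e f d"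
    using triple_parameters[OF assms] .
  have "m + e + f = t 2 - c * (e + d)"
    using c
  proof
    assume "c = f \<and> latin m e f d"
    then have "(2 + e - f) * d = f * (1 + e)" "c = f" by (auto simp: latin_def)
    then show ?thesis unfolding ts by (simp add: algebra_simps)
  next
    assume "c = e \<and> smith m e f d"
    then have "2 * d = f + e * e" "c = e" by (auto simp: smith_def)
    then show ?thesis unfolding ts by (simp add: algebra_simps)
  qed
  then have l: "m + e + f = m + (e + 2) * d + e - c * (e + d)" using ts by simp
  have t3: "t 3 = m + (e + 2) * d + e + c + (e + d)" using ts by simp
  have "srgp (nb V R a) R (m + (e + 2) * d + e) c (e + d)" if "a \<in> V" for a
    using srg_nb[OF G S t that] unfolding l t3 ts(3) .
  moreover have "srgp (conb V R a) R (- e * d) e (f - d)" if "a \<in> V" for a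
    using srg_conb[OF G S t that] ts by (simp add: algebra_simps)
  ultimately show ?thesis
    using S c unfolding latin_graph_def smith_graph_def by blast
qed

section \<open>Triangle-free graphs\<close>

lemma srgp_sym: "srgp V R m e f \<Longrightarrow> srgp V R m f e"
  by (simp add: ac_simps)

lemma srgp_unique_roots:
  assumes "nondeg V R" "srgp V R m e f" "srgp V R m' e' f'"
  shows "m' = m" "e' = e \<and> f' = f \<or> e' = f \<and> f' = e"
proof -
  note u = srg_unique[OF assms]
  show m: "m' = m" using u(3) by simp
  have s: "e' + f' = e + f" and p: "e' * f' = e * f" using u m by linarith+
  have "(e' - e) * (e' - f) = 0" using s p by algebra
  then have "e' = e \<or> e' = f" by simp
  then show "e' = e \<and> f' = f \<or> e' = f \<and> f' = e" using s by auto
qed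

lemma srgp_compl:
  assumes G: "graph_on V R" and S: "srgp V R m e f"
  defines "m' \<equiv> int (card V) - 2 * (m - e * f) + (m + e + f)"
  shows "srgp V (compl R) m' (- 1 - e) (- 1 - f)" 
    "x \<in> V \<Longrightarrow> m * m' = e * f * (e + 1) * (f + 1)"
proof -
  have "m' - (- 1 - e) * (- 1 - f) = int (card V) - 1 - (m - e * f)"
    "m' + (- 1 - e) + (- 1 - f) = int (card V) - 2 - 2 * (m - e * f) + m"
    by (simp_all add: m'_def algebra_simps)
  note eqs = this
  show "srgp V (compl R) m' (- 1 - e) (- 1 - f)"
    unfolding eqs unfolding m'_def by (rule srg_compl[OF G S refl])
  show "m * m' = e * f * (e + 1) * (f + 1)" if "x \<in> V"
    using srg_card[OF G S that] unfolding m'_def by algebra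
qed

lemma graph_on_nb: "graph_on V R \<Longrightarrow> graph_on (nb V R a) R" "graph_on V R \<Longrightarrow> graph_on (conb V R a) R"
  by (rule graph_on_subset, assumption, rule nb_subset)+

lemma has_tri_mono: "has_tri W R \<Longrightarrow> W \<subseteq> V \<Longrightarrow> has_tri V R"
  unfolding has_tri_def by blast

text \<open>
In a triangle-free graph \<open>t 1\<close> and \<open>t 2\<close> vanish, so a single parameter is left. The subconstituent of the
nonneighbours is triangle-free again, but its parameters do not have the required form.
\<close>

lemma triangle_free_parameters:
  assumes G: "graph_on V R" and reg: "tuple_regular 3 V R" and N: "nondeg V R"
    and K: "\<not> has_tri V R" and I: "has_tri V (compl R)"
  shows "\<exists>e. 1 \<le> e \<and> srgp V R (e * (e + 1)) e (- e * e - 2 * e) \<and>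
    (\<forall>a\<in>V. srgp (conb V R a) R (e * e) e (- e * e - e))"
proof -
  have fin: "finite V" using G by (simp add: graph_on_def)
  obtain k l m where S: "srg V R k l m"
    using tuple_regular_srg[OF G tuple_regular_mono[OF reg]] by auto
  obtain t where t: "triple_counts V R t" using tuple_regular_triple_counts[OF G reg] by blast
  have l: "l = 0"
    using nondeg_pairs[OF G N] has_tri_iff_srg[OF G S] K by (metis order_le_less)
  have zero: "(\<Sum>v\<in>V. adj R x v * adj R y v * adj R z v) = 0" if "x \<in> V" "y \<in> V" "R x y" for x y z
  proof -
    have E: "{v \<in> V. R x v \<and> R y v \<and> R z v} = {}" using K that unfolding has_tri_def by blast
    show ?thesis unfolding sum_adj_card[OF fin] E by simp
  qed
  have t2: "t 2 = 0"
  proof -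
    obtain x y z where *: "x \<in> V" "y \<in> V" "z \<in> V" "y \<noteq> z" "R x y" "R x z" "\<not> R y z"
      using N unfolding nondeg_def has_path_def by blast
    then have "x \<noteq> y" "x \<noteq> z" using graph_onD(2)[OF G] by blast+
    then show ?thesis using triple_countsD[OF t *(1-3)] * zero[OF *(1,2,5)] by (simp add: numeral_2_eq_2)
  qed
  have t1: "t 1 = 0"
  proof -
    obtain z x y where *: "z \<in> V" "x \<in> V" "y \<in> V" "x \<noteq> y" "compl R z x" "compl R z y" "\<not> compl R x y"
      using N unfolding nondeg_def has_path_def by blast
    then have **: "R x y" "x \<noteq> z" "y \<noteq> z" "\<not> R x z" "\<not> R y z"
      using graph_onD(3)[OF G] by (auto simp: compl_def)
    then show ?thesis using triple_countsD[OF t *(2,3,1)] * zero[OF *(2,3) **(1)] by simp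
  qed
  define e where "e = t 0"
  note ne = nonedge_eigenvalue[OF G S t N I, OF refl refl, unfolded t1 t2]
  have m: "m = e * (e + 1)" using ne(2) by (simp add: e_def algebra_simps)
  have k: "k = m - e * (- e * e - 2 * e)" using ne(1) l m by (simp add: e_def algebra_simps)
  have "srgp V R m e (- e * e - 2 * e)" using S k l m by (simp add: algebra_simps)
  moreover from srgp_roots(2)[OF G this N] have "1 \<le> e"
  proof
    assume "1 \<le> - e * e - 2 * e \<and> e \<le> - 2"
    then have "e * (e + 2) < 0" "e \<le> -2" by (auto simp: algebra_simps)
    then show ?thesis by (simp add: mult_less_0_iff)
  qed simp
  moreover have "srgp (conb V R a) R (e * e) e (- e * e - e)" if "a \<in> V" for a
  proof -
    have "k - m = e * e - e * (- e * e - e)" "l - t 1 = e * e + e + (- e * e - e)" "m - t 0 = e * e"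
      using k l m t1 by (simp_all add: e_def algebra_simps)
    then show ?thesis using srg_conb[OF G S t that] by (simp only:)
  qed
  ultimately show ?thesis using m by blast
qed

text \<open>
These are the parameters of the pentagon.
\<close>

lemma triangle_and_coclique_free:
  assumes G: "graph_on V R" and N: "nondeg V R" and S: "srg V R k l m"
    and K: "\<not> has_tri V R" and I: "\<not> has_tri V (compl R)"
  shows "k = 2" "l = 0" "m = 1" "card V = 5"
proof -
  obtain x y u v where p: "x \<in> V" "y \<in> V" "R x y" "u \<in> V" "v \<in> V" "compl R u v"
    using nondeg_pairs[OF G N] .
  show l: "l = 0" using has_tri_iff_srg[OF G S p(1-3)] K by simp
  have n: "int (card V) = 2 + 2 * k - m"
    using has_tri_iff_srg[OF graph_on_compl[OF G] srg_compl[OF G S refl] p(4-6)] I by simp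
  note b = srg_nondeg_bounds[OF G S N]
  have eq: "k * (k - m - 1) = m * (1 - m)"
    using srg_card[OF G S p(1)] n l by (simp add: algebra_simps)
  have "0 \<le> k * (k - m - 1)" using b by simp
  moreover have "m * (1 - m) \<le> 0" using b by (simp add: mult_le_0_iff)
  ultimately have "k * (k - m - 1) = 0" "m * (1 - m) = 0" using eq by auto
  then show m: "m = 1" and k: "k = 2" using b by auto
  show "card V = 5" using n m k by simp
qed

lemma conb_pairs:
  assumes G: "graph_on V R" and S: "srg V R k l m" and N: "nondeg V R"
    and I: "has_tri V (compl R)" and a: "a \<in> V"
  obtains x y z where "x \<in> conb V R a" "y \<in> conb V R a" "z \<in> conb V R a" "R x y" "compl R x z"
proof -
  have fin: "finite V" using G by (simp add: graph_on_def)
  note S' = srg_compl[OF G S refl] and G' = graph_on_compl[OF G] and N' = nondeg_compl[OF G N]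
  note b = srg_nondeg_bounds[OF G S N] and b' = srg_nondeg_bounds[OF G' S' N']
  have "(\<Sum>v\<in>V. adj (compl R) a v) > 0" using S' a b' unfolding srg_def by auto
  then have "{v \<in> V. compl R a v} \<noteq> {}"
    unfolding sum_adj_card[OF fin] by (metis card.empty less_irrefl of_nat_0)
  then obtain x where x: "x \<in> V" "compl R a x" by blast
  then have ax: "\<not> R x a" "x \<noteq> a" using a graph_onD(3)[OF G] by (auto simp: compl_def)
  have "(\<Sum>v\<in>V. adj R x v * adj R a v) < (\<Sum>v\<in>V. adj R x v)"
    using S x a ax b unfolding srg_def by auto
  from private_nb_ex'[OF fin a ax(1) this]
  obtain y where y: "y \<in> V" "y \<noteq> a" "R x y" "\<not> R a y" by blast
  have "0 < int (card V) - 2 - 2 * k + m" using has_tri_iff_srg[OF G' S' a x] I by blast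
  then have "0 < (\<Sum>v\<in>V. adj (compl R) a v * adj (compl R) x v)"
    using S' x a ax unfolding srg_def by auto
  from common_nb_ex[OF fin this] obtain z where z: "z \<in> V" "compl R a z" "compl R x z" by blast
  show ?thesis using that[of x y z] x y z by (auto simp: nb_def compl_def)
qed

lemma nb_pairs:
  assumes G: "graph_on V R" and S: "srg V R k l m" and N: "nondeg V R"
    and K: "has_tri V R" and a: "a \<in> V"
  obtains x y z where "x \<in> nb V R a" "y \<in> nb V R a" "z \<in> nb V R a" "R x y" "compl R x z"
proof -
  have fin: "finite V" using G by (simp add: graph_on_def)
  note b = srg_nondeg_bounds[OF G S N]
  have "(\<Sum>v\<in>V. adj R a v) > 0" using S a b unfolding srg_def by auto
  then have "{v \<in> V. R a v} \<noteq> {}"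
    unfolding sum_adj_card[OF fin] by (metis card.empty less_irrefl of_nat_0)
  then obtain x where x: "x \<in> V" "R a x" by blast
  then have ax: "a \<noteq> x" using a graph_onD(2)[OF G] by auto
  have s: "(\<Sum>v\<in>V. adj R a v * adj R x v) = l" "(\<Sum>v\<in>V. adj R a v) = k"
    using S x a ax unfolding srg_def by auto
  have "(\<Sum>v\<in>V. adj R a v * adj R x v) + 1 < (\<Sum>v\<in>V. adj R a v)" using s b by simp
  from private_nb_ex[OF fin x(1) this]
  obtain z where z: "z \<in> V" "z \<noteq> x" "R a z" "\<not> R x z" by blast
  have "0 < l" using has_tri_iff_srg[OF G S a x] K by blast
  then have "0 < (\<Sum>v\<in>V. adj R a v * adj R x v)" using s by simp
  from common_nb_ex[OF fin this] obtain y where y: "y \<in> V" "R a y" "R x y" by blast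
  show ?thesis using that[of x y z] x y z by (auto simp: nb_def compl_def)
qed

text \<open>
The pentagon has irrational eigenvalues. In the other case \<open>triangle_free_parameters\<close> applies to the
graph and to its subconstituent of nonneighbours, and yields \<open>c * (c + 1) = b * b\<close> with positive \<open>b\<close>, \<open>c\<close>.
\<close>

lemma has_triangle:
  assumes G: "graph_on V R" and reg: "tuple_regular 4 V R" and N: "nondeg V R" and S: "srgp V R m e f"
  shows "has_tri V R"
proof (rule ccontr)
  assume K: "\<not> has_tri V R"
  have no_ints: False if "graph_on W R'" "nondeg W R'" "srgp W R' m e f" "\<not> has_tri W R'" "\<not> has_tri W (compl R')"
    for W :: "'a set" and R' m e f
  proof -
    note t = triangle_and_coclique_free[OF that(1-3) that(4,5)]
    have s: "e + f = -1" and p: "e * f = -1" using t by auto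
    have "1 \<le> e \<and> f \<le> - 2 \<or> 1 \<le> f \<and> e \<le> - 2" by (rule srgp_roots(2)[OF that(1,3,2)])
    then show False
    proof
      assume *: "1 \<le> e \<and> f \<le> - 2"
      then have "e * f \<le> 1 * f" by (intro mult_right_mono_neg) auto
      then show False using p * by simp
    next
      assume *: "1 \<le> f \<and> e \<le> - 2"
      then have "f * e \<le> 1 * e" by (intro mult_right_mono_neg) auto
      then show False using p * by (simp add: mult.commute)
    qed
  qed
  have I: "has_tri V (compl R)" using no_ints[OF G N S K] by blast
  obtain b where b: "1 \<le> b" "srgp V R (b * (b + 1)) b (- b * b - 2 * b)"
    "\<And>a. a \<in> V \<Longrightarrow> srgp (conb V R a) R (b * b) b (- b * b - b)"
    using triangle_free_parameters[OF G tuple_regular_mono[OF reg] N K I] by auto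
  obtain a where a: "a \<in> V" using nondeg_pairs[OF G N] by blast
  define W where "W = conb V R a"
  have GW: "graph_on W R" unfolding W_def by (rule graph_on_nb(2)[OF G])
  have SW: "srgp W R (b * b) b (- b * b - b)" unfolding W_def by (rule b(3)[OF a])
  have bb: "b * b \<ge> 1" using b(1) mult_mono[of 1 b 1 b] by simp
  obtain x y z where xyz: "x \<in> W" "y \<in> W" "z \<in> W" "R x y" "compl R x z"
    using conb_pairs[OF G S N I a] unfolding W_def by blast
  have NW: "nondeg W R"
    by (rule nondeg_srgp[OF GW SW xyz(1,2,4) xyz(1,3,5)]) (use b(1) bb in auto)
  have KW: "\<not> has_tri W R" using K has_tri_mono[of W R V] nb_subset[of V "compl R" a] unfolding W_def by blast
  have regW: "tuple_regular 3 W R"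
    unfolding W_def using tuple_regular_nb(2)[OF G a, of 3] reg by simp
  have IW: "has_tri W (compl R)" using no_ints[OF GW NW SW KW] by blast
  obtain c where c: "1 \<le> c" "srgp W R (c * (c + 1)) c (- c * c - 2 * c)"
    using triangle_free_parameters[OF GW regW NW KW IW] by auto
  have eq: "c * (c + 1) = b * b" using srg_unique(3)[OF NW c(2) SW] .
  show False
  proof (cases "b \<le> c")
    case True
    then have "b * b \<le> c * c" using b by (intro mult_mono) auto
    then show False using eq c by (simp add: algebra_simps)
  next
    case False
    then have "(c + 1) * (c + 1) \<le> b * b" using c by (intro mult_mono) auto
    then show False using eq c by (simp add: algebra_simps)
  qed
qed

lemma has_coclique:
  assumes G: "graph_on V R" and reg: "tuple_regular 4 V R" and N: "nondeg V R" and S: "srgp V R m e f"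
  shows "has_tri V (compl R)"
  by (rule has_triangle[OF graph_on_compl[OF G] tuple_regular_compl[OF G reg] nondeg_compl[OF G N]
      srgp_compl(1)[OF G S]])

section \<open>Smith graphs\<close>

text \<open>
The part of \<open>smith_graph\<close> on which the descent to nonneighbours relies.
\<close>

definition smith_down :: "'a set \<Rightarrow> ('a \<Rightarrow> 'a \<Rightarrow> bool) \<Rightarrow> int \<Rightarrow> int \<Rightarrow> int \<Rightarrow> int \<Rightarrow> bool" where
  "smith_down V R m e f d \<longleftrightarrow> srgp V R m e f \<and> smith m e f d \<and>
     (\<forall>a\<in>V. srgp (conb V R a) R (- e * d) e (f - d))"

text \<open>
The primed parameters are those of the subconstituent of the nonneighbours, for both kinds of
graph and both orders of its eigenvalues \<open>e\<close> and \<open>h = f - d\<close>. Signs and sizes exclude all possibilities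
except that it is a Smith graph with the same first eigenvalue \<open>e\<close>, and this determines \<open>f\<close>.
\<close>

lemma smith_step_arith:
  fixes m e f d m' e' f' d' :: int
  assumes s: "smith m e f d" and e: "1 \<le> e" "f \<le> -2" "0 < m"
    and "m' = - e * d" "e' = e \<and> f' = f - d \<or> e' = f - d \<and> f' = e"
    and cases: "latin m' e' f' d' \<or> smith m' e' f' d'"
    and l: "0 < m' + e' + f'"
  shows "smith m' e' f' d'" "e' = e" "f' = - (e * e * (e + 2))" "f = - (e * e * (2 * e + 3))"
proof -
  define h where "h = f - d"
  have d2: "2 * d = f + e * e" and eq: "m * (e * e + 2 * e - f) = f * (e + 1) * (f + e * e)"
    using s by (auto simp: smith_def)
  have ee: "1 \<le> e * e" "e \<le> e * e" using e mult_mono[of 1 e 1 e] mult_mono[of 1 e e e] by auto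
  have "0 < e * e + 2 * e - f" using e ee by linarith
  then have "0 < m * (e * e + 2 * e - f)" using e by simp
  then have "0 < (f * (e + 1)) * (2 * d)" using eq d2 by simp
  moreover have "f * (e + 1) < 0" using e by (simp add: mult_neg_pos)
  ultimately have d: "d < 0" using zero_less_mult_iff[of "f * (e + 1)" "2 * d"] by linarith
  have h: "h = d - e * e" using d2 by (simp add: h_def)
  have f: "f = 2 * d - e * e" using d2 by simp
  consider (Le) "e' = e" "f' = h" "latin m' e' f' d'" | (Lh) "e' = h" "f' = e" "latin m' e' f' d'"
    | (Se) "e' = e" "f' = h" "smith m' e' f' d'" | (Sh) "e' = h" "f' = e" "smith m' e' f' d'"
    using assms unfolding h_def by blast
  then have "smith m' e' f' d' \<and> e' = e \<and> f' = - (e * e * (e + 2)) \<and> f = - (e * e * (2 * e + 3))"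
  proof cases
    case Le
    then have "- e * d = e * (e + 1)" "(2 + e - h) * d' = h * (1 + e)"
      using assms by (auto simp: latin_def)
    then have "e * (d + e + 1) = 0" by (simp add: algebra_simps)
    then have *: "d = - e - 1" using e by simp
    \<comment> \<open>The integer \<open>e + d'\<close> is an eigenvalue of a neighbourhood; it is too small not to be \<open>0\<close>.\<close>
    have "(e * e + 2 * e + 3) * (e + d') = e - 1"
      using \<open>(2 + e - h) * d' = h * (1 + e)\<close> unfolding h * by (simp add: algebra_simps)
    have "e = 1"
    proof (rule ccontr)
      assume "e \<noteq> 1"
      then have "0 < (e * e + 2 * e + 3) * (e + d')" using \<open>_ = e - 1\<close> e by simp
      then have "1 \<le> e + d'" using e ee by (simp add: zero_less_mult_iff)
      then have "(e * e + 2 * e + 3) * 1 \<le> (e * e + 2 * e + 3) * (e + d')"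
        using e ee by (intro mult_left_mono) auto
      then show False using \<open>_ = e - 1\<close> e ee by simp
    qed
    then show ?thesis using l assms(5) Le * h by simp
  next
    case Lh
    then have *: "- e * d = h * (h + 1)" using assms by (simp add: latin_def)
    define D where "D = - d"
    have D: "1 \<le> D" using d by (simp add: D_def)
    have hD: "- h = D + e * e" using h by (simp add: D_def)
    have "e * D = (D + e * e) * (D + e * e - 1)"
      using * unfolding hD[symmetric] by (simp add: D_def algebra_simps)
    moreover have "(D + e * e) * (e * e) \<le> (D + e * e) * (D + e * e - 1)"
      using D ee by (intro mult_left_mono) auto
    moreover have "D * e < (D + e * e) * (e * e)"
      using D ee e by (intro mult_less_le_imp_less) auto
    ultimately show ?thesis by (simp add: mult.commute)
  next
    case Se
    then have "- e * d * (e * e + 2 * e - h) = h * (e + 1) * (h + e * e)"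
      using assms by (simp add: smith_def)
    then have "d * (h + e * e * (e + 2)) = 0" unfolding h by (simp add: algebra_simps)
    then have "h = - (e * e * (e + 2))" using d by simp
    moreover have "f = 2 * h + e * e" using h f by simp
    ultimately show ?thesis using Se by (simp add: algebra_simps)
  next
    case Sh
    then have "- e * d * (h * h + 2 * h - e) = e * (h + 1) * (e + h * h)"
      using assms by (simp add: smith_def)
    then have "e * (- d * (h * h + 2 * h - e)) = e * ((h + 1) * (e + h * h))"
      by (simp add: algebra_simps)
    then have *: "- d * (h * h + 2 * h - e) = (h + 1) * (e + h * h)"
      using e mult_cancel_left[of e] by (metis not_one_le_zero)
    have "h \<le> -2" using h d ee by simp
    then have "(h + 1) * (e + h * h) < 0" using e zero_le_square[of h] by (intro mult_neg_pos) linarith+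
    then have "0 < d * (h * h + 2 * h - e)" using * by simp
    then have neg: "h * h + 2 * h < e" using d by (simp add: zero_less_mult_iff)
    show ?thesis
    proof (cases "h \<le> -3")
      case True
      then have "(- h) * 1 \<le> (- h) * (- h - 2)" by (intro mult_left_mono) auto
      then have "- h \<le> h * h + 2 * h" by (simp add: algebra_simps)
      then show ?thesis using neg h d ee by simp
    next
      case False
      then have "h = -2" using \<open>h \<le> -2\<close> by simp
      then have "d = -1" "e * e = 1" using h d ee by auto
      then have "e = 1" using ee e by simp
      then show ?thesis using * \<open>h = -2\<close> \<open>d = -1\<close> by simp
    qed
  qed
  then show "smith m' e' f' d'" "e' = e" "f' = - (e * e * (e + 2))" "f = - (e * e * (2 * e + 3))" by auto
qed

lemma smith_descent:
  assumes G: "graph_on V R" and reg: "tuple_regular 5 V R" and N: "nondeg V R"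
    and S: "smith_down V R m e f d" and e: "1 \<le> e"
  shows "f = - (e * e * (2 * e + 3))"
    "\<exists>a\<in>V. \<exists>m' d'. nondeg (conb V R a) R \<and> smith_down (conb V R a) R m' e (- (e * e * (e + 2))) d'"
proof -
  have sp: "srgp V R m e f" and sm: "smith m e f d"
    and sub: "\<And>a. a \<in> V \<Longrightarrow> srgp (conb V R a) R (- e * d) e (f - d)"
    using S by (auto simp: smith_down_def)
  have r: "0 < m" "f \<le> -2" using srgp_roots[OF G sp N] e by auto
  have I: "has_tri V (compl R)" by (rule has_coclique[OF G tuple_regular_mono[OF reg] N sp]) simp
  obtain a where a: "a \<in> V" using nondeg_pairs[OF G N] by blast
  define W where "W = conb V R a"
  have GW: "graph_on W R" unfolding W_def by (rule graph_on_nb(2)[OF G])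
  have SW: "srgp W R (- e * d) e (f - d)" unfolding W_def by (rule sub[OF a])
  have h: "2 * (f - d) = f - e * e" using sm by (simp add: smith_def)
  have ee: "1 \<le> e * e" using e mult_mono[of 1 e 1 e] by auto
  obtain x y z where xyz: "x \<in> W" "y \<in> W" "z \<in> W" "R x y" "compl R x z"
    using conb_pairs[OF G sp N I a] unfolding W_def by blast
  have NW: "nondeg W R"
    by (rule nondeg_srgp[OF GW SW xyz(1,2,4) xyz(1,3,5)]) (use h r ee e in auto)
  have regW: "tuple_regular 4 W R"
    unfolding W_def using tuple_regular_nb(2)[OF G a, of 4] reg by simp
  have KW: "has_tri W R" by (rule has_triangle[OF GW regW NW SW])
  have IW: "has_tri W (compl R)" by (rule has_coclique[OF GW regW NW SW])
  obtain m' e' f' d' where w: "latin_graph W R m' e' f' d' \<or> smith_graph W R m' e' f' d'"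
    using latin_or_smith_graph[OF GW tuple_regular_mono[OF regW] NW KW IW] by auto
  then have sw: "srgp W R m' e' f'" and ls: "latin m' e' f' d' \<or> smith m' e' f' d'"
    by (auto simp: latin_graph_def smith_graph_def)
  note u = srgp_unique_roots[OF NW SW sw]
  have l: "0 < m' + e' + f'" using has_tri_iff_srg[OF GW sw xyz(1,2,4)] KW by simp
  note ar = smith_step_arith[OF sm e r(2,1) u ls l]
  show "f = - (e * e * (2 * e + 3))" by (rule ar(4))
  have "smith_down W R m' e' f' d'"
    using w ar(1) by (auto simp: latin_graph_def smith_graph_def smith_down_def)
  then show "\<exists>a\<in>V. \<exists>m' d'. nondeg (conb V R a) R \<and> smith_down (conb V R a) R m' e (- (e * e * (e + 2))) d'"
    using a NW unfolding W_def ar(2,3) by blast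
qed

text \<open>
Two steps of descent give the values \<open>- (e * e * (e + 2))\<close> and \<open>- (e * e * (2 * e + 3))\<close> for the same eigenvalue.
\<close>

lemma smith_down_pos_False:
  assumes G: "graph_on V R" and reg: "tuple_regular 6 V R" and N: "nondeg V R"
    and S: "smith_down V R m e f d" and e: "1 \<le> e"
  shows False
proof -
  obtain a m' d' where a: "a \<in> V" "nondeg (conb V R a) R"
      "smith_down (conb V R a) R m' e (- (e * e * (e + 2))) d'"
    using smith_descent(2)[OF G tuple_regular_mono[OF reg] N S e] by auto
  have "tuple_regular 5 (conb V R a) R"
    using tuple_regular_nb(2)[OF G a(1), of 5] reg by simp
  from smith_descent(1)[OF graph_on_nb(2)[OF G] this a(2,3) e]
  have "e * e * (e + 1) = 0" by (simp add: algebra_simps)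
  then show False using e by simp
qed

text \<open>
The complement of a Smith graph is a Smith graph with eigenvalues \<open>-1 - e\<close> and \<open>-1 - f\<close>, and its
subconstituents are exchanged. This turns a negative \<open>e\<close> into a positive one.
\<close>

lemma smith_graph_compl:
  assumes G: "graph_on V R" and N: "nondeg V R" and S: "smith_graph V R m e f d"
  shows "\<exists>m'. smith_down V (compl R) m' (- 1 - e) (- 1 - f) (e * e + e - d)"
proof -
  have sp: "srgp V R m e f" and eq: "m * (e * e + 2 * e - f) = f * (e + 1) * (f + e * e)"
    and d: "2 * d = f + e * e"
    and sub: "\<And>a. a \<in> V \<Longrightarrow> srgp (nb V R a) R (m + (e + 2) * d + e) e (e + d)"
    using S by (auto simp: smith_graph_def smith_def)
  have fin: "finite V" using G by (simp add: graph_on_def)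
  obtain a where a: "a \<in> V" using nondeg_pairs[OF G N] by blast
  define m' where "m' = int (card V) - 2 * (m - e * f) + (m + e + f)"
  note c = srgp_compl[OF G sp, folded m'_def]
  have m: "0 < m" by (rule srgp_roots(1)[OF G sp N])
  have "m * (m' * (e * e + f)) = m * (e * (1 + f) * (e * e + 2 * e - f))"
    using c(2)[OF a] eq by algebra
  then have "m' * (e * e + f) = e * (1 + f) * (e * e + 2 * e - f)" using m by simp
  then have "smith m' (- 1 - e) (- 1 - f) (e * e + e - d)"
    using d by (simp add: smith_def algebra_simps)
  moreover have "srgp (conb V (compl R) a) (compl R)
      (- (- 1 - e) * (e * e + e - d)) (- 1 - e) (- 1 - f - (e * e + e - d))" if a: "a \<in> V" for a
  proof -
    have eq: "conb V (compl R) a = nb V R a"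
      using compl_compl[OF G a] by (auto simp: nb_def)
    have "int (card (nb V R a)) = m - e * f"
      using sp a unfolding nb_def srg_def sum_adj_card[OF fin] by blast
    from srgp_compl(1)[OF graph_on_nb(1)[OF G] sub[OF a], unfolded this]
    have *: "srgp (nb V R a) (compl R) (m - e * f - 2 * (m + (e + 2) * d + e - e * (e + d)) + (m + (e + 2) * d + e + e + (e + d)))
      (- 1 - e) (- 1 - (e + d))" .
    have f: "f = 2 * d - e * e" using d by simp
    have "m - e * f - 2 * (m + (e + 2) * d + e - e * (e + d)) + (m + (e + 2) * d + e + e + (e + d)) =
        - (- 1 - e) * (e * e + e - d)"
      "- 1 - (e + d) = - 1 - f - (e * e + e - d)"
      unfolding f by (simp_all add: algebra_simps)
    then show ?thesis using * unfolding eq by (simp only:)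
  qed
  ultimately show ?thesis using c(1) unfolding smith_down_def by blast
qed

lemma smith_graph_False:
  assumes G: "graph_on V R" and reg: "tuple_regular 6 V R" and N: "nondeg V R"
    and S: "smith_graph V R m e f d"
  shows False
proof -
  have sp: "srgp V R m e f" using S by (simp add: smith_graph_def)
  consider "1 \<le> e" | "e \<le> -2" using srgp_roots(2)[OF G sp N] by linarith
  then show False
  proof cases
    case 1
    then show ?thesis
      using smith_down_pos_False[OF G reg N _ 1] S unfolding smith_graph_def smith_down_def by blast
  next
    case 2
    obtain m' where "smith_down V (compl R) m' (- 1 - e) (- 1 - f) (e * e + e - d)"
      using smith_graph_compl[OF G N S] by blast
    from smith_down_pos_False[OF graph_on_compl[OF G] tuple_regular_compl[OF G reg] nondeg_compl[OF G N] this]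
    show ?thesis using 2 by simp
  qed
qed

section \<open>Latin square graphs\<close>

text \<open>
The parameters \<open>m = 2\<close> and \<open>e = -2\<close> are those of the square lattice graphs. There, the four vertices of two
disjoint edges without further adjacencies may or may not have a common neighbour, depending on
the position of the edges, unless the lattice has only nine vertices.
\<close>

lemma lattice_parameters:
  assumes G: "graph_on V R" and reg: "tuple_regular 4 V R" and N: "nondeg V R" and S: "srgp V R 2 (- 2) f"
  shows "f = 1"
proof -
  have fin: "finite V" using G by (simp add: graph_on_def)
  have f: "1 \<le> f" using srgp_roots(2)[OF G S N] by simp
  have K: "has_tri V R" by (rule has_triangle[OF G reg N S])
  have I: "has_tri V (compl R)" by (rule has_coclique[OF G reg N S])
  have 3: "tuple_regular 3 V R" by (rule tuple_regular_mono[OF reg]) simp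
  obtain m' e' f' d c t where S': "srgp V R m' e' f'" and t: "triple_counts V R t"
    and ts: "t 0 = m' + e' * d" "t 1 = m' + (e' + 1) * d" "t 2 = m' + (e' + 2) * d + e'" "t 3 = t 2 + e' + d + c"
    and cc: "c = f' \<and> latin m' e' f' d \<or> c = e' \<and> smith m' e' f' d"
    by (rule triple_parameters[OF G 3 N K I])
  note u = srgp_unique_roots[OF N S S']
  have ff: "1 \<le> f * f" using f mult_mono[of 1 f 1 f] by simp
  consider "e' = -2" "f' = f" "latin m' e' f' d" | "e' = f" "f' = -2" "latin m' e' f' d"
    | "e' = -2" "f' = f" "smith m' e' f' d" | "e' = f" "f' = -2" "smith m' e' f' d"
    using u(2) cc by blast
  then show ?thesis
  proof cases
    case 2
    then have "(f - 1) * (f + 2) = 0" using u by (simp add: latin_def algebra_simps)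
    then show ?thesis using f by simp
  next
    case 3
    then have "f * (f + 2) = 0" using u by (simp add: smith_def algebra_simps)
    then show ?thesis using f by simp
  next
    case 4
    then have "f * f * (f + 2) = 0" using u by (simp add: smith_def algebra_simps)
    then show ?thesis using f by simp
  next
    case 1
    then have "f * (d - 1) = 0" using u by (simp add: latin_def algebra_simps)
    then have "d = 1" using f by simp
    then have t12: "t 1 = 1" "t 2 = 0" using ts u 1 by auto
    have deg: "int (card {v \<in> V. R x v}) = 2 + 2 * f" if "x \<in> V" for x
      using S that unfolding srg_def sum_adj_card[OF fin] by (auto simp: mult.commute)
    have cn: "int (card {v \<in> V. R x v \<and> R y v}) = (if R x y then f else 2)" if "x \<in> V" "y \<in> V" "x \<noteq> y" for x y
      using S that unfolding srg_def sum_adj_card[OF fin] by auto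
    have tc: "int (card {v \<in> V. R x v \<and> R y v \<and> R z v}) = t (of_bool (R x y) + of_bool (R x z) + of_bool (R y z))"
      if "x \<in> V" "y \<in> V" "z \<in> V" "x \<noteq> y" "x \<noteq> z" "y \<noteq> z" for x y z
      using triple_countsD[OF t that] unfolding sum_adj_card[OF fin] .
    obtain z x y where zxy: "z \<in> V" "x \<in> V" "y \<in> V" "x \<noteq> y" "compl R z x" "compl R z y" "\<not> compl R x y"
      using N unfolding nondeg_def has_path_def by blast
    then have xy: "R x y" "x \<noteq> z" "y \<noteq> z" "\<not> R x z" "\<not> R y z" "\<not> R z x" "\<not> R z y"
      using graph_onD(3)[OF G] by (auto simp: compl_def)
    have "card {v \<in> V. R x v \<and> R y v \<and> R z v} = 1"
      using tc[OF zxy(2,3,1)] xy zxy t12 by simp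
    then obtain v where v: "{v \<in> V. R x v \<and> R y v \<and> R z v} = {v}" by (auto simp: card_1_singleton_iff)
    then have vV: "v \<in> V" "R x v" "R y v" "R z v" by blast+
    have vne: "v \<noteq> x" "v \<noteq> y" "v \<noteq> z" using vV graph_onD(2)[OF G] by blast+
    have vs: "R v x" "R v y" "R v z" using vV zxy graph_onD(3)[OF G] by blast+
    \<comment> \<open>Each \<open>w \<in> W\<close> forms with \<open>z\<close> an edge disjoint from and nonadjacent to \<open>x y\<close>; \<open>v\<close> is the only vertex
      that can be adjacent to all four.\<close>
    define W where "W = {w \<in> V. R z w \<and> \<not> R x w \<and> \<not> R y w}"
    have nzv: "\<not> R x w \<and> \<not> R y w" if "w \<in> V" "R z w" "R v w" for w
    proof -
      have "{u \<in> V. R z u \<and> R v u \<and> R x u} = {}" "{u \<in> V. R z u \<and> R v u \<and> R y u} = {}"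
        using tc[OF zxy(1) vV(1) zxy(2)] tc[OF zxy(1) vV(1) zxy(3)] xy vne vs vV t12 fin
        by (simp_all add: numeral_2_eq_2)
      then show ?thesis using that by blast
    qed
    have WV: "W \<inter> {w. R v w} = {w \<in> V. R z w \<and> R v w}" using nzv by (auto simp: W_def)
    have cW: "int (card (W \<inter> {w. R v w})) = f"
      unfolding WV using cn[OF zxy(1) vV(1)] vV vne by auto
    have finW: "finite W" using fin by (simp add: W_def)
    have "int (card W) = 2 * f - 1"
    proof -
      let ?X = "{w \<in> V. R z w \<and> R x w}" and ?Y = "{w \<in> V. R z w \<and> R y w}"
      have i: "?X \<inter> ?Y = {v}" using v by blast
      have "card ?X + card ?Y = card (?X \<union> ?Y) + card (?X \<inter> ?Y)"
        using fin by (intro card_Un_Int) auto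
      then have XY: "int (card (?X \<union> ?Y)) = 3"
        using cn[OF zxy(1,2)] cn[OF zxy(1,3)] xy unfolding i by auto
      have "{w \<in> V. R z w} = W \<union> (?X \<union> ?Y)" "W \<inter> (?X \<union> ?Y) = {}" by (auto simp: W_def)
      then have "card {w \<in> V. R z w} = card W + card (?X \<union> ?Y)"
        using fin finW by (simp only:) (intro card_Un_disjoint, auto)
      then show ?thesis using deg[OF zxy(1)] XY by simp
    qed
    moreover have "W \<subseteq> {w. R v w}"
    proof -
      have "W \<inter> {w. R v w} \<noteq> {}" using cW f by auto
      then obtain w where w: "w \<in> W" "R v w" by blast
      show ?thesis
      proof
        fix w' assume w': "w' \<in> W"
        have st: "same_type R [x, y, z, w] [x, y, z, w']"
          using w w' zxy xy graph_onD(2)[OF G zxy(1)] by (intro same_type_graph[OF G])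
            (auto simp: W_def less_Suc_eq eval_nat_numeral)
        have "card {u \<in> V. \<forall>a\<in>set [x, y, z, w]. R a u} = card {u \<in> V. \<forall>a\<in>set [x, y, z, w']. R a u}"
          using w w' zxy by (intro tuple_regular_common[OF G reg _ _ _ st]) (auto simp: W_def)
        moreover have "v \<in> {u \<in> V. \<forall>a\<in>set [x, y, z, w]. R a u}"
          using vV w graph_onD(3)[OF G] by (auto simp: W_def)
        then have "0 < card {u \<in> V. \<forall>a\<in>set [x, y, z, w]. R a u}"
          using fin by (auto simp: card_gt_0_iff)
        ultimately have "{u \<in> V. \<forall>a\<in>set [x, y, z, w']. R a u} \<noteq> {}"
          by (metis card.empty less_irrefl)
        then obtain u where "u \<in> V" "R x u" "R y u" "R z u" "R w' u" by auto
        then have "u = v" using v by blast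
        then show "w' \<in> {w. R v w}" using \<open>R w' u\<close> w' vV graph_onD(3)[OF G] by (auto simp: W_def)
      qed
    qed
    ultimately show ?thesis using cW by (simp add: Int_absorb2)
  qed
qed

lemma latin_card:
  assumes G: "graph_on V R" and N: "nondeg V R" and S: "srgp V R m e f" and L: "latin m e f d"
  shows "int (card V) = (e - f) * (e - f)"
proof -
  obtain a where a: "a \<in> V" using nondeg_pairs[OF G N] by blast
  have m: "m = e * (e + 1)" using L by (simp add: latin_def)
  have "0 < m" by (rule srgp_roots(1)[OF G S N])
  have "m * (int (card V) - (e - f) * (e - f)) = 0"
    using srg_card[OF G S a] unfolding m by algebra
  then show ?thesis using \<open>0 < m\<close> by simp
qed

text \<open>
If a Latin square graph and both its subconstituents have numbers of vertices \<open>(e - f)\<^sup>2\<close> for their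
respective eigenvalues, then the subconstituents have the same size, which forces \<open>f = - 1 - e\<close>. The integrality of
\<open>d\<close> does the rest.
\<close>

lemma three_latin_arith:
  fixes e f d :: int
  assumes L: "(2 + e - f) * d = f * (1 + e)"
    and r: "1 \<le> e \<and> f \<le> -2 \<or> 1 \<le> f \<and> e \<le> -2"
    and k: "e * (e + 1 - f) = (e + d - f) * (e + d - f)"
    and n: "(e - f) * (e - f) - 1 - e * (e + 1 - f) = (e - f + d) * (e - f + d)"
  shows "e = -2 \<and> f = 1"
proof -
  have "(e + 1 - f) * (e + f + 1) = 0" using k n by algebra
  then have f: "f = - 1 - e" using r by auto
  \<comment> \<open>Now \<open>d = - (e + 1)\<^sup>2 / (2 * e + 3)\<close>, whose numerator and denominator are coprime.\<close>
  have "(2 * e + 3) * (4 * d + 2 * e + 1) = -1" using L unfolding f by (simp add: algebra_simps)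
  then have "(2 * e + 3) dvd -1" by (metis dvd_triv_left)
  then have "2 * e + 3 = 1 \<or> 2 * e + 3 = -1" using zdvd1_eq[of "2 * e + 3"] by (simp add: abs_if split: if_splits)
  then show ?thesis using r f by auto
qed

text \<open>
The first four cases are those in which a subconstituent is degenerate. In the fifth, both
subconstituents are Latin square graphs, because Smith graphs are excluded.
\<close>

lemma latin_graph_card:
  assumes G: "graph_on V R" and reg: "tuple_regular 7 V R" and N: "nondeg V R"
    and L: "latin_graph V R m e f d"
  shows "card V = 9"
proof -
  have S: "srgp V R m e f" and la: "latin m e f d"
    and nbS: "\<And>a. a \<in> V \<Longrightarrow> srgp (nb V R a) R (m + (e + 2) * d + e) f (e + d)"
    and cbS: "\<And>a. a \<in> V \<Longrightarrow> srgp (conb V R a) R (- e * d) e (f - d)"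
    using L by (auto simp: latin_graph_def)
  have fin: "finite V" using G by (simp add: graph_on_def)
  have reg4: "tuple_regular 4 V R" by (rule tuple_regular_mono[OF reg]) simp
  have m: "m = e * (e + 1)" and d: "(2 + e - f) * d = f * (1 + e)" using la by (auto simp: latin_def)
  note r = srgp_roots[OF G S N]
  note card = latin_card[OF G N S la]
  have K: "has_tri V R" by (rule has_triangle[OF G reg4 N S])
  have I: "has_tri V (compl R)" by (rule has_coclique[OF G reg4 N S])
  obtain x y u v where p: "x \<in> V" "y \<in> V" "R x y" "u \<in> V" "v \<in> V" "compl R u v"
    using nondeg_pairs[OF G N] .
  have l: "0 < m + e + f" using has_tri_iff_srg[OF G S p(1-3)] K by simp
  note c = srgp_compl[OF G S]
  define m' where "m' = int (card V) - 2 * (m - e * f) + (m + e + f)"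
  have Sc: "srgp V (compl R) m' (- 1 - e) (- 1 - f)" using c(1) by (simp only: m'_def)
  have m': "m' = f * (f + 1)"
  proof -
    have "m * m' = e * f * (e + 1) * (f + 1)" using c(2)[OF p(1)] by (simp only: m'_def)
    then have "m * m' = m * (f * (f + 1))" unfolding m by (simp add: algebra_simps)
    then show ?thesis using r(1) by simp
  qed
  have l': "0 < m' + (- 1 - e) + (- 1 - f)"
    using has_tri_iff_srg[OF graph_on_compl[OF G] Sc p(4-6)] I by simp
  have "e = -2 \<and> f = 1"
  proof -
    consider "e + d = 0" | "e + d = -1" | "f - d = 0" | "f - d = -1"
      | "e + d \<noteq> 0" "e + d \<noteq> -1" "f - d \<noteq> 0" "f - d \<noteq> -1" by blast
    then show ?thesis
    proof cases
      case 1
      \<comment> \<open>Neighbourhoods have no edges.\<close>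
      then have d': "d = - e" by simp
      have "m + e + f = 0" using d unfolding d' m by (simp add: algebra_simps)
      then show ?thesis using l by simp
    next
      case 2
      \<comment> \<open>Neighbourhoods are disjoint unions of complete graphs.\<close>
      then have d': "d = - 1 - e" by simp
      have "(1 + e) * (e + 2) = 0" using d unfolding d' by (simp add: algebra_simps)
      then have e: "e = -2" using r by auto
      then have "f = 1" using lattice_parameters[OF G reg4 N, of f] S m by simp
      then show ?thesis using e by simp
    next
      case 3
      \<comment> \<open>Sets of nonneighbours are complete multipartite, which is case 2 for the complement.\<close>
      then have d': "d = f" by simp
      have "f * (f - 1) = 0" using d unfolding d' by (simp add: algebra_simps)
      then have f: "f = 1" using r by auto
      have "srgp V (compl R) 2 (- 2) (- 1 - e)" using srgp_sym[OF Sc] m' f by simp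
      from lattice_parameters[OF graph_on_compl[OF G] tuple_regular_compl[OF G reg4] nondeg_compl[OF G N] this]
      show ?thesis using f by simp
    next
      case 4
      \<comment> \<open>Nonneighbours of a vertex are adjacent to each other, which is case 1 for the complement.\<close>
      then have d': "d = f + 1" by simp
      have "m' + (- 1 - e) + (- 1 - f) = 0" using d unfolding d' m' by (simp add: algebra_simps)
      then show ?thesis using l' by simp
    next
      case 5
      have latin_sub: "int (card W) = (e' - f') * (e' - f')"
        if W: "graph_on W R" "tuple_regular 6 W R" "nondeg W R" "srgp W R m1 e' f'" for W m1 e' f'
      proof -
        have 4: "tuple_regular 4 W R" by (rule tuple_regular_mono[OF W(2)]) simp
        have 3: "tuple_regular 3 W R" by (rule tuple_regular_mono[OF W(2)]) simp
        obtain m2 e2 f2 d2 where "latin_graph W R m2 e2 f2 d2 \<or> smith_graph W R m2 e2 f2 d2"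
          using latin_or_smith_graph[OF W(1) 3 W(3) has_triangle[OF W(1) 4 W(3,4)] has_coclique[OF W(1) 4 W(3,4)]]
          by blast
        then have *: "srgp W R m2 e2 f2" "latin m2 e2 f2 d2"
          using smith_graph_False[OF W(1-3)] by (auto simp: latin_graph_def)
        from srgp_unique_roots(2)[OF W(3,4) *(1)] latin_card[OF W(1,3) *]
        show ?thesis by (auto simp: algebra_simps)
      qed
      have a: "x \<in> V" by (rule p(1))
      have G1: "graph_on (nb V R x) R" "graph_on (conb V R x) R" by (rule graph_on_nb[OF G])+
      have reg6: "tuple_regular 6 (nb V R x) R" "tuple_regular 6 (conb V R x) R"
        using tuple_regular_nb[OF G a, of 6] reg by simp_all
      obtain x1 y1 z1 where n1: "x1 \<in> nb V R x" "y1 \<in> nb V R x" "z1 \<in> nb V R x" "R x1 y1" "compl R x1 z1"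
        using nb_pairs[OF G S N K a] .
      have N1: "nondeg (nb V R x) R"
        by (rule nondeg_srgp[OF G1(1) nbS[OF a] n1(1,2,4) n1(1,3,5)]) (use 5 r in auto)
      obtain x2 y2 z2 where n2: "x2 \<in> conb V R x" "y2 \<in> conb V R x" "z2 \<in> conb V R x" "R x2 y2" "compl R x2 z2"
        using conb_pairs[OF G S N I a] .
      have N2: "nondeg (conb V R x) R"
        by (rule nondeg_srgp[OF G1(2) cbS[OF a] n2(1,2,4) n2(1,3,5)]) (use 5 r in auto)
      have c1: "int (card (nb V R x)) = m - e * f"
        using S a unfolding nb_def srg_def sum_adj_card[OF fin] by blast
      have c2: "int (card (conb V R x)) = m' - (- 1 - e) * (- 1 - f)"
        using Sc a unfolding nb_def srg_def sum_adj_card[OF fin] by blast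
      have k: "e * (e + 1 - f) = (e + d - f) * (e + d - f)"
        using latin_sub[OF G1(1) reg6(1) N1 nbS[OF a]] unfolding c1 m by (simp add: algebra_simps)
      have n: "(e - f) * (e - f) - 1 - e * (e + 1 - f) = (e - f + d) * (e - f + d)"
        using latin_sub[OF G1(2) reg6(2) N2 cbS[OF a]] unfolding c2 m' by (simp add: algebra_simps)
      show ?thesis by (rule three_latin_arith[OF d r(2) k n])
    qed
  qed
  then have "int (card V) = 9" using card by simp
  then show ?thesis by simp
qed

lemma srgp_graph_card:
  assumes G: "graph_on V R" and reg: "tuple_regular 7 V R" and N: "nondeg V R"
    and K: "has_tri V R" and I: "has_tri V (compl R)"
  shows "card V = 9"
proof -
  have 3: "tuple_regular 3 V R" and 6: "tuple_regular 6 V R" by (rule tuple_regular_mono[OF reg], simp)+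
  show ?thesis
    using latin_or_smith_graph[OF G 3 N K I] latin_graph_card[OF G reg N] smith_graph_False[OF G 6 N] by blast
qed

lemma has_tri_of_coclique:
  assumes G: "graph_on V R" and reg: "tuple_regular 7 V R" and N: "nondeg V R"
    and I: "has_tri V (compl R)"
  shows "has_tri V R"
proof (rule ccontr)
  assume K: "\<not> has_tri V R"
  have 3: "tuple_regular 3 V R" and 4: "tuple_regular 4 V R" by (rule tuple_regular_mono[OF reg], simp)+
  obtain e where "srgp V R (e * (e + 1)) e (- e * e - 2 * e)"
    using triangle_free_parameters[OF G 3 N K I] by blast
  from has_triangle[OF G 4 N this] K show False by simp
qed

text \<open>
Graphs with both a triangle and a coclique of size three have nine vertices. By \<open>has_tri_of_coclique\<close>,
used for the graph and for its complement, the only others have neither, and then five vertices.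
\<close>

theorem tuple_regular_graph_card:
  assumes G: "graph_on V R" and reg: "tuple_regular 7 V R" and N: "nondeg V R"
  shows "card V \<le> 9"
proof -
  note G' = graph_on_compl[OF G] and N' = nondeg_compl[OF G N] and reg' = tuple_regular_compl[OF G reg]
  have cc: "has_tri V (compl (compl R)) \<longleftrightarrow> has_tri V R"
    unfolding has_tri_def by (simp add: compl_compl[OF G] cong: bex_cong)
  have 1: "has_tri V (compl R) \<Longrightarrow> has_tri V R" by (rule has_tri_of_coclique[OF G reg N])
  have 2: "has_tri V R \<Longrightarrow> has_tri V (compl R)"
    using has_tri_of_coclique[OF G' reg' N'] unfolding cc .
  show ?thesis
  proof (cases "has_tri V R")
    case True
    then show ?thesis using srgp_graph_card[OF G reg N True 2] by simp
  next
    case False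
    then have "\<not> has_tri V (compl R)" using 1 by blast
    moreover obtain k l m where "srg V R k l m"
      using tuple_regular_srg[OF G tuple_regular_mono[OF reg]] by auto
    ultimately show ?thesis using triangle_and_coclique_free(4)[OF G N _ False] by fastforce
  qed
qed

section \<open>Bipartite graphs with prescribed extension numbers\<close>

text \<open>
Fix \<open>p \<in> X\<close> and \<open>b \<in> Y\<close> and count the paths \<open>p, y, x, b\<close> by their inner vertex in \<open>X\<close>, respectively by
their inner vertex in \<open>Y\<close>. Comparing an adjacent pair with a nonadjacent one gives \<open>r - l = k - m\<close> and
\<open>l * k = m * r\<close>, hence \<open>r = k\<close>.
\<close>

lemma biregular_card_eq:
  assumes fin: "finite X" "finite Y"
    and r: "\<And>x. x \<in> X \<Longrightarrow> card {y \<in> Y. B x y} = r"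
    and l: "\<And>x x'. x \<in> X \<Longrightarrow> x' \<in> X \<Longrightarrow> x \<noteq> x' \<Longrightarrow> card {y \<in> Y. B x y \<and> B x' y} = l"
    and k: "\<And>y. y \<in> Y \<Longrightarrow> card {x \<in> X. B x y} = k"
    and m: "\<And>y y'. y \<in> Y \<Longrightarrow> y' \<in> Y \<Longrightarrow> y \<noteq> y' \<Longrightarrow> card {x \<in> X. B x y \<and> B x y'} = m"
    and ex: "u \<in> X" "v \<in> X" "b \<in> Y" "B u b" "\<not> B v b"
  shows "card X = card Y"
proof -
  define A where "A x y = (of_bool (B x y) :: int)" for x y
  have AA: "A x y * A x y = A x y" for x y by (simp add: A_def)
  have c1: "(\<Sum>y\<in>Y. A x y) = int r" if "x \<in> X" for x
    using r[OF that] fin by (simp add: A_def Int_def)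
  have c2: "(\<Sum>y\<in>Y. A p y * A x y) = int l + (int r - int l) * of_bool (x = p)" if "p \<in> X" "x \<in> X" for x p
  proof (cases "x = p")
    case True
    then show ?thesis using c1 that by (simp add: AA)
  next
    case False
    then show ?thesis using l[OF that] fin by (simp add: A_def of_bool_conj[symmetric] Int_def)
  qed
  have d1: "(\<Sum>x\<in>X. A x y) = int k" if "y \<in> Y" for y
    using k[OF that] fin by (simp add: A_def Int_def)
  have d2: "(\<Sum>x\<in>X. A x y * A x b) = int m + (int k - int m) * of_bool (y = b)" if "y \<in> Y" "b \<in> Y" for y b
  proof (cases "y = b")
    case True
    then show ?thesis using d1 that by (simp add: AA)
  next
    case False
    then show ?thesis using m[OF that] fin by (simp add: A_def of_bool_conj[symmetric] Int_def)
  qed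
  have path: "int l * int k + (int r - int l) * A p b = int m * int r + (int k - int m) * A p b"
    if p: "p \<in> X" for p
  proof -
    have "(\<Sum>x\<in>X. (\<Sum>y\<in>Y. A p y * A x y) * A x b) = (\<Sum>y\<in>Y. A p y * (\<Sum>x\<in>X. A x y * A x b))"
      by (simp add: sum_distrib_left sum_distrib_right mult.assoc) (rule sum.swap)
    moreover have "(\<Sum>x\<in>X. (\<Sum>y\<in>Y. A p y * A x y) * A x b) =
        (\<Sum>x\<in>X. int l * A x b + (int r - int l) * (of_bool (x = p) * A x b))"
      by (intro sum.cong refl) (simp only: c2[OF p], simp only: algebra_simps)
    moreover have "\<dots> = int l * int k + (int r - int l) * A p b"
      using d1[OF ex(3)] sum_delta_int[OF fin(1) p, of "\<lambda>x. A x b"]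
      by (simp only: sum.distrib sum_distrib_left[symmetric])
    moreover have "(\<Sum>y\<in>Y. A p y * (\<Sum>x\<in>X. A x y * A x b)) =
        (\<Sum>y\<in>Y. int m * A p y + (int k - int m) * (of_bool (y = b) * A p y))"
      by (intro sum.cong refl) (simp only: d2[OF _ ex(3)], simp only: algebra_simps)
    moreover have "\<dots> = int m * int r + (int k - int m) * A p b"
      using c1[OF p] sum_delta_int[OF fin(2) ex(3), of "A p"]
      by (simp only: sum.distrib sum_distrib_left[symmetric])
    ultimately show ?thesis by simp
  qed
  have e1: "int l * int k = int m * int r" using path[OF ex(2)] ex by (simp add: A_def)
  have e2: "int r - int l = int k - int m" using path[OF ex(1)] ex e1 by (simp add: A_def)
  have "{y \<in> Y. B u y \<and> B v y} \<subset> {y \<in> Y. B u y}" using ex by blast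
  then have "card {y \<in> Y. B u y \<and> B v y} < card {y \<in> Y. B u y}" using fin by (intro psubset_card_mono) auto
  moreover have "u \<noteq> v" using ex by blast
  ultimately have lr: "l < r" using r[OF ex(1)] l[OF ex(1,2)] by simp
  have "(int r - int l) * int k = (int r - int l) * int r"
    using e1 e2 by algebra
  then have kr: "k = r" using lr by simp
  have "(\<Sum>x\<in>X. \<Sum>y\<in>Y. A x y) = (\<Sum>y\<in>Y. \<Sum>x\<in>X. A x y)" by (rule sum.swap)
  then have "int (card X) * int r = int (card Y) * int k" using c1 d1 by simp
  then show ?thesis using kr lr by simp
qed

text \<open>
By the preceding lemma the two sides have the same size, and so have \<open>X - {p}\<close> and the neighbours of
\<open>p\<close>, and \<open>X - {p}\<close> and the nonneighbours of \<open>p\<close>. Hence \<open>card X = 2 * (card X - 1)\<close>.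
\<close>

lemma finite_generic_bipartite_False:
  assumes fin: "finite X" "finite Y"
    and r: "\<And>x x'. x \<in> X \<Longrightarrow> x' \<in> X \<Longrightarrow> card {y \<in> Y. B x y} = card {y \<in> Y. B x' y}"
    and l: "\<And>x1 x2 y1 y2. {x1, x2, y1, y2} \<subseteq> X \<Longrightarrow> x1 \<noteq> x2 \<Longrightarrow> y1 \<noteq> y2 \<Longrightarrow>
      card {y \<in> Y. B x1 y \<and> B x2 y} = card {y \<in> Y. B y1 y \<and> B y2 y}"
    and t: "\<And>x1 x2 x3 y1 y2 y3. {x1, x2, x3, y1, y2, y3} \<subseteq> X \<Longrightarrow> distinct [x1, x2, x3] \<Longrightarrow>
      distinct [y1, y2, y3] \<Longrightarrow>
      card {y \<in> Y. B x1 y \<and> B x2 y \<and> B x3 y} = card {y \<in> Y. B y1 y \<and> B y2 y \<and> B y3 y}"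
    and k: "\<And>x x'. x \<in> Y \<Longrightarrow> x' \<in> Y \<Longrightarrow> card {y \<in> X. B y x} = card {y \<in> X. B y x'}"
    and m: "\<And>x1 x2 y1 y2. {x1, x2, y1, y2} \<subseteq> Y \<Longrightarrow> x1 \<noteq> x2 \<Longrightarrow> y1 \<noteq> y2 \<Longrightarrow>
      card {y \<in> X. B y x1 \<and> B y x2} = card {y \<in> X. B y y1 \<and> B y y2}"
    and X: "p \<in> X" "u \<in> X" "v \<in> X" "distinct [p, u, v]"
    and Y: "a \<in> Y" "B p a" "B u a" "\<not> B v a" "b \<in> Y" "\<not> B p b" "B u b" "\<not> B v b"
  shows False
proof -
  define rr where "rr = card {y \<in> Y. B p y}"
  define ll where "ll = card {y \<in> Y. B p y \<and> B u y}"
  define tt where "tt = card {y \<in> Y. B p y \<and> B u y \<and> B v y}"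
  define kk where "kk = card {x \<in> X. B x a}"
  define mm where "mm = card {x \<in> X. B x a \<and> B x b}"
  have ab: "a \<noteq> b" using Y by blast
  have R: "card {y \<in> Y. B x y} = rr" if "x \<in> X" for x using r that X(1) unfolding rr_def by blast
  have L: "card {y \<in> Y. B x y \<and> B x' y} = ll" if "x \<in> X" "x' \<in> X" "x \<noteq> x'" for x x'
    unfolding ll_def using that X by (intro l) auto
  have T: "card {y \<in> Y. B x y \<and> B x' y \<and> B x'' y} = tt" if "x \<in> X" "x' \<in> X" "x'' \<in> X" "distinct [x, x', x'']" for x x' x''
    unfolding tt_def using that X by (intro t) auto
  have K: "card {x \<in> X. B x y} = kk" if "y \<in> Y" for y using k that Y(1) unfolding kk_def by blast
  have M: "card {x \<in> X. B x y \<and> B x y'} = mm" if "y \<in> Y" "y' \<in> Y" "y \<noteq> y'" for y y'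
    unfolding mm_def using that Y ab by (intro m) auto
  have XY: "card X = card Y"
    by (rule biregular_card_eq[OF fin R L K M X(2,3) Y(1,3,4)])
  have split: "card {y \<in> Y. P y \<and> \<not> B p y} = card {y \<in> Y. P y} - card {y \<in> Y. B p y \<and> P y}" for P
  proof -
    have "{y \<in> Y. P y \<and> \<not> B p y} = {y \<in> Y. P y} - {y \<in> Y. B p y \<and> P y}" by blast
    then show ?thesis using fin by (simp only:) (intro card_Diff_subset, auto)
  qed
  have rem: "card {x \<in> X - {p}. P x} = card {x \<in> X. P x} - of_bool (P p)" for P
  proof -
    have "{x \<in> X - {p}. P x} = {x \<in> X. P x} - {p}" by blast
    then show ?thesis using fin X(1) by (simp add: card_Diff_singleton_if)
  qed
  have 1: "card (X - {p}) = card {y \<in> Y. B p y}"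
  proof (rule biregular_card_eq)
    show "finite (X - {p})" "finite {y \<in> Y. B p y}" using fin by auto
    show "card {y \<in> {y \<in> Y. B p y}. B x y} = ll" if "x \<in> X - {p}" for x
      using L[of p x] that X(1) by (auto simp: conj_assoc)
    show "card {y \<in> {y \<in> Y. B p y}. B x y \<and> B x' y} = tt" if "x \<in> X - {p}" "x' \<in> X - {p}" "x \<noteq> x'" for x x'
      using T[of p x x'] that X(1) by (auto simp: conj_assoc)
    show "card {x \<in> X - {p}. B x y} = kk - 1" if "y \<in> {y \<in> Y. B p y}" for y
      using that K unfolding rem by simp
    show "card {x \<in> X - {p}. B x y \<and> B x y'} = mm - 1"
      if "y \<in> {y \<in> Y. B p y}" "y' \<in> {y \<in> Y. B p y}" "y \<noteq> y'" for y y'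
      using that M unfolding rem by simp
    show "u \<in> X - {p}" "v \<in> X - {p}" "a \<in> {y \<in> Y. B p y}" "B u a" "\<not> B v a" using X Y by auto
  qed
  have 2: "card (X - {p}) = card {y \<in> Y. \<not> B p y}"
  proof (rule biregular_card_eq)
    show "finite (X - {p})" "finite {y \<in> Y. \<not> B p y}" using fin by auto
    have eq: "{y \<in> {y \<in> Y. \<not> B p y}. P y} = {y \<in> Y. P y \<and> \<not> B p y}" for P by blast
    show "card {y \<in> {y \<in> Y. \<not> B p y}. B x y} = rr - ll" if "x \<in> X - {p}" for x
      using L[of p x] R[of x] that X(1) unfolding eq split by auto
    show "card {y \<in> {y \<in> Y. \<not> B p y}. B x y \<and> B x' y} = ll - tt" if "x \<in> X - {p}" "x' \<in> X - {p}" "x \<noteq> x'" for x x'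
      using T[of p x x'] L[of x x'] that X(1) unfolding eq split by auto
    show "card {x \<in> X - {p}. B x y} = kk" if "y \<in> {y \<in> Y. \<not> B p y}" for y
      using that K unfolding rem by simp
    show "card {x \<in> X - {p}. B x y \<and> B x y'} = mm"
      if "y \<in> {y \<in> Y. \<not> B p y}" "y' \<in> {y \<in> Y. \<not> B p y}" "y \<noteq> y'" for y y'
      using that M unfolding rem by simp
    show "u \<in> X - {p}" "v \<in> X - {p}" "b \<in> {y \<in> Y. \<not> B p y}" "B u b" "\<not> B v b" using X Y by auto
  qed
  have "card Y = card {y \<in> Y. B p y} + card {y \<in> Y. \<not> B p y}"
    using fin by (subst card_Un_disjoint[symmetric]) (auto intro: arg_cong[of _ _ card])
  then have "card X = 2 * (card X - 1)" using XY 1 2 X(1) fin by (simp add: card_Diff_singleton_if)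
  moreover have "card {p, u, v} \<le> card X" using X fin by (intro card_mono) auto
  ultimately show False using X(4) by auto
qed

section \<open>Formulas\<close>

fun ren :: "(nat \<Rightarrow> nat) \<Rightarrow> 'r form \<Rightarrow> 'r form" where
  "ren f (Eq i j) = Eq (f i) (f j)"
| "ren f (Rel r is) = Rel r (map f is)"
| "ren f (Neg \<phi>) = Neg (ren f \<phi>)"
| "ren f (Conj \<phi> \<psi>) = Conj (ren f \<phi>) (ren f \<psi>)"
| "ren f (Exists \<phi>) = Exists (ren (case_nat 0 (\<lambda>n. Suc (f n))) \<phi>)"

lemma wff_ren: "wff ar n \<phi> \<Longrightarrow> \<forall>i<n. f i < k \<Longrightarrow> wff ar k (ren f \<phi>)"
proof (induction \<phi> arbitrary: n k f)
  case (Exists \<phi>)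
  then show ?case by (auto simp: less_Suc_eq_0_disj intro!: Exists.IH[of "Suc n"])
qed auto

lemma sat_ren:
  "wff ar (length e) \<phi> \<Longrightarrow> \<forall>i<length e. e' ! f i = e ! i \<Longrightarrow> sat M e' (ren f \<phi>) \<longleftrightarrow> sat M e \<phi>"
proof (induction \<phi> arbitrary: e e' f)
  case (Rel r "is")
  then have "map (\<lambda>i. e' ! i) (map f is) = map (\<lambda>i. e ! i) is" by auto
  then show ?case by (simp only: ren.simps sat.simps)
next
  case (Exists \<phi>)
  have "sat M (a # e') (ren (case_nat 0 (\<lambda>n. Suc (f n))) \<phi>) \<longleftrightarrow> sat M (a # e) \<phi>" for a
    using Exists.prems by (intro Exists.IH) (auto simp: less_Suc_eq_0_disj)
  then show ?case by simp
qed auto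

definition Imp :: "'r form \<Rightarrow> 'r form \<Rightarrow> 'r form" where
  "Imp \<phi> \<psi> = Neg (Conj \<phi> (Neg \<psi>))"

definition Iff :: "'r form \<Rightarrow> 'r form \<Rightarrow> 'r form" where
  "Iff \<phi> \<psi> = Conj (Imp \<phi> \<psi>) (Imp \<psi> \<phi>)"

text \<open>
The empty conjunction has to be true in every environment, including the empty one.
\<close>

definition conjs :: "'r form list \<Rightarrow> 'r form" where
  "conjs \<phi>s = foldr Conj \<phi>s (Neg (Exists (Neg (Eq 0 0))))"

definition exs :: "nat \<Rightarrow> 'r form \<Rightarrow> 'r form" where
  "exs n \<phi> = (Exists ^^ n) \<phi>"

definition alls :: "nat \<Rightarrow> 'r form \<Rightarrow> 'r form" where
  "alls n \<phi> = Neg (exs n (Neg \<phi>))"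

lemma wff_Imp [simp]: "wff ar n (Imp \<phi> \<psi>) \<longleftrightarrow> wff ar n \<phi> \<and> wff ar n \<psi>"
  and sat_Imp [simp]: "sat M e (Imp \<phi> \<psi>) \<longleftrightarrow> (sat M e \<phi> \<longrightarrow> sat M e \<psi>)"
  and wff_Iff [simp]: "wff ar n (Iff \<phi> \<psi>) \<longleftrightarrow> wff ar n \<phi> \<and> wff ar n \<psi>"
  and sat_Iff [simp]: "sat M e (Iff \<phi> \<psi>) \<longleftrightarrow> (sat M e \<phi> \<longleftrightarrow> sat M e \<psi>)"
  by (auto simp: Imp_def Iff_def)

lemma wff_conjs [simp]: "wff ar n (conjs \<phi>s) \<longleftrightarrow> (\<forall>\<phi>\<in>set \<phi>s. wff ar n \<phi>)"
  by (induction \<phi>s) (auto simp: conjs_def)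

lemma sat_conjs [simp]: "sat M e (conjs \<phi>s) \<longleftrightarrow> (\<forall>\<phi>\<in>set \<phi>s. sat M e \<phi>)"
  by (induction \<phi>s) (auto simp: conjs_def)

lemma wff_exs [simp]: "wff ar k (exs n \<phi>) \<longleftrightarrow> wff ar (n + k) \<phi>"
  by (induction n arbitrary: k) (auto simp: exs_def)

lemma tuples_Suc: "tuples M (Suc n) = {xs @ [a] | xs a. xs \<in> tuples M n \<and> a \<in> univ M}"
proof (intro equalityI subsetI)
  fix xs assume "xs \<in> tuples M (Suc n)"
  then show "xs \<in> {xs @ [a] | xs a. xs \<in> tuples M n \<and> a \<in> univ M}"
    by (cases xs rule: rev_cases) (auto simp: tuples_def)
qed (auto simp: tuples_def)

lemma tuples_0 [simp]: "tuples M 0 = {[]}"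
  by (auto simp: tuples_def)

lemma sat_exs [simp]: "sat M e (exs n \<phi>) \<longleftrightarrow> (\<exists>xs\<in>tuples M n. sat M (xs @ e) \<phi>)"
proof (induction n arbitrary: e)
  case 0
  then show ?case by (simp add: exs_def)
next
  case (Suc n)
  have "sat M e (exs (Suc n) \<phi>) \<longleftrightarrow> (\<exists>a\<in>univ M. sat M (a # e) (exs n \<phi>))"
    by (simp add: exs_def)
  then show ?case unfolding Suc.IH tuples_Suc by force
qed

lemma wff_alls [simp]: "wff ar k (alls n \<phi>) \<longleftrightarrow> wff ar (n + k) \<phi>"
  by (simp add: alls_def)

lemma sat_alls [simp]: "sat M e (alls n \<phi>) \<longleftrightarrow> (\<forall>xs\<in>tuples M n. sat M (xs @ e) \<phi>)"
  by (simp add: alls_def)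

lemma tuples_length: "xs \<in> tuples M n \<Longrightarrow> length xs = n"
  by (simp add: tuples_def)

lemma tuples_split: "xs \<in> tuples M (m + n) \<Longrightarrow> \<exists>ys\<in>tuples M m. \<exists>zs\<in>tuples M n. xs = ys @ zs"
  by (rule bexI[of _ "take m xs"], rule bexI[of _ "drop m xs"])
    (auto simp: tuples_def dest: in_set_takeD in_set_dropD)

lemma sat_isomorphism:
  assumes iso: "isomorphism ar M N g"
  shows "wff ar (length e) \<phi> \<Longrightarrow> set e \<subseteq> univ M \<Longrightarrow> sat N (map g e) \<phi> \<longleftrightarrow> sat M e \<phi>"
proof (induction \<phi> arbitrary: e)
  case (Eq i j)
  then have "e ! i \<in> univ M" "e ! j \<in> univ M" by auto
  then show ?case using iso Eq by (auto simp: isomorphism_def bij_betw_def inj_on_def)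
next
  case (Rel r "is")
  then have "map (\<lambda>i. e ! i) is \<in> tuples M (ar r)" by (auto simp: tuples_def)
  moreover have "map (\<lambda>i. map g e ! i) is = map g (map (\<lambda>i. e ! i) is)" using Rel by auto
  ultimately show ?case using iso unfolding isomorphism_def sat.simps by metis
next
  case (Exists \<phi>)
  have "sat N (g a # map g e) \<phi> \<longleftrightarrow> sat M (a # e) \<phi>" if "a \<in> univ M" for a
    using Exists.IH[of "a # e"] Exists.prems that by simp
  moreover have "univ N = g ` univ M" using iso by (simp add: isomorphism_def bij_betw_def)
  ultimately show ?case by simp
qed auto

section \<open>Ultraproducts\<close>

lemma ultra_eq_equiv: "equiv (direct_product N) (ultra_eq U N)"
proof (rule equivI)
  show "trans (ultra_eq U N)"
    by (auto simp: trans_def ultra_eq_def elim: eventually_elim2)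
qed (auto simp: refl_on_def sym_def ultra_eq_def eq_commute)

lemma ultra_eq_class_eq:
  assumes "f \<in> direct_product N" "g \<in> direct_product N"
  shows "ultra_eq U N `` {f} = ultra_eq U N `` {g} \<longleftrightarrow> eventually (\<lambda>i. f i = g i) U"
  using eq_equiv_class_iff[OF ultra_eq_equiv assms] assms by (auto simp: ultra_eq_def)

lemma ultrafilter_eventually_not:
  assumes "ultrafilter U"
  shows "eventually (\<lambda>i. \<not> P i) U \<longleftrightarrow> \<not> eventually P U"
proof
  assume 1: "eventually (\<lambda>i. \<not> P i) U"
  show "\<not> eventually P U"
  proof
    assume "eventually P U"
    with 1 have "eventually (\<lambda>i. False) U" by (rule eventually_elim2) auto
    then show False using assms by (simp add: ultrafilter_def trivial_limit_def)
  qed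
next
  assume "\<not> eventually P U"
  then show "eventually (\<lambda>i. \<not> P i) U" using assms by (auto simp: ultrafilter_def)
qed

lemma map_nth_map: "\<forall>k\<in>set is. k < length fs \<Longrightarrow> map (\<lambda>k. map h fs ! k) is = map h (map (\<lambda>k. fs ! k) is)"
  by simp

text \<open>
By induction on the formula. For an existential quantifier, witnesses in almost all factors are
chosen and completed arbitrarily to an element of the product.
\<close>

theorem Los:
  assumes U: "ultrafilter U" and ne: "\<And>i. univ (N i) \<noteq> {}"
  shows "wff ar (length fs) \<phi> \<Longrightarrow> set fs \<subseteq> direct_product N \<Longrightarrow>
    sat (ultraproduct ar U N) (map (\<lambda>f. ultra_eq U N `` {f}) fs) \<phi> \<longleftrightarrow>
    eventually (\<lambda>i. sat (N i) (map (\<lambda>f. f i) fs) \<phi>) U"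
proof (induction \<phi> arbitrary: fs)
  case (Eq i j)
  then have "fs ! i \<in> direct_product N" "fs ! j \<in> direct_product N" by auto
  from ultra_eq_class_eq[OF this, of U] show ?case using Eq by simp
next
  case (Rel r "is")
  let ?c = "\<lambda>f. ultra_eq U N `` {f}"
  define gs where "gs = map (\<lambda>k. fs ! k) is"
  have gs: "set gs \<subseteq> direct_product N" "length gs = ar r" using Rel by (auto simp: gs_def)
  have "map ?c gs \<in> rel (ultraproduct ar U N) r \<longleftrightarrow> eventually (\<lambda>i. map (\<lambda>f. f i) gs \<in> rel (N i) r) U"
  proof
    assume "map ?c gs \<in> rel (ultraproduct ar U N) r"
    then obtain hs where hs: "map ?c gs = map ?c hs" "set hs \<subseteq> direct_product N" "length hs = ar r"
      "eventually (\<lambda>i. map (\<lambda>f. f i) hs \<in> rel (N i) r) U"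
      unfolding ultraproduct_def by (simp only: rel_struct.simps mem_Collect_eq) blast
    have len: "length gs = length hs" using gs hs by simp
    have "eventually (\<lambda>i. (gs ! k) i = (hs ! k) i) U" if "k < length gs" for k
    proof -
      have "?c (gs ! k) = ?c (hs ! k)" 
        using arg_cong[OF hs(1), of "\<lambda>xs. xs ! k"] that len by simp
      then show ?thesis
        using ultra_eq_class_eq[of "gs ! k" N "hs ! k" U] gs hs that len by (auto simp: subset_iff)
    qed
    then have "eventually (\<lambda>i. \<forall>k\<in>{..<length gs}. (gs ! k) i = (hs ! k) i) U"
      by (intro eventually_ball_finite) auto
    with hs(4) show "eventually (\<lambda>i. map (\<lambda>f. f i) gs \<in> rel (N i) r) U"
    proof eventually_elim
      case (elim i)
      then have "map (\<lambda>f. f i) gs = map (\<lambda>f. f i) hs" using len by (auto intro: nth_equalityI)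
      then show ?case using elim by simp
    qed
  next
    assume "eventually (\<lambda>i. map (\<lambda>f. f i) gs \<in> rel (N i) r) U"
    then show "map ?c gs \<in> rel (ultraproduct ar U N) r" using gs by (auto simp: ultraproduct_def)
  qed
  moreover have "\<forall>k\<in>set is. k < length fs" using Rel by simp
  ultimately show ?case by (simp only: sat.simps map_nth_map gs_def)
next
  case (Neg \<phi>)
  then show ?case using ultrafilter_eventually_not[OF U] by simp
next
  case (Conj \<phi> \<psi>)
  then show ?case by (simp add: eventually_conj_iff)
next
  case (Exists \<phi>)
  let ?c = "\<lambda>f. ultra_eq U N `` {f}"
  have IH: "sat (ultraproduct ar U N) (?c f # map ?c fs) \<phi> \<longleftrightarrow>
      eventually (\<lambda>i. sat (N i) (f i # map (\<lambda>f. f i) fs) \<phi>) U" if "f \<in> direct_product N" for f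
    using Exists.IH[of "f # fs"] Exists.prems that by simp
  have "sat (ultraproduct ar U N) (map ?c fs) (Exists \<phi>) \<longleftrightarrow>
      (\<exists>f\<in>direct_product N. sat (ultraproduct ar U N) (?c f # map ?c fs) \<phi>)"
    by (auto simp: ultraproduct_def quotient_def)
  also have "\<dots> \<longleftrightarrow> (\<exists>f\<in>direct_product N. eventually (\<lambda>i. sat (N i) (f i # map (\<lambda>f. f i) fs) \<phi>) U)"
    using IH by blast
  also have "\<dots> \<longleftrightarrow> eventually (\<lambda>i. \<exists>a\<in>univ (N i). sat (N i) (a # map (\<lambda>f. f i) fs) \<phi>) U"
  proof
    assume "\<exists>f\<in>direct_product N. eventually (\<lambda>i. sat (N i) (f i # map (\<lambda>f. f i) fs) \<phi>) U"
    then obtain f where "f \<in> direct_product N" "eventually (\<lambda>i. sat (N i) (f i # map (\<lambda>f. f i) fs) \<phi>) U" by blast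
    from this(2) show "eventually (\<lambda>i. \<exists>a\<in>univ (N i). sat (N i) (a # map (\<lambda>f. f i) fs) \<phi>) U"
      by (rule eventually_mono) (use \<open>f \<in> _\<close> in \<open>auto simp: direct_product_def\<close>)
  next
    assume ev: "eventually (\<lambda>i. \<exists>a\<in>univ (N i). sat (N i) (a # map (\<lambda>f. f i) fs) \<phi>) U"
    define P where "P i a \<longleftrightarrow> a \<in> univ (N i) \<and> sat (N i) (a # map (\<lambda>f. f i) fs) \<phi>" for i a
    define f where "f i = (if \<exists>a. P i a then SOME a. P i a else SOME a. a \<in> univ (N i))" for i
    have "P i (f i)" if "\<exists>a. P i a" for i using someI_ex[OF that] that by (simp add: f_def)
    moreover have "f i \<in> univ (N i)" for i
    proof (cases "\<exists>a. P i a")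
      case True
      then show ?thesis using calculation by (auto simp: P_def)
    next
      case False
      then show ?thesis using ne[of i] by (simp add: f_def some_in_eq)
    qed
    ultimately have "f \<in> direct_product N" "eventually (\<lambda>i. sat (N i) (f i # map (\<lambda>f. f i) fs) \<phi>) U"
      using ev by (auto simp: direct_product_def P_def elim!: eventually_mono)
    then show "\<exists>f\<in>direct_product N. eventually (\<lambda>i. sat (N i) (f i # map (\<lambda>f. f i) fs) \<phi>) U" by blast
  qed
  finally show ?case by simp
qed

section \<open>Transfer to the members of a multidimensional exact class\<close>

lemma elem_equiv_sat:
  "elem_equiv ar A B \<Longrightarrow> wff ar 0 \<phi> \<Longrightarrow> sat A [] \<phi> \<longleftrightarrow> sat B [] \<phi>"
  unfolding elem_equiv_def theory_of_def by blast

lemma model_theory_sat: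
  assumes "is_model ar K (theory_of ar M)" "wff ar 0 \<phi>"
  shows "sat K [] \<phi> \<longleftrightarrow> sat M [] \<phi>"
proof
  assume "sat K [] \<phi>"
  then show "sat M [] \<phi>"
    using assms unfolding is_model_def theory_of_def by (metis (mono_tags, lifting) mem_Collect_eq sat.simps(3) wff.simps(3))
next
  assume "sat M [] \<phi>"
  then show "sat K [] \<phi>" using assms unfolding is_model_def theory_of_def by blast
qed

lemma sat_ren_append:
  assumes "wff ar l \<psi>" "length b = l" "length b' = l"
  shows "sat M (b @ b') (ren (\<lambda>i. i) \<psi>) \<longleftrightarrow> sat M b \<psi>" "sat M (b @ b') (ren (\<lambda>i. l + i) \<psi>) \<longleftrightarrow> sat M b' \<psi>"
  using assms by (auto intro!: sat_ren simp: nth_append)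

locale mec_ultraproduct =
  fixes ar :: "'r \<Rightarrow> nat" and C :: "('r, 'a) rel_struct set" and U :: "'i filter"
    and N :: "'i \<Rightarrow> ('r, 'a) rel_struct" and M :: "('r, 'm) rel_struct"
  assumes mec: "mec ar C" and ultra: "ultrafilter U" and N: "N i \<in> C"
    and equiv: "elem_equiv ar (ultraproduct ar U N) M"
begin

lemma N_structure: "is_structure ar (N i)" and N_finite: "finite (univ (N i))"
  using mec N by (auto simp: mec_def)

lemma sentence_iff: "wff ar 0 \<phi> \<Longrightarrow> sat M [] \<phi> \<longleftrightarrow> eventually (\<lambda>i. sat (N i) [] \<phi>) U"
  using Los[OF ultra, of N ar "[]" \<phi>] N_structure elem_equiv_sat[OF equiv, of \<phi>]
  by (simp add: is_structure_def)

lemma eventually_ex: "eventually P U \<Longrightarrow> \<exists>i. P i"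
  using ultra by (auto simp: ultrafilter_def dest: eventually_happens')

text \<open>
Suppose that in \<open>M\<close> the formula \<open>\<theta>(y,y')\<close> implies that \<open>y\<close> and \<open>y'\<close> satisfy the same formulas. Then in
almost all \<open>N i\<close> it implies that they satisfy the same of the finitely many formulas which define the
partition that belongs to \<open>\<phi>\<close>.
\<close>

lemma equal_counts:
  assumes \<phi>: "wff ar (k + l) \<phi>" and \<theta>: "wff ar (l + l) \<theta>"
    and types: "\<And>b b' \<psi>. b \<in> tuples M l \<Longrightarrow> b' \<in> tuples M l \<Longrightarrow> sat M (b @ b') \<theta> \<Longrightarrow> wff ar l \<psi> \<Longrightarrow>
      sat M b \<psi> \<longleftrightarrow> sat M b' \<psi>"
  shows "eventually (\<lambda>i. \<forall>b\<in>tuples (N i) l. \<forall>b'\<in>tuples (N i) l. sat (N i) (b @ b') \<theta> \<longrightarrow>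
      card {a \<in> tuples (N i) k. sat (N i) (a @ b) \<phi>} = card {a \<in> tuples (N i) k. sat (N i) (a @ b') \<phi>}) U"
proof -
  obtain P h where P: "finite P" "definable_partition ar C l P"
    and h: "\<forall>\<pi>\<in>P. \<forall>(K, b)\<in>\<pi>. real (card {a \<in> tuples K k. sat K (a @ b) \<phi>}) = h \<pi> K"
    using mec \<phi> unfolding mec_def by blast
  have "\<forall>\<pi>\<in>P. \<exists>\<psi>. wff ar l \<psi> \<and>
      (\<forall>K\<in>C. {b \<in> tuples K l. sat K b \<psi>} = {b \<in> tuples K l. (K, b) \<in> \<pi>})"
    using P(2) unfolding definable_partition_def by blast
  from bchoice[OF this] obtain \<psi> where *: "\<forall>\<pi>\<in>P. wff ar l (\<psi> \<pi>) \<and>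
      (\<forall>K\<in>C. {b \<in> tuples K l. sat K b (\<psi> \<pi>)} = {b \<in> tuples K l. (K, b) \<in> \<pi>})"
    by (rule exE)
  then have \<psi>: "\<And>\<pi>. \<pi> \<in> P \<Longrightarrow> wff ar l (\<psi> \<pi>)"
    "\<And>\<pi> K. \<pi> \<in> P \<Longrightarrow> K \<in> C \<Longrightarrow> {b \<in> tuples K l. sat K b (\<psi> \<pi>)} = {b \<in> tuples K l. (K, b) \<in> \<pi>}"
    by blast+
  define \<sigma> where "\<sigma> \<pi> = alls (l + l) (Imp \<theta> (Iff (ren (\<lambda>i. i) (\<psi> \<pi>)) (ren (\<lambda>i. l + i) (\<psi> \<pi>))))" for \<pi>
  have "eventually (\<lambda>i. \<forall>\<pi>\<in>P. sat (N i) [] (\<sigma> \<pi>)) U"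
  proof (intro eventually_ball_finite P(1) ballI)
    fix \<pi> assume \<pi>: "\<pi> \<in> P"
    have "wff ar 0 (\<sigma> \<pi>)"
      using \<theta> wff_ren[OF \<psi>(1)[OF \<pi>]] by (simp add: \<sigma>_def)
    moreover have "sat M [] (\<sigma> \<pi>)"
      unfolding \<sigma>_def sat_alls
    proof
      fix w assume "w \<in> tuples M (l + l)"
      then obtain b b' where b: "b \<in> tuples M l" "b' \<in> tuples M l" "w = b @ b'"
        using tuples_split by blast
      show "sat M (w @ []) (Imp \<theta> (Iff (ren (\<lambda>i. i) (\<psi> \<pi>)) (ren (\<lambda>i. l + i) (\<psi> \<pi>))))"
        using types[OF b(1,2) _ \<psi>(1)[OF \<pi>]] sat_ren_append[OF \<psi>(1)[OF \<pi>] b(1,2)[THEN tuples_length]]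
        by (simp add: b(3))
    qed
    ultimately show "eventually (\<lambda>i. sat (N i) [] (\<sigma> \<pi>)) U" using sentence_iff by blast
  qed
  then show ?thesis
  proof eventually_elim
    case (elim i)
    show ?case
    proof (intro ballI impI)
      fix b b' assume b: "b \<in> tuples (N i) l" "b' \<in> tuples (N i) l" "sat (N i) (b @ b') \<theta>"
      have "(N i, b) \<in> \<Union>P"
        using P(2) b(1) N[of i] by (simp add: definable_partition_def partition_on_def class_tuples_def)
      then obtain \<pi> where \<pi>: "\<pi> \<in> P" "(N i, b) \<in> \<pi>" by blast
      have "b @ b' \<in> tuples (N i) (l + l)" using b by (auto simp: tuples_def)
      then have "sat (N i) ((b @ b') @ []) (Imp \<theta> (Iff (ren (\<lambda>i. i) (\<psi> \<pi>)) (ren (\<lambda>i. l + i) (\<psi> \<pi>))))"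
        using elim \<pi>(1) unfolding \<sigma>_def sat_alls by blast
      then have "sat (N i) b (\<psi> \<pi>) \<longleftrightarrow> sat (N i) b' (\<psi> \<pi>)"
        using b(3) sat_ren_append[OF \<psi>(1)[OF \<pi>(1)] b(1,2)[THEN tuples_length]] by simp
      then have "(N i, b') \<in> \<pi>" using \<psi>(2)[OF \<pi>(1) N[of i]] b \<pi>(2) by blast
      then have "real (card {a \<in> tuples (N i) k. sat (N i) (a @ b) \<phi>}) =
          real (card {a \<in> tuples (N i) k. sat (N i) (a @ b') \<phi>})"
        using bspec[OF bspec[OF h \<pi>(1)] \<pi>(2)] bspec[OF bspec[OF h \<pi>(1)] \<open>(N i, b') \<in> \<pi>\<close>] by simp
      then show "card {a \<in> tuples (N i) k. sat (N i) (a @ b) \<phi>} = card {a \<in> tuples (N i) k. sat (N i) (a @ b') \<phi>}"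
        by simp
    qed
  qed
qed

end

section \<open>The strict order property\<close>

text \<open>
Within one member of the class, the size of a set defined by \<open>\<phi>\<close> depends only on the part of the
partition that contains the parameters.
\<close>

lemma mec_counts_bounded:
  assumes mec: "mec ar C" and \<phi>: "wff ar (k + l) \<phi>"
  shows "\<exists>B. \<forall>K\<in>C. card ((\<lambda>b. card {a \<in> tuples K k. sat K (a @ b) \<phi>}) ` tuples K l) \<le> B"
proof -
  obtain P h where P: "finite P" "definable_partition ar C l P"
    and h: "\<forall>\<pi>\<in>P. \<forall>(K, b)\<in>\<pi>. real (card {a \<in> tuples K k. sat K (a @ b) \<phi>}) = h \<pi> K"
    using mec \<phi> unfolding mec_def by blast
  have "card ((\<lambda>b. card {a \<in> tuples K k. sat K (a @ b) \<phi>}) ` tuples K l) \<le> card P" if K: "K \<in> C" for K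
  proof -
    let ?c = "\<lambda>b. card {a \<in> tuples K k. sat K (a @ b) \<phi>}"
    have "real ` ?c ` tuples K l \<subseteq> (\<lambda>\<pi>. h \<pi> K) ` P"
    proof
      fix x assume "x \<in> real ` ?c ` tuples K l"
      then obtain b where b: "b \<in> tuples K l" "x = real (?c b)" by blast
      then have "(K, b) \<in> \<Union>P"
        using P(2) K by (simp add: definable_partition_def partition_on_def class_tuples_def)
      then obtain \<pi> where "\<pi> \<in> P" "(K, b) \<in> \<pi>" by blast
      then have "x = h \<pi> K" using h b(2) by blast
      then show "x \<in> (\<lambda>\<pi>. h \<pi> K) ` P" using \<open>\<pi> \<in> P\<close> by blast
    qed
    then have "card (real ` ?c ` tuples K l) \<le> card P"
      using P(1) by (meson card_image_le card_mono finite_imageI le_trans)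
    moreover have "card (real ` ?c ` tuples K l) = card (?c ` tuples K l)"
      by (rule card_image) (simp add: inj_on_def)
    ultimately show ?thesis by simp
  qed
  then show ?thesis by blast
qed

text \<open>
An assignment of the variables of \<open>chain_form\<close> consists of \<open>q\<close> consecutive segments of length \<open>n\<close>, followed by the
parameters \<open>c\<close> of \<open>\<phi>\<close>. The formula says that the relation \<open>\<phi>(x,y,c)\<close> between \<open>n\<close>-tuples is transitive and
that the segments form a chain of \<open>q\<close> elements in it.
\<close>

definition seg :: "nat \<Rightarrow> nat \<Rightarrow> 'a list \<Rightarrow> 'a list" where
  "seg n i e = take n (drop (i * n) e)"

definition pair_form :: "nat \<Rightarrow> nat \<Rightarrow> 'r form \<Rightarrow> nat \<Rightarrow> nat \<Rightarrow> 'r form" where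
  "pair_form n q \<phi> i j = ren (\<lambda>t. if t < n then i * n + t else if t < n + n then j * n + (t - n)
     else q * n + (t - (n + n))) \<phi>"

definition chain_form :: "nat \<Rightarrow> nat \<Rightarrow> 'r form \<Rightarrow> 'r form" where
  "chain_form n q \<phi> = Conj
     (alls (3 * n) (Imp (Conj (pair_form n (3 + q) \<phi> 0 1) (pair_form n (3 + q) \<phi> 1 2)) (pair_form n (3 + q) \<phi> 0 2)))
     (conjs (concat (map (\<lambda>i. map (\<lambda>j. if i = j then pair_form n q \<phi> i j
         else Iff (pair_form n q \<phi> i j) (Neg (pair_form n q \<phi> j i))) [0..<q]) [0..<q])))"

lemma ball_concat_map:
  "(\<forall>x\<in>set (concat (map (\<lambda>i. map (F i) [0..<q]) [0..<q'])). P x) \<longleftrightarrow> (\<forall>i<q'. \<forall>j<q. P (F i j))"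
  by auto

lemma all_less_cong: "(\<And>i j. i < q \<Longrightarrow> j < q \<Longrightarrow> P i j \<longleftrightarrow> P' i j) \<Longrightarrow>
  (\<forall>i<(q::nat). \<forall>j<q. P i j) \<longleftrightarrow> (\<forall>i<q. \<forall>j<q. P' i j)"
  by simp

lemma seg_less: "i < q \<Longrightarrow> t < n \<Longrightarrow> i * n + t < q * (n::nat)"
proof -
  assume "i < q" "t < n"
  then have "i * n + t < Suc i * n" by simp
  also have "\<dots> \<le> q * n" using \<open>i < q\<close> by (intro mult_le_mono1) simp
  finally show ?thesis .
qed

lemma wff_pair_form:
  assumes "wff ar (n + (n + m)) \<phi>" "i < q" "j < q"
  shows "wff ar (q * n + m) (pair_form n q \<phi> i j)"
  unfolding pair_form_def
proof (intro wff_ren[OF assms(1)] allI impI)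
  fix t assume "t < n + (n + m)"
  then show "(if t < n then i * n + t else if t < n + n then j * n + (t - n)
     else q * n + (t - (n + n))) < q * n + m"
    using seg_less[OF assms(2), of t n] seg_less[OF assms(3), of "t - n" n]
    by (cases "t < n"; cases "t < n + n") (simp_all, linarith?)
qed

lemma sat_pair_form:
  assumes "wff ar (n + (n + m)) \<phi>" "i < q" "j < q" "length e = q * n + m"
  shows "sat K e (pair_form n q \<phi> i j) \<longleftrightarrow> sat K (seg n i e @ seg n j e @ drop (q * n) e) \<phi>"
proof -
  have "Suc i * n \<le> q * n" "Suc j * n \<le> q * n" using assms by (intro mult_le_mono1; simp)+
  then have len: "length (seg n i e) = n" "length (seg n j e) = n" "length (drop (q * n) e) = m"
    using assms(4) by (auto simp: seg_def)
  have nth: "seg n i e ! t = e ! (i * n + t)" "seg n j e ! t = e ! (j * n + t)" if "t < n" for t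
    using that assms(4) \<open>Suc i * n \<le> q * n\<close> \<open>Suc j * n \<le> q * n\<close> by (auto simp: seg_def)
  show ?thesis unfolding pair_form_def
    using assms(1) len nth assms(4) by (intro sat_ren) (auto simp: nth_append)
qed

lemma wff_chain_form:
  assumes "wff ar (n + (n + m)) \<phi>"
  shows "wff ar (q * n + m) (chain_form n q \<phi>)"
proof -
  have e: "3 * n + (q * n + m) = (3 + q) * n + m" by (simp add: algebra_simps)
  show ?thesis
    using wff_pair_form[OF assms, of _ "3 + q"] wff_pair_form[OF assms, of _ q]
    unfolding chain_form_def wff.simps wff_alls wff_Imp e by auto
qed

lemma seg_append:
  assumes "length x = n" "length y = n" "length z = n"
  shows "seg n 0 (x @ y @ z @ e) = x" "seg n 1 (x @ y @ z @ e) = y" "seg n 2 (x @ y @ z @ e) = z"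
    "drop ((3 + q) * n) (x @ y @ z @ e) = drop (q * n) e"
  using assms by (auto simp: seg_def algebra_simps numeral_2_eq_2 numeral_3_eq_3)

lemma sat_chain_form:
  assumes \<phi>: "wff ar (n + (n + m)) \<phi>" and e: "e \<in> tuples K (q * n + m)"
  defines "Q \<equiv> \<lambda>x y. sat K (x @ y @ drop (q * n) e) \<phi>"
  shows "sat K e (chain_form n q \<phi>) \<longleftrightarrow>
    (\<forall>x\<in>tuples K n. \<forall>y\<in>tuples K n. \<forall>z\<in>tuples K n. Q x y \<and> Q y z \<longrightarrow> Q x z) \<and>
    (\<forall>i<q. \<forall>j<q. if i = j then Q (seg n i e) (seg n j e)
       else Q (seg n i e) (seg n j e) \<longleftrightarrow> \<not> Q (seg n j e) (seg n i e))"
proof -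
  have len: "length e = q * n + m" using e by (simp add: tuples_length)
  have p: "sat K e (pair_form n q \<phi> i j) \<longleftrightarrow> Q (seg n i e) (seg n j e)" if "i < q" "j < q" for i j
    unfolding Q_def by (rule sat_pair_form[OF \<phi> that len])
  have p3: "sat K (x @ y @ z @ e) (pair_form n (3 + q) \<phi> 0 1) \<longleftrightarrow> Q x y"
    "sat K (x @ y @ z @ e) (pair_form n (3 + q) \<phi> 1 2) \<longleftrightarrow> Q y z"
    "sat K (x @ y @ z @ e) (pair_form n (3 + q) \<phi> 0 2) \<longleftrightarrow> Q x z"
    if "length x = n" "length y = n" "length z = n" for x y z
  proof -
    have l: "length (x @ y @ z @ e) = (3 + q) * n + m" using that len by (simp add: algebra_simps)
    show "sat K (x @ y @ z @ e) (pair_form n (3 + q) \<phi> 0 1) \<longleftrightarrow> Q x y"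
      "sat K (x @ y @ z @ e) (pair_form n (3 + q) \<phi> 1 2) \<longleftrightarrow> Q y z"
      "sat K (x @ y @ z @ e) (pair_form n (3 + q) \<phi> 0 2) \<longleftrightarrow> Q x z"
      using sat_pair_form[OF \<phi> _ _ l, of 0 1 K] sat_pair_form[OF \<phi> _ _ l, of 1 2 K]
        sat_pair_form[OF \<phi> _ _ l, of 0 2 K] unfolding seg_append[OF that] Q_def by simp_all
  qed
  have t3: "w \<in> tuples K (3 * n) \<longleftrightarrow> (\<exists>x\<in>tuples K n. \<exists>y\<in>tuples K n. \<exists>z\<in>tuples K n. w = x @ y @ z)" for w
  proof
    assume "w \<in> tuples K (3 * n)"
    moreover have "3 * n = n + (n + n)" by simp
    ultimately have "w \<in> tuples K (n + (n + n))" by (simp only:)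
    then show "\<exists>x\<in>tuples K n. \<exists>y\<in>tuples K n. \<exists>z\<in>tuples K n. w = x @ y @ z"
      by (metis tuples_split)
  qed (auto simp: tuples_def)
  have trans: "(\<forall>w\<in>tuples K (3 * n). sat K (w @ e) (Imp (Conj (pair_form n (3 + q) \<phi> 0 1) (pair_form n (3 + q) \<phi> 1 2)) (pair_form n (3 + q) \<phi> 0 2)))
    \<longleftrightarrow> (\<forall>x\<in>tuples K n. \<forall>y\<in>tuples K n. \<forall>z\<in>tuples K n. Q x y \<and> Q y z \<longrightarrow> Q x z)"
    (is "?L \<longleftrightarrow> ?R")
  proof
    assume L: ?L
    show ?R
    proof (intro ballI)
      fix x y z assume xyz: "x \<in> tuples K n" "y \<in> tuples K n" "z \<in> tuples K n"
      then have "x @ y @ z \<in> tuples K (3 * n)" using t3 by blast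
      from bspec[OF L this] show "Q x y \<and> Q y z \<longrightarrow> Q x z"
        using p3[OF xyz[THEN tuples_length]] by simp
    qed
  next
    assume R: ?R
    show ?L
    proof
      fix w assume "w \<in> tuples K (3 * n)"
      then obtain x y z where xyz: "x \<in> tuples K n" "y \<in> tuples K n" "z \<in> tuples K n" "w = x @ y @ z"
        using t3 by blast
      show "sat K (w @ e) (Imp (Conj (pair_form n (3 + q) \<phi> 0 1) (pair_form n (3 + q) \<phi> 1 2)) (pair_form n (3 + q) \<phi> 0 2))"
        using bspec[OF bspec[OF bspec[OF R xyz(1)] xyz(2)] xyz(3)] p3[OF xyz(1-3)[THEN tuples_length]]
        by (simp add: xyz(4))
    qed
  qed
  have "sat K e (if i = j then pair_form n q \<phi> i j else Iff (pair_form n q \<phi> i j) (Neg (pair_form n q \<phi> j i))) \<longleftrightarrow>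
    (if i = j then Q (seg n i e) (seg n j e) else Q (seg n i e) (seg n j e) \<longleftrightarrow> \<not> Q (seg n j e) (seg n i e))"
    if "i < q" "j < q" for i j
    using p that by simp
  from all_less_cong[OF this] show ?thesis
    unfolding chain_form_def sat.simps sat_alls sat_conjs trans ball_concat_map by (rule arg_cong)
qed

text \<open>
In a finite structure, the sets of predecessors of the members of a chain are strictly increasing,
so they have pairwise different sizes.
\<close>

lemma chain_form_counts:
  assumes \<phi>: "wff ar (n + (n + m)) \<phi>" and e: "e \<in> tuples K (q * n + m)" and fin: "finite (univ K)"
    and sat: "sat K e (chain_form n q \<phi>)"
  shows "q \<le> card ((\<lambda>b. card {a \<in> tuples K n. sat K (a @ b) \<phi>}) ` tuples K (n + m))"
proof -
  define c where "c = drop (q * n) e"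
  define Q where "Q x y \<longleftrightarrow> sat K (x @ y @ c) \<phi>" for x y
  define x where "x i = seg n i e" for i
  define D where "D i = {a \<in> tuples K n. sat K (a @ x i @ c) \<phi>}" for i
  have len: "length e = q * n + m" using e by (simp add: tuples_length)
  have c: "c \<in> tuples K m" using e by (auto simp: c_def tuples_def dest: in_set_dropD)
  have x: "x i \<in> tuples K n" if "i < q" for i
  proof -
    have "Suc i * n \<le> q * n" using that by (intro mult_le_mono1) simp
    then show ?thesis using e by (auto simp: x_def seg_def tuples_def dest!: in_set_takeD in_set_dropD)
  qed
  have *: "\<forall>x\<in>tuples K n. \<forall>y\<in>tuples K n. \<forall>z\<in>tuples K n. Q x y \<and> Q y z \<longrightarrow> Q x z"
    "\<forall>i<q. \<forall>j<q. if i = j then Q (x i) (x j) else Q (x i) (x j) \<longleftrightarrow> \<not> Q (x j) (x i)"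
    using sat unfolding sat_chain_form[OF \<phi> e] Q_def x_def c_def by blast+
  have finD: "finite (D i)" for i
    by (rule finite_subset[OF _ finite_lists_length_eq[OF fin, of n]]) (auto simp: D_def tuples_def)
  have refl: "Q (x i) (x i)" if "i < q" for i
    using *(2)[rule_format, OF that that] by simp
  have tot: "Q (x i) (x j) \<longleftrightarrow> \<not> Q (x j) (x i)" if "i < q" "j < q" "i \<noteq> j" for i j
    using *(2)[rule_format, OF that(1,2)] that(3) by simp
  have less: "card (D i) < card (D j)" if ij: "i < q" "j < q" "i \<noteq> j" "Q (x i) (x j)" for i j
  proof (rule psubset_card_mono[OF finD])
    have "D i \<subseteq> D j"
    proof
      fix a assume "a \<in> D i"
      then have a: "a \<in> tuples K n" "Q a (x i)" by (simp_all add: D_def Q_def)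
      then have "Q a (x j)"
        using bspec[OF bspec[OF bspec[OF *(1) a(1)] x[OF ij(1)]] x[OF ij(2)]] ij(4) by blast
      then show "a \<in> D j" using a(1) by (simp add: D_def Q_def)
    qed
    moreover have "Q (x j) (x j)" "\<not> Q (x j) (x i)" using refl tot ij by blast+
    then have "x j \<in> D j" "x j \<notin> D i" using x[OF ij(2)] by (simp_all add: D_def Q_def)
    ultimately show "D i \<subset> D j" by blast
  qed
  have "card (D i) \<noteq> card (D j)" if "i < q" "j < q" "i \<noteq> j" for i j
  proof -
    have "Q (x i) (x j) \<or> Q (x j) (x i)" using tot that by blast
    then show ?thesis using less[OF that] less[OF that(2,1)] that(3) by auto
  qed
  then have "inj_on (\<lambda>i. card (D i)) {..<q}" by (auto simp: inj_on_def)
  then have "q = card ((\<lambda>i. card (D i)) ` {..<q})" by (simp add: card_image)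
  also have "\<dots> \<le> card ((\<lambda>b. card {a \<in> tuples K n. sat K (a @ b) \<phi>}) ` tuples K (n + m))"
  proof (rule card_mono)
    show "finite ((\<lambda>b. card {a \<in> tuples K n. sat K (a @ b) \<phi>}) ` tuples K (n + m))"
      using finite_lists_length_eq[OF fin, of "n + m"] by (simp add: tuples_def)
    have "x i @ c \<in> tuples K (n + m)" if "i < q" for i using x[OF that] c by (auto simp: tuples_def)
    then show "(\<lambda>i. card (D i)) ` {..<q} \<subseteq> (\<lambda>b. card {a \<in> tuples K n. sat K (a @ b) \<phi>}) ` tuples K (n + m)"
      unfolding D_def by blast
  qed
  finally show ?thesis .
qed

lemma chain_tuple:
  assumes x: "\<And>i. i < q \<Longrightarrow> x i \<in> tuples K n" and c: "c \<in> tuples K m"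
  shows "\<exists>e\<in>tuples K (q * n + m). (\<forall>i<q. seg n i e = x i) \<and> drop (q * n) e = c"
proof -
  define e where "e = concat (map x [0..<q]) @ c"
  have len: "length (concat (map x [0..<r])) = r * n" if "r \<le> q" for r
    using that
  proof (induction r)
    case (Suc r)
    then show ?case using tuples_length[OF x[of r]] by simp
  qed simp
  have "seg n i e = x i" if "i < q" for i
  proof -
    have "[0..<q] = [0..<i] @ i # [Suc i..<q]" 
      using that upt_add_eq_append[of 0 i "q - i"] by (simp add: upt_conv_Cons)
    then have "e = concat (map x [0..<i]) @ x i @ (concat (map x [Suc i..<q]) @ c)" by (simp add: e_def)
    then show ?thesis using len[of i] that x[OF that] by (simp add: seg_def tuples_length)
  qed
  moreover have "drop (q * n) e = c" using len[of q] by (simp add: e_def)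
  moreover have "e \<in> tuples K (q * n + m)"
    using x c len[of q] by (fastforce simp: e_def tuples_def)
  ultimately show ?thesis by blast
qed

text \<open>
For every length, a chain of classes in an interpretable partial order yields a chain of
representatives in the definable preorder that it comes from. The existence of such a chain is
expressed by a sentence and is inherited by some \<open>N i\<close>.
\<close>

lemma (in mec_ultraproduct) not_strict_order_property:
  assumes "strict_order_property TYPE('n) ar (theory_of ar M)"
  shows False
proof -
  obtain K :: "('r, 'n) rel_struct" and n D E P S where K: "is_model ar K (theory_of ar M)"
    and P: "interpretable_partial_order ar K n D E P"
    and S: "S \<subseteq> D // E" "infinite S" "total_on S P"
    using assms unfolding strict_order_property_def by blast
  have eq: "equiv D E" and po: "partial_order_on (D // E) P"
    and def: "definable_rel ar K n {(x, y) \<in> D \<times> D. (E `` {x}, E `` {y}) \<in> P}"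
    and D: "definable ar K n D"
    using P unfolding interpretable_partial_order_def by blast+
  obtain m \<phi> c where \<phi>: "wff ar (n + n + m) \<phi>" and c: "c \<in> tuples K m"
    and X: "{x @ y | x y. (x, y) \<in> {(x, y) \<in> D \<times> D. (E `` {x}, E `` {y}) \<in> P}} =
      {a \<in> tuples K (n + n). sat K (a @ c) \<phi>}"
    using def unfolding definable_rel_def definable_def by blast
  have Dn: "D \<subseteq> tuples K n" using D unfolding definable_def by blast
  define Q where "Q x y \<longleftrightarrow> sat K (x @ y @ c) \<phi>" for x y
  have Q: "Q x y \<longleftrightarrow> x \<in> D \<and> y \<in> D \<and> (E `` {x}, E `` {y}) \<in> P"
    if xy: "x \<in> tuples K n" "y \<in> tuples K n" for x y
  proof -
    have "Q x y \<longleftrightarrow> x @ y \<in> {a \<in> tuples K (n + n). sat K (a @ c) \<phi>}"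
      using xy by (auto simp: Q_def tuples_def)
    also have "\<dots> \<longleftrightarrow> x @ y \<in> {x @ y | x y. (x, y) \<in> {(x, y) \<in> D \<times> D. (E `` {x}, E `` {y}) \<in> P}}"
      unfolding X ..
    also have "\<dots> \<longleftrightarrow> x \<in> D \<and> y \<in> D \<and> (E `` {x}, E `` {y}) \<in> P"
    proof
      assume "x @ y \<in> {x @ y | x y. (x, y) \<in> {(x, y) \<in> D \<times> D. (E `` {x}, E `` {y}) \<in> P}}"
      then obtain x' y' where *: "x @ y = x' @ y'" "x' \<in> D" "y' \<in> D" "(E `` {x'}, E `` {y'}) \<in> P" by blast
      have "x' \<in> tuples K n" using *(2) Dn by blast
      then have "length x = length x'" using xy by (simp add: tuples_length)
      then have "x = x'" "y = y'" using *(1) by simp_all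
      then show "x \<in> D \<and> y \<in> D \<and> (E `` {x}, E `` {y}) \<in> P" using *(2-4) by blast
    qed blast
    finally show ?thesis .
  qed
  have \<phi>': "wff ar (n + (n + m)) \<phi>" using \<phi> by (simp add: add.assoc)
  obtain B where B: "\<And>K. K \<in> C \<Longrightarrow> card ((\<lambda>b. card {a \<in> tuples K n. sat K (a @ b) \<phi>}) ` tuples K (n + m)) \<le> B"
    using mec_counts_bounded[OF mec \<phi>'] by blast
  \<comment> \<open>One element more than there are different sizes of definable sets.\<close>
  define q where "q = Suc B"
  obtain T where T: "T \<subseteq> S" "finite T" "card T = q" using infinite_arbitrarily_large[OF S(2)] by blast
  obtain g where g: "bij_betw g {..<q} T" using T by (metis bij_betw_from_nat_into_finite ex_bij_betw_nat_finite lessThan_atLeast0)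
  have "\<exists>x. x \<in> D \<and> g i = E `` {x}" if "i < q" for i
  proof -
    have "g i \<in> D // E" using g that T(1) S(1) by (auto simp: bij_betw_def)
    then show ?thesis by (auto simp: quotient_def)
  qed
  then have "\<exists>x. \<forall>i. i < q \<longrightarrow> x i \<in> D \<and> g i = E `` {x i}" by (intro choice) blast
  then obtain x where x: "\<And>i. i < q \<Longrightarrow> x i \<in> D" "\<And>i. i < q \<Longrightarrow> g i = E `` {x i}" by blast
  then have xt: "x i \<in> tuples K n" if "i < q" for i using Dn that by blast
  obtain e where e: "e \<in> tuples K (q * n + m)" "\<And>i. i < q \<Longrightarrow> seg n i e = x i" "drop (q * n) e = c"
    using chain_tuple[of q x K n c m, OF xt c] by blast
  have refl: "(a, a) \<in> P" if "a \<in> D // E" for a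
    using po that by (auto simp: partial_order_on_def preorder_on_def refl_on_def)
  have trans: "trans P" and antisym: "antisym P"
    using po by (auto simp: partial_order_on_def preorder_on_def)
  have "sat K e (chain_form n q \<phi>)"
    unfolding sat_chain_form[OF \<phi>' e(1)] e(3) Q_def[symmetric]
  proof (intro conjI ballI allI impI)
    fix u v w assume uvw: "u \<in> tuples K n" "v \<in> tuples K n" "w \<in> tuples K n" "Q u v \<and> Q v w"
    then show "Q u w" using Q transD[OF trans] by blast
  next
    fix i j assume ij: "i < q" "j < q"
    have mem: "g i \<in> S" "g j \<in> S" using g ij T(1) by (auto simp: bij_betw_def)
    have Qij: "Q (x i) (x j) \<longleftrightarrow> (g i, g j) \<in> P" "Q (x j) (x i) \<longleftrightarrow> (g j, g i) \<in> P"
      using Q[OF xt xt] x ij by auto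
    show "if i = j then Q (seg n i e) (seg n j e) else Q (seg n i e) (seg n j e) \<longleftrightarrow> \<not> Q (seg n j e) (seg n i e)"
    proof (cases "i = j")
      case True
      then show ?thesis using Qij e(2) ij mem S(1) refl by auto
    next
      case False
      then have "g i \<noteq> g j" using g ij by (auto simp: bij_betw_def inj_on_def)
      then show ?thesis
        using Qij e(2) ij mem S(3) antisymD[OF antisym] False unfolding total_on_def by metis
    qed
  qed
  then have "sat K [] (exs (q * n + m) (chain_form n q \<phi>))" using e(1) by auto
  moreover have w: "wff ar 0 (exs (q * n + m) (chain_form n q \<phi>))" using wff_chain_form[OF \<phi>'] by simp
  ultimately have "eventually (\<lambda>i. sat (N i) [] (exs (q * n + m) (chain_form n q \<phi>))) U"
    using model_theory_sat[OF K w] sentence_iff[OF w] by blast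
  then obtain i where "sat (N i) [] (exs (q * n + m) (chain_form n q \<phi>))" using eventually_ex by blast
  then obtain e' where "e' \<in> tuples (N i) (q * n + m)" "sat (N i) e' (chain_form n q \<phi>)" by auto
  from chain_form_counts[OF \<phi>' this(1) N_finite this(2)] B[OF N[of i]]
  show False by (simp add: q_def)
qed

section \<open>Homogeneous structures with one binary relation\<close>

definition arc :: "(arc_lang, 'a) rel_struct \<Rightarrow> 'a \<Rightarrow> 'a \<Rightarrow> bool" where
  "arc M x y \<longleftrightarrow> [x, y] \<in> rel M Arc"

lemma sat_arc [simp]: "sat M e (Rel Arc [i, j]) \<longleftrightarrow> arc M (e ! i) (e ! j)"
  by (simp add: arc_def)

text \<open>Atomic formulas are evaluated by \<open>sat_arc\<close>, which keeps them in terms of \<open>arc\<close>.\<close>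

declare sat.simps(2) [simp del]

declare arc_ar_def [simp]

definition lit :: "bool \<Rightarrow> 'r form \<Rightarrow> 'r form" where
  "lit b \<phi> = (if b then \<phi> else Neg \<phi>)"

lemma wff_lit [simp]: "wff ar n (lit b \<phi>) \<longleftrightarrow> wff ar n \<phi>"
  and sat_lit [simp]: "sat M e (lit b \<phi>) \<longleftrightarrow> (sat M e \<phi> \<longleftrightarrow> b)"
  by (auto simp: lit_def)

definition same_type_form :: "nat \<Rightarrow> arc_lang form" where
  "same_type_form l = conjs (concat (map (\<lambda>i. map (\<lambda>j. Conj (Iff (Eq i j) (Eq (l + i) (l + j)))
     (Iff (Rel Arc [i, j]) (Rel Arc [l + i, l + j]))) [0..<l]) [0..<l]))"

lemma wff_same_type_form: "wff arc_ar (l + l) (same_type_form l)"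
  unfolding same_type_form_def wff_conjs ball_concat_map by simp

lemma sat_same_type_form:
  assumes "length b = l" "length b' = l"
  shows "sat M (b @ b') (same_type_form l) \<longleftrightarrow> same_type (arc M) b b'"
  unfolding same_type_form_def sat_conjs ball_concat_map same_type_def
  using assms by (simp add: nth_append)

definition ext_form :: "(bool \<times> bool) list \<Rightarrow> arc_lang form" where
  "ext_form ps = conjs (map (\<lambda>i. Conj (Neg (Eq 0 (Suc i)))
     (Conj (lit (fst (ps ! i)) (Rel Arc [0, Suc i])) (lit (snd (ps ! i)) (Rel Arc [Suc i, 0])))) [0..<length ps])"

lemma wff_ext_form: "wff arc_ar (1 + length ps) (ext_form ps)"
  by (auto simp: ext_form_def)

lemma sat_ext_form:
  assumes "length b = length ps"
  shows "sat M (v # b) (ext_form ps) \<longleftrightarrow> list_all2 (\<lambda>x p. v \<noteq> x \<and> (arc M v x, arc M x v) = p) b ps"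
  unfolding ext_form_def using assms by (auto simp: list_all2_conv_all_nth prod_eq_iff)

lemma tuples_1: "tuples M 1 = (\<lambda>v. [v]) ` univ M"
  by (auto simp: tuples_def length_Suc_conv)

lemma card_ext_form:
  assumes "length b = length ps"
  shows "card {a \<in> tuples M 1. sat M (a @ b) (ext_form ps)} = card (ext (univ M) (arc M) b ps)"
proof -
  have "{a \<in> tuples M 1. sat M (a @ b) (ext_form ps)} = (\<lambda>v. [v]) ` ext (univ M) (arc M) b ps"
    unfolding tuples_1 ext_def using sat_ext_form[OF assms, of M] by auto
  then show ?thesis by (simp add: card_image inj_on_def)
qed

text \<open>
The matrices \<open>E\<close> and \<open>A\<close> prescribe the equalities and the arcs among the entries of a tuple.
\<close>

definition pattern_form :: "nat \<Rightarrow> (nat \<Rightarrow> nat \<Rightarrow> bool) \<Rightarrow> (nat \<Rightarrow> nat \<Rightarrow> bool) \<Rightarrow> arc_lang form" where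
  "pattern_form l E A = conjs (concat (map (\<lambda>i. map (\<lambda>j. Conj (lit (E i j) (Eq i j))
     (lit (A i j) (Rel Arc [i, j]))) [0..<l]) [0..<l]))"

lemma wff_pattern_form: "wff arc_ar l (pattern_form l E A)"
  unfolding pattern_form_def wff_conjs ball_concat_map by simp

lemma sat_pattern_form:
  "sat M b (pattern_form l E A) \<longleftrightarrow> (\<forall>i<l. \<forall>j<l. (b ! i = b ! j \<longleftrightarrow> E i j) \<and> (arc M (b ! i) (b ! j) \<longleftrightarrow> A i j))"
  unfolding pattern_form_def sat_conjs ball_concat_map by simp

text \<open>
The map between two tuples of the same type is an isomorphism of finite substructures and extends to
an automorphism.
\<close>

lemma homogeneous_types:
  assumes hom: "homogeneous arc_ar M" and b: "b \<in> tuples M l" "b' \<in> tuples M l"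
    and st: "same_type (arc M) b b'" and \<psi>: "wff arc_ar l \<psi>"
  shows "sat M b \<psi> \<longleftrightarrow> sat M b' \<psi>"
proof -
  have len: "length b = l" "length b' = l" using b by (simp_all add: tuples_length)
  have st': "b ! i = b ! j \<longleftrightarrow> b' ! i = b' ! j" "arc M (b ! i) (b ! j) \<longleftrightarrow> arc M (b' ! i) (b' ! j)"
    if "i < l" "j < l" for i j
    using st that len by (auto simp: same_type_def)
  define f where "f x = b' ! (SOME i. i < l \<and> b ! i = x)" for x
  have f: "f (b ! i) = b' ! i" if "i < l" for i
  proof -
    have "(SOME j. j < l \<and> b ! j = b ! i) < l \<and> b ! (SOME j. j < l \<and> b ! j = b ! i) = b ! i"
      by (rule someI[of _ i]) (use that in simp)
    then show ?thesis unfolding f_def using st'(1)[of _ i] that by blast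
  qed
  have sets: "set b = (\<lambda>i. b ! i) ` {..<l}" "set b' = (\<lambda>i. b' ! i) ` {..<l}"
    using len by (auto simp: set_conv_nth)
  have "isomorphism arc_ar (substructure M (set b)) (substructure M (set b')) f"
    unfolding isomorphism_def
  proof (intro conjI allI ballI)
    show "bij_betw f (univ (substructure M (set b))) (univ (substructure M (set b')))"
      unfolding bij_betw_def inj_on_def substructure_def using f st'(1) by (auto simp: sets image_iff)
    fix r xs assume "xs \<in> tuples (substructure M (set b)) (arc_ar r)"
    then have xs: "set xs \<subseteq> set b" "length xs = 2" by (auto simp: tuples_def substructure_def arc_ar_def)
    then obtain x y where xy: "xs = [x, y]" by (auto simp: numeral_2_eq_2 length_Suc_conv)
    then obtain i j where ij: "i < l" "j < l" "x = b ! i" "y = b ! j" using xs sets by auto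
    have r: "r = Arc" by (cases r)
    have "b' ! i \<in> set b'" "b' ! j \<in> set b'" using ij len by auto
    then show "xs \<in> rel (substructure M (set b)) r \<longleftrightarrow> map f xs \<in> rel (substructure M (set b')) r"
      using st'(2)[OF ij(1,2)] xs(1) f ij unfolding xy r by (auto simp: substructure_def arc_def)
  qed
  moreover have "set b \<subseteq> univ M" "set b' \<subseteq> univ M" using b by (auto simp: tuples_def)
  ultimately obtain g where g: "isomorphism arc_ar M M g" "\<forall>x\<in>set b. g x = f x"
    using hom unfolding homogeneous_def by blast
  have "map g b = b'" using g(2) f len by (auto intro!: nth_equalityI)
  then show ?thesis using sat_isomorphism[OF g(1), of b \<psi>] \<psi> len \<open>set b \<subseteq> univ M\<close> by simp
qed

locale arc_ultraproduct = mec_ultraproduct arc_ar C U N M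
  for C :: "(arc_lang, 'a) rel_struct set" and U :: "'i filter"
    and N :: "'i \<Rightarrow> (arc_lang, 'a) rel_struct" and M :: "(arc_lang, 'm) rel_struct"
begin

lemma eventually_tuple_regular:
  assumes hom: "homogeneous arc_ar M"
  shows "eventually (\<lambda>i. tuple_regular t (univ (N i)) (arc (N i))) U"
proof -
  let ?reg = "\<lambda>i ps. \<forall>b\<in>tuples (N i) (length ps). \<forall>b'\<in>tuples (N i) (length ps). same_type (arc (N i)) b b' \<longrightarrow>
      card (ext (univ (N i)) (arc (N i)) b ps) = card (ext (univ (N i)) (arc (N i)) b' ps)"
  have "eventually (\<lambda>i. ?reg i ps) U" for ps
  proof -
    let ?l = "length ps"
    have "eventually (\<lambda>i. \<forall>b\<in>tuples (N i) ?l. \<forall>b'\<in>tuples (N i) ?l. sat (N i) (b @ b') (same_type_form ?l) \<longrightarrow>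
      card {a \<in> tuples (N i) 1. sat (N i) (a @ b) (ext_form ps)} =
      card {a \<in> tuples (N i) 1. sat (N i) (a @ b') (ext_form ps)}) U"
    proof (rule equal_counts[OF wff_ext_form wff_same_type_form])
      fix b b' \<psi> assume "b \<in> tuples M ?l" "b' \<in> tuples M ?l" "sat M (b @ b') (same_type_form ?l)" "wff arc_ar ?l \<psi>"
      then show "sat M b \<psi> \<longleftrightarrow> sat M b' \<psi>"
        using homogeneous_types[OF hom] sat_same_type_form by (metis tuples_length)
    qed
    then show ?thesis
    proof eventually_elim
      case (elim i)
      show ?case
      proof (intro ballI impI)
        fix b b' assume b: "b \<in> tuples (N i) ?l" "b' \<in> tuples (N i) ?l" "same_type (arc (N i)) b b'"
        note len = b(1,2)[THEN tuples_length]
        have "sat (N i) (b @ b') (same_type_form ?l)" using sat_same_type_form[OF len] b(3) by simp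
        from elim[rule_format, OF b(1,2) this]
        show "card (ext (univ (N i)) (arc (N i)) b ps) = card (ext (univ (N i)) (arc (N i)) b' ps)"
          unfolding card_ext_form[OF len(1)] card_ext_form[OF len(2)] .
      qed
    qed
  qed
  moreover have "finite {ps :: (bool \<times> bool) list. set ps \<subseteq> UNIV \<and> length ps \<le> t}"
    by (rule finite_lists_length_le) simp
  ultimately have "eventually (\<lambda>i. \<forall>ps\<in>{ps. set ps \<subseteq> UNIV \<and> length ps \<le> t}. ?reg i ps) U"
    by (intro eventually_ball_finite) auto
  then show ?thesis
  proof eventually_elim
    case (elim i)
    show ?case unfolding tuple_regular_def
    proof (intro conjI allI impI; (elim conjE)?)
      show "finite (univ (N i))" by (rule N_finite)
      fix xs ys :: "'a list" and ps
      assume xs: "set xs \<subseteq> univ (N i)" "set ys \<subseteq> univ (N i)" "length xs \<le> t" "same_type (arc (N i)) xs ys"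
      have len: "length ys = length xs" using xs(4) by (simp add: same_type_def)
      show "card (ext (univ (N i)) (arc (N i)) xs ps) = card (ext (univ (N i)) (arc (N i)) ys ps)"
      proof (cases "length ps = length xs")
        case True
        then show ?thesis using elim xs len by (auto simp: tuples_def)
      next
        case False
        then show ?thesis using len by (simp add: ext_length_neq)
      qed
    qed
  qed
qed

lemma eventually_pattern_iff:
  "(\<exists>b\<in>tuples M l. \<forall>p<l. \<forall>q<l. (b ! p = b ! q \<longleftrightarrow> E p q) \<and> (arc M (b ! p) (b ! q) \<longleftrightarrow> A p q)) \<longleftrightarrow>
   eventually (\<lambda>i. \<exists>b\<in>tuples (N i) l. \<forall>p<l. \<forall>q<l. (b ! p = b ! q \<longleftrightarrow> E p q) \<and>
     (arc (N i) (b ! p) (b ! q) \<longleftrightarrow> A p q)) U"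
  using sentence_iff[of "exs l (pattern_form l E A)"] wff_pattern_form[of l E A]
  by (simp add: sat_pattern_form)

lemma eventually_copy:
  assumes b: "b \<in> tuples M l"
  shows "eventually (\<lambda>i. \<exists>b'\<in>tuples (N i) l. \<forall>p<l. \<forall>q<l. (b' ! p = b' ! q \<longleftrightarrow> b ! p = b ! q) \<and>
     (arc (N i) (b' ! p) (b' ! q) \<longleftrightarrow> arc M (b ! p) (b ! q))) U"
  unfolding eventually_pattern_iff[symmetric, of l "\<lambda>p q. b ! p = b ! q" "\<lambda>p q. arc M (b ! p) (b ! q)"]
  using b by blast

end

section \<open>Tournaments and the digraphs \<open>Q\<^sub>n\<close>\<close>

lemma ball_tuples_2: "(\<forall>xs\<in>tuples M 2. P xs) \<longleftrightarrow> (\<forall>x\<in>univ M. \<forall>y\<in>univ M. P [x, y])"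
proof -
  have "tuples M 2 = {[x, y] | x y. x \<in> univ M \<and> y \<in> univ M}"
    by (auto simp: tuples_def length_Suc_conv numeral_2_eq_2)
  then show ?thesis by auto
qed

lemma bex_tuples_3: "(\<exists>xs\<in>tuples M 3. P xs) \<longleftrightarrow> (\<exists>x\<in>univ M. \<exists>y\<in>univ M. \<exists>z\<in>univ M. P [x, y, z])"
proof -
  have "tuples M 3 = {[x, y, z] | x y z. x \<in> univ M \<and> y \<in> univ M \<and> z \<in> univ M}"
    by (auto simp: tuples_def length_Suc_conv numeral_3_eq_3)
  then show ?thesis by auto
qed

definition asym_form :: "arc_lang form" where
  "asym_form = alls 2 (Imp (Rel Arc [0, 1]) (Neg (Rel Arc [1, 0])))"

definition total_form :: "arc_lang form" where
  "total_form = alls 2 (Imp (Neg (Eq 0 1)) (Imp (Neg (Rel Arc [0, 1])) (Rel Arc [1, 0])))"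

lemma asym_form: "wff arc_ar 0 asym_form"
  "sat M [] asym_form \<longleftrightarrow> (\<forall>x\<in>univ M. \<forall>y\<in>univ M. arc M x y \<longrightarrow> \<not> arc M y x)"
  by (simp_all add: asym_form_def ball_tuples_2)

lemma total_form: "wff arc_ar 0 total_form"
  "sat M [] total_form \<longleftrightarrow> (\<forall>x\<in>univ M. \<forall>y\<in>univ M. x \<noteq> y \<longrightarrow> \<not> arc M x y \<longrightarrow> arc M y x)"
  by (simp_all add: total_form_def ball_tuples_2)

lemma is_digraph_asym: "is_digraph M \<Longrightarrow> arc M x y \<Longrightarrow> \<not> arc M y x"
  unfolding is_digraph_def arcs_def arc_def irrefl_def antisym_def by blast

context arc_ultraproduct
begin

lemma eventually_card_ge:
  assumes "infinite (univ M)"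
  shows "eventually (\<lambda>i. l \<le> card (univ (N i))) U"
proof -
  obtain S where S: "finite S" "card S = l" "S \<subseteq> univ M" using infinite_arbitrarily_large[OF assms] by blast
  obtain b where b: "set b = S" "distinct b" using finite_distinct_list[OF S(1)] by blast
  then have len: "length b = l" using S(2) distinct_card by fastforce
  have "b \<in> tuples M l" using b S len by (simp add: tuples_def)
  from eventually_copy[OF this] show ?thesis
  proof eventually_elim
    case (elim i)
    then obtain b' where b': "b' \<in> tuples (N i) l" "\<And>p q. p < l \<Longrightarrow> q < l \<Longrightarrow> b' ! p = b' ! q \<longleftrightarrow> b ! p = b ! q"
      by blast
    then have "distinct b'"
      using b(2) len by (auto simp: distinct_conv_nth tuples_length)
    then have "card (set b') = l" using b'(1) by (simp add: distinct_card tuples_length)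
    moreover have "card (set b') \<le> card (univ (N i))"
      using b'(1) by (intro card_mono N_finite) (simp add: tuples_def)
    ultimately show ?case by simp
  qed
qed

lemma not_homogeneous_tournament:
  assumes hom: "homogeneous arc_ar M" and T: "is_tournament M" and inf: "infinite (univ M)"
  shows False
proof -
  have "sat M [] asym_form" unfolding asym_form(2) using is_digraph_asym[of M] T unfolding is_tournament_def by blast
  moreover have "sat M [] total_form"
    using T unfolding total_form(2) is_tournament_def total_on_def arcs_def arc_def by blast
  ultimately have "eventually (\<lambda>i. sat (N i) [] asym_form) U" "eventually (\<lambda>i. sat (N i) [] total_form) U"
    using sentence_iff asym_form(1) total_form(1) by blast+
  with eventually_tuple_regular[OF hom, of 3] eventually_card_ge[OF inf, of 4]
  have "eventually (\<lambda>i. False) U"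
  proof eventually_elim
    case (elim i)
    have "tournament_on (univ (N i)) (arc (N i))"
      using elim(3,4) N_finite unfolding asym_form(2) total_form(2) tournament_on_def by blast
    from tuple_regular_tournament_card[OF this elim(1)] elim(2) show False by simp
  qed
  then show False using eventually_ex by blast
qed

end

lemma indep_digraph_is_digraph: "0 < n \<Longrightarrow> is_digraph (indep_digraph n)"
  by (auto simp: is_digraph_def is_structure_def indep_digraph_def arcs_def irrefl_def antisym_def)

lemma embeds_self: "embeds ar M M"
proof -
  have "isomorphism ar M (substructure M (univ M)) id"
    by (auto simp: isomorphism_def substructure_def tuples_def)
  then show ?thesis unfolding embeds_def by blast
qed

lemma Q_no_independent_tuple:
  assumes Q: "is_Q n M" and n: "0 < n" and b: "b \<in> tuples M n"
  shows "\<not> (\<forall>p<n. \<forall>q<n. (b ! p = b ! q \<longleftrightarrow> p = q) \<and> \<not> arc M (b ! p) (b ! q))"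
proof
  assume *: "\<forall>p<n. \<forall>q<n. (b ! p = b ! q \<longleftrightarrow> p = q) \<and> \<not> arc M (b ! p) (b ! q)"
  have len: "length b = n" and sub: "set b \<subseteq> univ M" using b by (auto simp: tuples_def)
  have "isomorphism arc_ar (indep_digraph n) (substructure M (set b)) (\<lambda>i. b ! i)"
    unfolding isomorphism_def
  proof (intro conjI allI ballI)
    show "bij_betw (\<lambda>i. b ! i) (univ (indep_digraph n)) (univ (substructure M (set b)))"
      using * len by (auto simp: bij_betw_def inj_on_def indep_digraph_def substructure_def set_conv_nth)
    fix r xs assume "xs \<in> tuples (indep_digraph n) (arc_ar r)"
    then obtain p q where "xs = [p, q]" "p < n" "q < n"
      by (auto simp: tuples_def indep_digraph_def length_Suc_conv numeral_2_eq_2)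
    then show "xs \<in> rel (indep_digraph n) r \<longleftrightarrow> map ((!) b) xs \<in> rel (substructure M (set b)) r"
      using * by (cases r) (auto simp: indep_digraph_def substructure_def arc_def)
  qed
  then have "embeds arc_ar (indep_digraph n) M" using sub unfolding embeds_def by blast
  moreover have "finite (univ (indep_digraph n))" by (simp add: indep_digraph_def)
  ultimately show False
    using Q indep_digraph_is_digraph[OF n] embeds_self[of arc_ar "indep_digraph n"] unfolding is_Q_def by blast
qed

text \<open>
The disjoint union of \<open>k\<close> isolated vertices and a transitive tournament on four vertices. It embeds
into \<open>Q\<^sub>n\<close> for \<open>n = k + 2\<close>, since an independent set contains at most one vertex of the tournament.
\<close>

definition test_digraph :: "nat \<Rightarrow> (arc_lang, nat) rel_struct" where
  "test_digraph k = \<lparr>univ = {..<k + 4}, rel = (\<lambda>_. {[i, j] | i j. k \<le> i \<and> i < j \<and> j < k + 4})\<rparr>"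

lemma test_digraph_is_digraph: "is_digraph (test_digraph k)"
proof -
  have "0 \<in> {..<k + 4}" by simp
  then have "{..<k + 4} \<noteq> {}" by blast
  then show ?thesis
    by (auto simp: is_digraph_def is_structure_def test_digraph_def arcs_def irrefl_def antisym_def tuples_def)
qed

lemma test_digraph_omits: "\<not> embeds arc_ar (indep_digraph (k + 2)) (test_digraph k)"
proof
  assume "embeds arc_ar (indep_digraph (k + 2)) (test_digraph k)"
  then obtain S f where S: "S \<subseteq> {..<k + 4}"
    and iso: "isomorphism arc_ar (indep_digraph (k + 2)) (substructure (test_digraph k) S) f"
    unfolding embeds_def by (auto simp: test_digraph_def)
  have bij: "bij_betw f {..<k + 2} S"
    using iso by (simp add: isomorphism_def indep_digraph_def substructure_def)
  then have cS: "card S = k + 2" using bij_betw_same_card by fastforce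
  have "card S \<le> card (S \<inter> {..<k}) + card (S - {..<k})"
    using S by (metis card_Un_le Int_Diff_Un)
  moreover have "card (S \<inter> {..<k}) \<le> k" using card_mono[of "{..<k}" "S \<inter> {..<k}"] by simp
  ultimately have "2 \<le> card (S - {..<k})" using cS by simp
  then obtain u v where uv: "u \<in> S" "v \<in> S" "k \<le> u" "u < v"
  proof -
    assume that: "\<And>u v. u \<in> S \<Longrightarrow> v \<in> S \<Longrightarrow> k \<le> u \<Longrightarrow> u < v \<Longrightarrow> thesis"
    have "finite (S - {..<k})" using S finite_subset by fastforce
    from card_le_Suc0_iff_eq[OF this] \<open>2 \<le> card (S - {..<k})\<close>
    have "\<not> (\<forall>u\<in>S - {..<k}. \<forall>v\<in>S - {..<k}. u = v)" by linarith
    then obtain u v where "u \<in> S - {..<k}" "v \<in> S - {..<k}" "u \<noteq> v" by blast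
    then show thesis using that[of u v] that[of v u] by (cases "u < v") auto
  qed
  have "u \<in> f ` {..<k + 2}" "v \<in> f ` {..<k + 2}" using bij uv by (simp_all add: bij_betw_def)
  then obtain i j where ij: "i < k + 2" "j < k + 2" "f i = u" "f j = v" by blast
  have "[i, j] \<in> tuples (indep_digraph (k + 2)) (arc_ar Arc)"
    using ij by (simp add: tuples_def indep_digraph_def)
  then have "[i, j] \<in> rel (indep_digraph (k + 2)) Arc \<longleftrightarrow>
      map f [i, j] \<in> rel (substructure (test_digraph k) S) Arc"
    using iso unfolding isomorphism_def by blast
  moreover have "v < k + 4" using S uv by blast
  ultimately show False
    using uv ij by (simp add: indep_digraph_def substructure_def test_digraph_def)
qed

lemma Q_test_tuple:
  assumes Q: "is_Q (k + 2) M"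
  shows "\<exists>b\<in>tuples M (k + 4). \<forall>p<k + 4. \<forall>q<k + 4. (b ! p = b ! q \<longleftrightarrow> p = q) \<and>
    (arc M (b ! p) (b ! q) \<longleftrightarrow> k \<le> p \<and> p < q)"
proof -
  have "finite (univ (test_digraph k))" by (simp add: test_digraph_def)
  then have "embeds arc_ar (test_digraph k) M"
    using Q test_digraph_is_digraph[of k] test_digraph_omits[of k] unfolding is_Q_def by blast
  then obtain S f where S: "S \<subseteq> univ M" and iso: "isomorphism arc_ar (test_digraph k) (substructure M S) f"
    unfolding embeds_def by blast
  have bij: "bij_betw f {..<k + 4} S"
    using iso by (simp add: isomorphism_def test_digraph_def substructure_def)
  have R: "arc M (f p) (f q) \<longleftrightarrow> k \<le> p \<and> p < q" if "p < k + 4" "q < k + 4" for p q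
  proof -
    have "[p, q] \<in> tuples (test_digraph k) (arc_ar Arc)"
      using that by (simp add: tuples_def test_digraph_def)
    then have "[p, q] \<in> rel (test_digraph k) Arc \<longleftrightarrow> map f [p, q] \<in> rel (substructure M S) Arc"
      using iso unfolding isomorphism_def by blast
    moreover have "f p \<in> S" "f q \<in> S" using bij that by (auto simp: bij_betw_def)
    ultimately show ?thesis using that by (auto simp: test_digraph_def substructure_def arc_def)
  qed
  define b where "b = map f [0..<k + 4]"
  have nth: "b ! p = f p" if "p < k + 4" for p using that unfolding b_def by (subst nth_map) auto
  have "f p = f q \<longleftrightarrow> p = q" if "p < k + 4" "q < k + 4" for p q
    using bij that unfolding bij_betw_def inj_on_def by blast
  then have "\<forall>p<k + 4. \<forall>q<k + 4. (b ! p = b ! q \<longleftrightarrow> p = q) \<and> (arc M (b ! p) (b ! q) \<longleftrightarrow> k \<le> p \<and> p < q)"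
    using R nth by simp
  moreover have "set b = f ` {..<k + 4}" unfolding b_def by (simp only: set_map set_upt lessThan_atLeast0)
  then have "set b \<subseteq> univ M" using bij S by (simp add: bij_betw_def)
  then have "b \<in> tuples M (k + 4)" by (simp add: tuples_def b_def)
  ultimately show ?thesis by blast
qed

text \<open>
In \<open>Q\<^sub>n\<close> the common nonneighbours of \<open>n - 2\<close> independent vertices form a tournament. So in \<open>N i\<close> they form
a tournament with prescribed extension numbers, and the test digraph shows that it can have at least
four vertices.
\<close>

lemma (in arc_ultraproduct) not_Q:
  assumes Q: "is_Q (k + 2) M"
  shows False
proof -
  let ?A = "\<lambda>p q. k \<le> p \<and> p < q"
  have hom: "homogeneous arc_ar M" and dig: "is_digraph M" using Q by (auto simp: is_Q_def)
  have "sat M [] asym_form" unfolding asym_form(2) using is_digraph_asym[OF dig] by blast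
  then have asym: "eventually (\<lambda>i. sat (N i) [] asym_form) U" using sentence_iff asym_form(1) by blast
  have "\<not> (\<exists>b\<in>tuples M (k + 2). \<forall>p<k + 2. \<forall>q<k + 2. (b ! p = b ! q \<longleftrightarrow> p = q) \<and> (arc M (b ! p) (b ! q) \<longleftrightarrow> False))"
    using Q_no_independent_tuple[OF Q] by auto
  then have indep: "eventually (\<lambda>i. \<not> (\<exists>b\<in>tuples (N i) (k + 2). \<forall>p<k + 2. \<forall>q<k + 2.
      (b ! p = b ! q \<longleftrightarrow> p = q) \<and> (arc (N i) (b ! p) (b ! q) \<longleftrightarrow> False))) U"
    unfolding eventually_pattern_iff[of "k + 2" "\<lambda>p q. p = q" "\<lambda>p q. False"]
    unfolding ultrafilter_eventually_not[OF ultra] .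
  have test: "eventually (\<lambda>i. \<exists>b\<in>tuples (N i) (k + 4). \<forall>p<k + 4. \<forall>q<k + 4.
      (b ! p = b ! q \<longleftrightarrow> p = q) \<and> (arc (N i) (b ! p) (b ! q) \<longleftrightarrow> ?A p q)) U"
    using Q_test_tuple[OF Q] unfolding eventually_pattern_iff[of "k + 4" "\<lambda>p q. p = q" ?A] .
  from asym indep test eventually_tuple_regular[OF hom, of "k + 3"]
  have "eventually (\<lambda>i. False) U"
  proof eventually_elim
    case (elim i)
    let ?V = "univ (N i)" and ?R = "arc (N i)"
    obtain b where b: "b \<in> tuples (N i) (k + 4)"
      and bp: "\<And>p q. p < k + 4 \<Longrightarrow> q < k + 4 \<Longrightarrow> (b ! p = b ! q \<longleftrightarrow> p = q) \<and> (?R (b ! p) (b ! q) \<longleftrightarrow> ?A p q)"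
      using elim(3) by blast
    define as where "as = take k b"
    define W where "W = ext ?V ?R as (replicate k (False, False))"
    have len: "length as = k" "\<And>p. p < k \<Longrightarrow> as ! p = b ! p"
      using b by (simp_all add: as_def tuples_length)
    have as: "set as \<subseteq> ?V" using b by (auto simp: as_def tuples_def dest: in_set_takeD)
    have WV: "W \<subseteq> ?V" unfolding W_def by (rule ext_subset)
    have W: "v \<in> W \<longleftrightarrow> v \<in> ?V \<and> (\<forall>p<k. v \<noteq> as ! p \<and> \<not> ?R v (as ! p) \<and> \<not> ?R (as ! p) v)" for v
      by (auto simp: W_def ext_def list_all2_conv_all_nth len(1))
    have reg: "tuple_regular 3 W ?R"
      unfolding W_def using elim(4) len(1) as by (intro tuple_regular_ext) simp_all
    have tour: "tournament_on W ?R"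
      unfolding tournament_on_def
    proof (intro conjI ballI impI)
      show "finite W" using WV N_finite finite_subset by blast
      show "\<not> ?R x x" if "x \<in> W" for x using elim(1) WV that unfolding asym_form(2) by blast
      fix x y assume xy: "x \<in> W" "y \<in> W" "x \<noteq> y"
      have "\<not> (?R x y \<and> ?R y x)" using elim(1) WV xy unfolding asym_form(2) by blast
      moreover have "?R x y \<or> ?R y x"
      proof (rule ccontr)
        assume n: "\<not> (?R x y \<or> ?R y x)"
        have irr: "\<not> ?R z z" if "z \<in> ?V" for z using elim(1) that unfolding asym_form(2) by blast
        let ?c = "as @ [x, y]"
        have c: "?c \<in> tuples (N i) (k + 2)" using as WV xy len(1) by (auto simp: tuples_def)
        have nth: "?c ! p = (if p < k then as ! p else if p = k then x else y)" if "p < k + 2" for p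
          using that len(1) by (auto simp: nth_append less_Suc_eq numeral_2_eq_2)
        have pq: "(?c ! p = ?c ! q \<longleftrightarrow> p = q) \<and> \<not> ?R (?c ! p) (?c ! q)" if pq: "p < k + 2" "q < k + 2" for p q
        proof -
          have asp: "(as ! p = as ! q \<longleftrightarrow> p = q) \<and> \<not> ?R (as ! p) (as ! q)" if "p < k" "q < k" for p q
            using bp[of p q] that len(2) by auto
          show ?thesis
            using asp W[of x] W[of y] xy n irr WV pq
            unfolding nth[OF pq(1)] nth[OF pq(2)] by (auto simp: less_Suc_eq numeral_2_eq_2)
        qed
        then show False using elim(2) c by blast
      qed
      ultimately show "?R x y \<longleftrightarrow> \<not> ?R y x" by blast
    qed
    have "(\<lambda>p. b ! p) ` {k..<k + 4} \<subseteq> W"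
    proof
      fix v assume "v \<in> (\<lambda>p. b ! p) ` {k..<k + 4}"
      then obtain p where p: "k \<le> p" "p < k + 4" "v = b ! p" by auto
      have "v \<in> ?V" using p b by (auto simp: tuples_def)
      moreover have "v \<noteq> as ! q \<and> \<not> ?R v (as ! q) \<and> \<not> ?R (as ! q) v" if "q < k" for q
        using bp[of p q] bp[of q p] p that len(2) by auto
      ultimately show "v \<in> W" unfolding W by blast
    qed
    then have "card ((\<lambda>p. b ! p) ` {k..<k + 4}) \<le> card W"
      using WV N_finite finite_subset by (intro card_mono) blast+
    moreover have "inj_on (\<lambda>p. b ! p) {k..<k + 4}" using bp by (auto simp: inj_on_def)
    ultimately have "4 \<le> card W" by (simp add: card_image)
    then show False using tuple_regular_tournament_card[OF tour reg] by simp
  qed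
  then show False using eventually_ex by blast
qed

section \<open>Homogeneous graphs\<close>

definition graph_form :: "arc_lang form" where
  "graph_form = alls 2 (Conj (Imp (Eq 0 1) (Neg (Rel Arc [0, 1]))) (Imp (Rel Arc [0, 1]) (Rel Arc [1, 0])))"

definition path_form :: "arc_lang form" where
  "path_form = exs 3 (conjs [Neg (Eq 1 2), Rel Arc [0, 1], Rel Arc [0, 2], Neg (Rel Arc [1, 2])])"

definition copath_form :: "arc_lang form" where
  "copath_form = exs 3 (conjs [Neg (Eq 1 2), Neg (Eq 0 1), Neg (Rel Arc [0, 1]), Neg (Eq 0 2),
     Neg (Rel Arc [0, 2]), Rel Arc [1, 2]])"

lemma graph_form: "wff arc_ar 0 graph_form"
  "finite (univ M) \<Longrightarrow> sat M [] graph_form \<longleftrightarrow> graph_on (univ M) (arc M)"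
  "sat M [] graph_form \<longleftrightarrow> (\<forall>x\<in>univ M. \<forall>y\<in>univ M. (x = y \<longrightarrow> \<not> arc M x y) \<and> (arc M x y \<longrightarrow> arc M y x))"
  by (auto simp: graph_form_def ball_tuples_2 graph_on_def)

lemma path_form: "wff arc_ar 0 path_form" "sat M [] path_form \<longleftrightarrow> has_path (univ M) (arc M)"
  unfolding path_form_def by (simp, simp add: bex_tuples_3 has_path_def)

lemma copath_form: "wff arc_ar 0 copath_form" "sat M [] copath_form \<longleftrightarrow> has_path (univ M) (compl (arc M))"
  unfolding copath_form_def by (simp, simp add: bex_tuples_3 has_path_def compl_def cong: conj_cong)

lemma (in arc_ultraproduct) not_nondegenerate_graph:
  assumes hom: "homogeneous arc_ar M" and G: "sat M [] graph_form" and inf: "infinite (univ M)"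
    and nd: "nondeg (univ M) (arc M)"
  shows False
proof -
  have "sat M [] path_form" "sat M [] copath_form"
    using nd by (simp_all add: nondeg_def path_form copath_form)
  with G have "eventually (\<lambda>i. sat (N i) [] graph_form) U" "eventually (\<lambda>i. sat (N i) [] path_form) U"
      "eventually (\<lambda>i. sat (N i) [] copath_form) U"
    using sentence_iff graph_form(1) path_form(1) copath_form(1) by blast+
  with eventually_tuple_regular[OF hom, of 7] eventually_card_ge[OF inf, of 10]
  have "eventually (\<lambda>i. False) U"
  proof eventually_elim
    case (elim i)
    have "graph_on (univ (N i)) (arc (N i))" using elim(3) graph_form(2)[OF N_finite] by blast
    moreover have "nondeg (univ (N i)) (arc (N i))"
      using elim(4,5) by (simp add: nondeg_def path_form copath_form)
    ultimately show False using tuple_regular_graph_card[OF _ elim(1)] elim(2) by fastforce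
  qed
  then show False using eventually_ex by blast
qed

text \<open>
Equality and every equivalence relation contain with \<open>(x,y)\<close>, \<open>(x,y')\<close> and \<open>(x',y')\<close> also \<open>(x',y)\<close>. This
excludes a half graph, even on four indices.
\<close>

lemma rectangular_no_half_graph:
  fixes u v :: "nat \<Rightarrow> 'a"
  assumes rect: "\<And>x x' y y'. x \<in> V \<Longrightarrow> x' \<in> V \<Longrightarrow> y \<in> V \<Longrightarrow> y' \<in> V \<Longrightarrow> T x y \<Longrightarrow> T x y' \<Longrightarrow> T x' y' \<Longrightarrow> T x' y"
    and V: "\<And>i. u i \<in> V" "\<And>i. v i \<in> V"
    and Y: "i0 < i1" "i1 < i2" "i2 < i3" "{i0, i1, i2, i3} \<subseteq> Y"
    and up: "\<And>i j. i \<in> Y \<Longrightarrow> j \<in> Y \<Longrightarrow> i < j \<Longrightarrow> T (u i) (v j) \<longleftrightarrow> c"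
    and down: "\<And>i j. i \<in> Y \<Longrightarrow> j \<in> Y \<Longrightarrow> j < i \<Longrightarrow> T (u i) (v j) \<longleftrightarrow> c'"
  shows "c = c'"
proof (rule ccontr)
  assume ne: "c \<noteq> c'"
  show False
  proof (cases c)
    case True
    have "T (u i0) (v i1)" "T (u i0) (v i3)" "T (u i2) (v i3)" "\<not> T (u i2) (v i1)"
      using up[of i0 i1] up[of i0 i3] up[of i2 i3] down[of i2 i1] Y ne True by auto
    then show False using rect[OF V(1) V(1) V(2) V(2)] by blast
  next
    case False
    have "T (u i3) (v i2)" "T (u i3) (v i0)" "T (u i1) (v i0)" "\<not> T (u i1) (v i2)"
      using down[of i3 i2] down[of i3 i0] down[of i1 i0] up[of i1 i2] Y ne False by auto
    then show False using rect[OF V(1) V(1) V(2) V(2)] by blast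
  qed
qed

text \<open>
Suppose the truth of \<open>\<Phi>\<close> at a tuple depends only on the restrictions of two symmetric relations as
above to the tuple. By Ramsey's theorem, a sequence that witnesses the order property for \<open>\<Phi>\<close> can be
thinned out until these restrictions for \<open>a i @ b j\<close> depend only on whether \<open>i < j\<close> or \<open>j < i\<close>. The difference
between the two cases is then visible at a single pair of coordinates, which gives a half graph.
\<close>

lemma no_order_property:
  fixes a b :: "nat \<Rightarrow> 'a list" and \<Phi> :: "'a list \<Rightarrow> bool" and T :: "bool \<Rightarrow> 'a \<Rightarrow> 'a \<Rightarrow> bool"
  assumes a: "\<And>i. set (a i) \<subseteq> V" "\<And>i. length (a i) = k" and b: "\<And>i. set (b i) \<subseteq> V" "\<And>i. length (b i) = l"
    and rect: "\<And>c x x' y y'. x \<in> V \<Longrightarrow> x' \<in> V \<Longrightarrow> y \<in> V \<Longrightarrow> y' \<in> V \<Longrightarrow>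
      T c x y \<Longrightarrow> T c x y' \<Longrightarrow> T c x' y' \<Longrightarrow> T c x' y"
    and sym: "\<And>c x y. x \<in> V \<Longrightarrow> y \<in> V \<Longrightarrow> T c x y \<Longrightarrow> T c y x"
    and \<Phi>: "\<And>e e'. set e \<subseteq> V \<Longrightarrow> set e' \<subseteq> V \<Longrightarrow> length e = k + l \<Longrightarrow> length e' = k + l \<Longrightarrow>
      (\<And>c p q. p < k + l \<Longrightarrow> q < k + l \<Longrightarrow> T c (e ! p) (e ! q) \<longleftrightarrow> T c (e' ! p) (e' ! q)) \<Longrightarrow> \<Phi> e \<longleftrightarrow> \<Phi> e'"
    and order: "\<And>i j. \<Phi> (a i @ b j) \<longleftrightarrow> i < j"
  shows False
proof -
  define X where "X = (UNIV :: bool set) \<times> {..<k + l} \<times> {..<k + l}"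
  \<comment> \<open>The relations induced on a tuple; there are finitely many possibilities.\<close>
  define code where "code e = {(c, p, q) \<in> X. T c (e ! p) (e ! q)}" for e
  have codeX: "code e \<in> Pow X" for e by (auto simp: code_def)
  have finX: "finite (Pow X \<times> Pow X)" by (simp add: X_def)
  then obtain h where h: "bij_betw h (Pow X \<times> Pow X) {0..<card (Pow X \<times> Pow X)}"
    using ex_bij_betw_finite_nat by blast
  define col where "col i j = (code (a i @ b j), code (a j @ b i))" for i j
  define f where "f Z = h (col (Min Z) (Max Z))" for Z
  have colX: "col i j \<in> Pow X \<times> Pow X" for i j using codeX by (simp add: col_def)
  have "f Z < card (Pow X \<times> Pow X)" for Z
    using bij_betw_apply[OF h colX] by (simp add: f_def)
  then have "\<forall>x\<in>UNIV. \<forall>y\<in>UNIV. x \<noteq> y \<longrightarrow> f {x, y} < card (Pow X \<times> Pow X)" by blast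
  from Ramsey2[OF infinite_UNIV_nat this] obtain Y t where
    "infinite Y" "\<forall>i\<in>Y. \<forall>j\<in>Y. i \<noteq> j \<longrightarrow> f {i, j} = t" by (elim exE conjE)
  then have Y: "infinite Y" "\<And>i j. i \<in> Y \<Longrightarrow> j \<in> Y \<Longrightarrow> i \<noteq> j \<Longrightarrow> f {i, j} = t" by blast+
  obtain i0 i1 i2 i3 where i: "i0 < i1" "i1 < i2" "i2 < i3" "{i0, i1, i2, i3} \<subseteq> Y"
  proof -
    assume that: "\<And>i0 i1 i2 i3. i0 < i1 \<Longrightarrow> i1 < i2 \<Longrightarrow> i2 < i3 \<Longrightarrow> {i0, i1, i2, i3} \<subseteq> Y \<Longrightarrow> thesis"
    have next_ex: "\<exists>j\<in>Y. i < j" for i using Y(1) infinite_nat_iff_unbounded by blast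
    obtain i0 where "i0 \<in> Y" using next_ex by blast
    moreover obtain i1 where "i1 \<in> Y" "i0 < i1" using next_ex by blast
    moreover obtain i2 where "i2 \<in> Y" "i1 < i2" using next_ex by blast
    moreover obtain i3 where "i3 \<in> Y" "i2 < i3" using next_ex by blast
    ultimately show thesis using that by blast
  qed
  have fcol: "f {i, j} = h (col i j)" if "i < j" for i j
    using that by (simp add: f_def min_def max_def)
  have col_eq: "col i j = col i0 i1" if "i \<in> Y" "j \<in> Y" "i < j" for i j
  proof -
    have "h (col i j) = h (col i0 i1)"
      using Y(2)[of i j] Y(2)[of i0 i1] that i fcol by auto
    then show ?thesis using h colX unfolding bij_betw_def inj_on_def by blast
  qed
  define C where "C = code (a i0 @ b i1)"
  define C' where "C' = code (a i1 @ b i0)"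
  have up: "code (a i @ b j) = C" if "i \<in> Y" "j \<in> Y" "i < j" for i j
    using col_eq[OF that] by (simp add: col_def C_def)
  have down: "code (a i @ b j) = C'" if "i \<in> Y" "j \<in> Y" "j < i" for i j
    using col_eq[OF that(2,1,3)] by (simp add: col_def C'_def)
  have T: "T c ((a i @ b j) ! p) ((a i @ b j) ! q) \<longleftrightarrow> (c, p, q) \<in> code (a i @ b j)"
    if "p < k + l" "q < k + l" for c p q i j
    using that by (auto simp: code_def X_def)
  have upT: "T c ((a i @ b j) ! p) ((a i @ b j) ! q) \<longleftrightarrow> (c, p, q) \<in> C"
    if "p < k + l" "q < k + l" "i \<in> Y" "j \<in> Y" "i < j" for c p q i j
    using T[OF that(1,2)] up[OF that(3-5)] by simp
  have downT: "T c ((a i @ b j) ! p) ((a i @ b j) ! q) \<longleftrightarrow> (c, p, q) \<in> C'"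
    if "p < k + l" "q < k + l" "i \<in> Y" "j \<in> Y" "j < i" for c p q i j
    using T[OF that(1,2)] down[OF that(3-5)] by simp
  have an: "(a i @ b j) ! p = a i ! p" if "p < k" for i j p using that a(2) by (simp add: nth_append)
  have bn: "(a i @ b j) ! p = b j ! (p - k)" if "\<not> p < k" for i j p using that a(2) by (simp add: nth_append)
  have aV: "a i ! p \<in> V" if "p < k" for i p using a[of i] that by (metis nth_mem subsetD)
  have bV: "b i ! (p - k) \<in> V" if "\<not> p < k" "p < k + l" for i p
  proof -
    have "p - k < length (b i)" using that b(2) by simp
    then show ?thesis using b(1)[of i] nth_mem by blast
  qed
  have cross: "(c, p, q) \<in> C \<longleftrightarrow> (c, p, q) \<in> C'" if pq: "p < k" "\<not> q < k" "q < k + l" for c p q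
  proof (rule rectangular_no_half_graph[where T = "T c" and u = "\<lambda>i. a i ! p" and v = "\<lambda>j. b j ! (q - k)" and V = V, OF _ _ _ i])
    show "T c x' y" if "x \<in> V" "x' \<in> V" "y \<in> V" "y' \<in> V" "T c x y" "T c x y'" "T c x' y'" for x x' y y'
      using rect[of x x' y y' c] that by blast
    show "a i ! p \<in> V" "b i ! (q - k) \<in> V" for i using aV bV pq by auto
    show "T c (a i ! p) (b j ! (q - k)) \<longleftrightarrow> (c, p, q) \<in> C" if "i \<in> Y" "j \<in> Y" "i < j" for i j
      using upT[OF _ pq(3) that, of p c] pq an bn by simp
    show "T c (a i ! p) (b j ! (q - k)) \<longleftrightarrow> (c, p, q) \<in> C'" if "i \<in> Y" "j \<in> Y" "j < i" for i j
      using downT[OF _ pq(3) that, of p c] pq an bn by simp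
  qed
  have symC: "(c, p, q) \<in> D \<longleftrightarrow> (c, q, p) \<in> D"
    if D: "D = code (a i @ b j)" and pq: "p < k" "\<not> q < k" "q < k + l" for c p q D i j
  proof -
    have "a i ! p \<in> V" "b j ! (q - k) \<in> V" using aV bV pq by auto
    then have "T c (a i ! p) (b j ! (q - k)) \<longleftrightarrow> T c (b j ! (q - k)) (a i ! p)" using sym by blast
    then show ?thesis unfolding D using T[of p q c i j] T[of q p c i j] pq an bn by simp
  qed
  have "(c, p, q) \<in> C \<longleftrightarrow> (c, p, q) \<in> C'" if pq: "p < k + l" "q < k + l" for c p q
  proof -
    consider "p < k" "q < k" | "p < k" "\<not> q < k" | "\<not> p < k" "q < k" | "\<not> p < k" "\<not> q < k" by blast
    then show ?thesis
    proof cases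
      case 1
      then show ?thesis using upT[OF pq, of i1 i2 c] downT[OF pq, of i1 i0 c] i an by simp
    next
      case 2
      then show ?thesis using cross pq by blast
    next
      case 3
      then show ?thesis
        using cross[OF 3(2,1) pq(1)] symC[OF C_def 3(2,1) pq(1)] symC[OF C'_def 3(2,1) pq(1)] by blast
    next
      case 4
      then show ?thesis using upT[OF pq, of i0 i1 c] downT[OF pq, of i2 i1 c] i bn by simp
    qed
  qed
  then have "\<Phi> (a i0 @ b i1) \<longleftrightarrow> \<Phi> (a i1 @ b i0)"
    using a b T by (intro \<Phi>) (auto simp: C_def C'_def)
  then show False using order[of i0 i1] order[of i1 i0] i(1) by simp
qed

text \<open>
In a model of the theory of a homogeneous graph the truth of a formula at a tuple is still determined by
the induced graph, since this is a first-order property. If the graph is degenerate, the induced graph is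
determined by equality and one further equivalence relation.
\<close>

lemma degenerate_homogeneous_graph_stable:
  fixes M :: "(arc_lang, 'm) rel_struct"
  assumes hom: "homogeneous arc_ar M" and G: "sat M [] graph_form" and nd: "\<not> nondeg (univ M) (arc M)"
    and uns: "unstable TYPE('n) arc_ar (theory_of arc_ar M)"
  shows False
proof -
  obtain K :: "(arc_lang, 'n) rel_struct" and k l \<phi> a b where K: "is_model arc_ar K (theory_of arc_ar M)"
    and \<phi>: "wff arc_ar (k + l) \<phi>"
    and seq: "\<forall>i. a i \<in> tuples K k" "\<forall>j. b j \<in> tuples K l" "\<forall>i j. sat K (a i @ b j) \<phi> \<longleftrightarrow> i < (j :: nat)"
    using uns unfolding unstable_def by (elim exE conjE)
  have a: "\<And>i. a i \<in> tuples K k" and b: "\<And>j. b j \<in> tuples K l"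
    and ord: "\<And>i j. sat K (a i @ b j) \<phi> \<longleftrightarrow> i < (j :: nat)"
    using seq by blast+
  note tr = model_theory_sat[OF K]
  let ?V = "univ K" and ?R = "arc K" and ?s = "k + l"
  have gK: "\<And>x y. x \<in> ?V \<Longrightarrow> y \<in> ?V \<Longrightarrow> (x = y \<longrightarrow> \<not> ?R x y) \<and> (?R x y \<longrightarrow> ?R y x)"
    using tr[OF graph_form(1)] G unfolding graph_form(3) by blast
  have nK: "\<not> has_path ?V ?R \<or> \<not> has_path ?V (compl ?R)"
    using nd tr[OF path_form(1)] tr[OF copath_form(1)] unfolding nondeg_def path_form(2) copath_form(2) by blast
  define \<sigma> where "\<sigma> = alls (?s + ?s) (Imp (same_type_form ?s) (Iff (ren (\<lambda>i. i) \<phi>) (ren (\<lambda>i. ?s + i) \<phi>)))"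
  have w\<sigma>: "wff arc_ar 0 \<sigma>" using wff_same_type_form[of ?s] wff_ren[OF \<phi>] by (simp add: \<sigma>_def)
  have "sat M [] \<sigma>"
    unfolding \<sigma>_def sat_alls
  proof
    fix w assume "w \<in> tuples M (?s + ?s)"
    then obtain e e' where e: "e \<in> tuples M ?s" "e' \<in> tuples M ?s" "w = e @ e'" using tuples_split by blast
    show "sat M (w @ []) (Imp (same_type_form ?s) (Iff (ren (\<lambda>i. i) \<phi>) (ren (\<lambda>i. ?s + i) \<phi>)))"
      using homogeneous_types[OF hom e(1,2) _ \<phi>] sat_same_type_form[OF e(1,2)[THEN tuples_length]]
        sat_ren_append[OF \<phi> e(1,2)[THEN tuples_length]] by (simp add: e(3))
  qed
  then have s\<sigma>: "sat K [] \<sigma>" using tr[OF w\<sigma>] by blast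
  have type: "sat K e \<phi> \<longleftrightarrow> sat K e' \<phi>"
    if e: "e \<in> tuples K ?s" "e' \<in> tuples K ?s" "same_type ?R e e'" for e e'
  proof -
    have "e @ e' \<in> tuples K (?s + ?s)" using e by (auto simp: tuples_def)
    then have "sat K ((e @ e') @ []) (Imp (same_type_form ?s) (Iff (ren (\<lambda>i. i) \<phi>) (ren (\<lambda>i. ?s + i) \<phi>)))"
      using s\<sigma> unfolding \<sigma>_def sat_alls by blast
    then show ?thesis
      using e(3) sat_same_type_form[OF e(1,2)[THEN tuples_length], of K]
        sat_ren_append[OF \<phi> e(1,2)[THEN tuples_length], of K] by simp
  qed
  \<comment> \<open>Adjacency or nonadjacency, completed by equality to an equivalence relation.\<close>
  define S where "S x y \<longleftrightarrow> (if has_path ?V ?R then \<not> ?R x y else x = y \<or> ?R x y)" for x y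
  have S_trans: "S x z" if V: "x \<in> ?V" "y \<in> ?V" "z \<in> ?V" and S: "S x y" "S y z" for x y z
  proof (cases "x = y \<or> y = z \<or> x = z")
    case True
    then show ?thesis using S gK[OF V(1,1)] by (auto simp: S_def)
  next
    case ne: False
    show ?thesis
    proof (cases "has_path ?V ?R")
      case True
      then have no: "\<not> has_path ?V (compl ?R)" using nK by blast
      have "\<not> ?R x y" "\<not> ?R y z" using S True by (simp_all add: S_def)
      then have "compl ?R y x" "compl ?R y z" using ne gK[OF V(2,1)] by (auto simp: compl_def)
      then have "compl ?R x z" using no V ne unfolding has_path_def by blast
      then show ?thesis using True by (simp add: S_def compl_def)
    next
      case False
      have "?R y x" "?R y z" using S False ne gK[OF V(1,2)] by (auto simp: S_def)
      then have "?R x z" using False V ne unfolding has_path_def by blast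
      then show ?thesis using False by (simp add: S_def)
    qed
  qed
  have S_sym: "S y x" if "x \<in> ?V" "y \<in> ?V" "S x y" for x y
    using that gK[of x y] gK[of y x] unfolding S_def by (auto split: if_splits)
  have R_S: "?R x y \<longleftrightarrow> (if has_path ?V ?R then \<not> S x y else S x y \<and> x \<noteq> y)" if "x \<in> ?V" "y \<in> ?V" for x y
    using gK[OF that] by (auto simp: S_def)
  define T where "T c x y \<longleftrightarrow> (if c then x = y else S x y)" for c x y
  show False
  proof (rule no_order_property[of a ?V k b l T "\<lambda>e. sat K e \<phi>"])
    show "set (a i) \<subseteq> ?V" "length (a i) = k" "set (b i) \<subseteq> ?V" "length (b i) = l" for i
      using a[of i] b[of i] by (simp_all add: tuples_def)
    show "T c x' y" if "x \<in> ?V" "x' \<in> ?V" "y \<in> ?V" "y' \<in> ?V" "T c x y" "T c x y'" "T c x' y'" for c x x' y y'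
    proof (cases c)
      case True
      then show ?thesis using that by (simp add: T_def)
    next
      case False
      then have s: "S x y" "S x y'" "S x' y'" using that by (simp_all add: T_def)
      have "S x' x" using S_trans[OF that(2,4,1) s(3) S_sym[OF that(1,4) s(2)]] .
      then show ?thesis using S_trans[OF that(2,1,3) _ s(1)] False by (simp add: T_def)
    qed
    show "T c y x" if "x \<in> ?V" "y \<in> ?V" "T c x y" for c x y
      using that S_sym by (auto simp: T_def split: if_splits)
    show "sat K (a i @ b j) \<phi> \<longleftrightarrow> i < j" for i j by (rule ord)
    fix e e' assume e: "set e \<subseteq> ?V" "set e' \<subseteq> ?V" "length e = ?s" "length e' = ?s"
      and T: "\<And>c p q. p < ?s \<Longrightarrow> q < ?s \<Longrightarrow> T c (e ! p) (e ! q) \<longleftrightarrow> T c (e' ! p) (e' ! q)"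
    have "same_type ?R e e'"
      unfolding same_type_def
    proof (intro conjI allI impI)
      show "length e = length e'" using e by simp
      fix p q assume pq: "p < length e" "q < length e"
      then have V: "e ! p \<in> ?V" "e ! q \<in> ?V" "e' ! p \<in> ?V" "e' ! q \<in> ?V" using e by auto
      show eq: "e ! p = e ! q \<longleftrightarrow> e' ! p = e' ! q" using T[of p q True] pq e by (simp add: T_def)
      show "?R (e ! p) (e ! q) \<longleftrightarrow> ?R (e' ! p) (e' ! q)"
        unfolding R_S[OF V(1,2)] R_S[OF V(3,4)] using T[of p q False] eq pq e by (simp add: T_def)
    qed
    then show "sat K e \<phi> \<longleftrightarrow> sat K e' \<phi>" using e by (intro type) (simp_all add: tuples_def)
  qed
qed

lemma (in arc_ultraproduct) not_unstable_homogeneous_graph: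
  assumes hom: "homogeneous arc_ar M" and G: "is_graph M" and inf: "infinite (univ M)"
    and uns: "unstable TYPE('n) arc_ar (theory_of arc_ar M)"
  shows False
proof -
  have "sat M [] graph_form"
    using G unfolding graph_form(3) is_graph_def irrefl_def sym_def arcs_def arc_def by blast
  then show False
    using not_nondegenerate_graph[OF hom _ inf] degenerate_homogeneous_graph_stable[OF hom _ _ uns] by blast
qed

section \<open>The generic bipartite graph\<close>

definition generic_pair :: "('a \<Rightarrow> 'a \<Rightarrow> bool) \<Rightarrow> 'a set \<Rightarrow> 'a set \<Rightarrow> bool" where
  "generic_pair R X Y \<longleftrightarrow> (\<forall>A B. finite A \<and> finite B \<and> A \<subseteq> X \<and> B \<subseteq> X \<and> A \<inter> B = {} \<longrightarrow>
     (\<exists>v\<in>Y. (\<forall>a\<in>A. R v a) \<and> (\<forall>b\<in>B. \<not> R v b)))"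

text \<open>
A vertex of \<open>X\<close> outside \<open>A\<close> and \<open>B\<close> splits the set of realisations of \<open>(A, B)\<close> into two nonempty sets of
the same form, so such sets are infinite.
\<close>

lemma generic_pair_infinite:
  assumes gen: "generic_pair R X Y" and inf: "infinite X"
    and AB: "finite A" "finite B" "A \<subseteq> X" "B \<subseteq> X" "A \<inter> B = {}"
  shows "infinite {v \<in> Y. (\<forall>a\<in>A. R v a) \<and> (\<forall>b\<in>B. \<not> R v b)}"
proof
  let ?S = "\<lambda>A B. {v \<in> Y. (\<forall>a\<in>A. R v a) \<and> (\<forall>b\<in>B. \<not> R v b)}"
  assume "finite (?S A B)"
  then show False
    using AB
  proof (induction "card (?S A B)" arbitrary: A B rule: less_induct)
    case less
    have "infinite (X - (A \<union> B))" using inf less.prems by simp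
    then have "X - (A \<union> B) \<noteq> {}" by (intro infinite_imp_nonempty)
    then obtain w where w: "w \<in> X" "w \<notin> A \<union> B" by blast
    have S_ne: "?S A' B' \<noteq> {}" if "finite A'" "finite B'" "A' \<subseteq> X" "B' \<subseteq> X" "A' \<inter> B' = {}" for A' B'
      using gen[unfolded generic_pair_def, rule_format, of A' B'] that by blast
    have ex: "?S A (insert w B) \<noteq> {}"
      using less.prems w by (intro S_ne) auto
    have sub: "?S (insert w A) B \<subset> ?S A B" using ex by blast
    have "finite (?S (insert w A) B)" using sub less.prems(1) finite_subset by blast
    with less.hyps[OF psubset_card_mono[OF less.prems(1) sub]] show False
      using less.prems w by auto
  qed
qed

lemma quotient_two_classes:
  assumes E: "equiv V E" and q: "V // E = {P, Q}" and ne: "P \<noteq> Q"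
  shows "V = P \<union> Q" "P \<inter> Q = {}" "(x, y) \<in> E \<longleftrightarrow> x \<in> P \<and> y \<in> P \<or> x \<in> Q \<and> y \<in> Q"
proof -
  show V: "V = P \<union> Q" using Union_quotient[OF E] q by simp
  show "P \<inter> Q = {}" using quotient_disj[OF E, of P Q] q ne by blast
  show "(x, y) \<in> E \<longleftrightarrow> x \<in> P \<and> y \<in> P \<or> x \<in> Q \<and> y \<in> Q"
  proof
    assume xy: "(x, y) \<in> E"
    then have "x \<in> V" using E by (auto simp: equiv_def refl_on_def)
    then have "E `` {x} \<in> {P, Q}" "x \<in> E `` {x}"
      using q quotientI[of x V E] equiv_class_self[OF E] by auto
    moreover have "y \<in> E `` {x}" using xy by simp
    ultimately show "x \<in> P \<and> y \<in> P \<or> x \<in> Q \<and> y \<in> Q" by auto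
  next
    assume "x \<in> P \<and> y \<in> P \<or> x \<in> Q \<and> y \<in> Q"
    then show "(x, y) \<in> E"
      using in_quotient_imp_in_rel[OF E, of P x y] in_quotient_imp_in_rel[OF E, of Q x y] q by auto
  qed
qed

definition left :: "(bip_lang, 'a) rel_struct \<Rightarrow> 'a \<Rightarrow> bool" where
  "left M x \<longleftrightarrow> [x] \<in> rel M Left"

definition right :: "(bip_lang, 'a) rel_struct \<Rightarrow> 'a \<Rightarrow> bool" where
  "right M x \<longleftrightarrow> [x] \<in> rel M Right"

definition bip_adj :: "(bip_lang, 'a) rel_struct \<Rightarrow> 'a \<Rightarrow> 'a \<Rightarrow> bool" where
  "bip_adj M x y \<longleftrightarrow> [x, y] \<in> rel M Adj"

lemma sat_bip [simp]:
  "sat M e (Rel Left [i]) \<longleftrightarrow> left M (e ! i)"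
  "sat M e (Rel Right [i]) \<longleftrightarrow> right M (e ! i)"
  "sat M e (Rel Adj [i, j]) \<longleftrightarrow> bip_adj M (e ! i) (e ! j)"
  by (simp_all add: left_def right_def bip_adj_def sat.simps(2))

lemma generic_bipartite_facts:
  assumes "is_generic_bipartite M"
  shows "infinite (univ M)" "univ M = Collect (left M) \<union> Collect (right M)"
    "left M x \<Longrightarrow> \<not> right M x"
    "[x, y] \<in> rel M SameSide \<longleftrightarrow> left M x \<and> left M y \<or> right M x \<and> right M y"
    "bip_adj M x y \<Longrightarrow> bip_adj M y x"
    "bip_adj M x y \<Longrightarrow> left M x \<and> right M y \<or> right M x \<and> left M y"
    "generic_pair (bip_adj M) (Collect (left M)) (Collect (right M))"
    "generic_pair (bip_adj M) (Collect (right M)) (Collect (left M))"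
proof -
  define E where "E = {(x, y). [x, y] \<in> rel M SameSide}"
  define R where "R = {(x, y). [x, y] \<in> rel M Adj}"
  define P where "P = {x. [x] \<in> rel M Left}"
  define Q where "Q = {x. [x] \<in> rel M Right}"
  have gb: "generic_bipartite (univ M) E R" and PQ: "P \<noteq> Q" "univ M // E = {P, Q}"
    using assms unfolding is_generic_bipartite_def Let_def E_def R_def P_def Q_def by blast+
  have E: "equiv (univ M) E" and R: "R \<subseteq> univ M \<times> univ M" "sym R" "R \<inter> E = {}"
    and ext: "\<And>X A B. X \<in> univ M // E \<Longrightarrow> finite A \<Longrightarrow> finite B \<Longrightarrow> A \<subseteq> X \<Longrightarrow> B \<subseteq> X \<Longrightarrow> A \<inter> B = {} \<Longrightarrow>
        \<exists>v\<in>univ M - X. (\<forall>a\<in>A. (v, a) \<in> R) \<and> (\<forall>b\<in>B. (v, b) \<notin> R)"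
    using gb unfolding generic_bipartite_def by blast+
  note q = quotient_two_classes[OF E PQ(2,1)]
  have P: "Collect (left M) = P" "\<And>x. left M x \<longleftrightarrow> x \<in> P" by (auto simp: P_def left_def)
  have Q: "Collect (right M) = Q" "\<And>x. right M x \<longleftrightarrow> x \<in> Q" by (auto simp: Q_def right_def)
  have adj: "bip_adj M x y \<longleftrightarrow> (x, y) \<in> R" for x y by (simp add: bip_adj_def R_def)
  show "infinite (univ M)" using gb by (simp add: generic_bipartite_def)
  show "univ M = Collect (left M) \<union> Collect (right M)" unfolding P Q by (rule q(1))
  show "left M x \<Longrightarrow> \<not> right M x" unfolding P Q using q(2) by blast
  show "[x, y] \<in> rel M SameSide \<longleftrightarrow> left M x \<and> left M y \<or> right M x \<and> right M y"
    unfolding P Q using q(3)[of x y] by (simp add: E_def)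
  show "bip_adj M x y \<Longrightarrow> bip_adj M y x" unfolding adj using R(2) by (auto simp: sym_def)
  show "bip_adj M x y \<Longrightarrow> left M x \<and> right M y \<or> right M x \<and> left M y"
    unfolding P Q adj using R(1,3) q(1) q(3)[of x y] by blast
  have "univ M - P = Q" "univ M - Q = P" using q(1,2) by blast+
  then show "generic_pair (bip_adj M) (Collect (left M)) (Collect (right M))"
    "generic_pair (bip_adj M) (Collect (right M)) (Collect (left M))"
    unfolding generic_pair_def P Q adj using ext[of P] ext[of Q] PQ(2) by auto
qed

lemma generic_bipartite_sides_infinite:
  assumes G: "is_generic_bipartite M"
  shows "infinite (Collect (left M))" "infinite (Collect (right M))"
proof -
  note f = generic_bipartite_facts[OF G]
  have "infinite (Collect (left M)) \<or> infinite (Collect (right M))" using f(1,2) by simp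
  moreover have "infinite Y" if "generic_pair (bip_adj M) X Y" "infinite X" for X Y
    using generic_pair_infinite[OF that, of "{}" "{}"] by simp
  ultimately show "infinite (Collect (left M))" "infinite (Collect (right M))" using f(7,8) by blast+
qed

text \<open>
The predicate \<open>Right\<close> and the relation \<open>SameSide\<close> are determined by \<open>Left\<close> in a generic bipartite graph.
\<close>

definition same_bip_type :: "(bip_lang, 'a) rel_struct \<Rightarrow> 'a list \<Rightarrow> 'a list \<Rightarrow> bool" where
  "same_bip_type M b b' \<longleftrightarrow> length b = length b' \<and>
     (\<forall>i<length b. left M (b ! i) \<longleftrightarrow> left M (b' ! i)) \<and>
     (\<forall>i<length b. \<forall>j<length b. (b ! i = b ! j \<longleftrightarrow> b' ! i = b' ! j) \<and>
        (bip_adj M (b ! i) (b ! j) \<longleftrightarrow> bip_adj M (b' ! i) (b' ! j)))"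

text \<open>
A new element is matched with an element on the same side that has the prescribed neighbours and
nonneighbours. As there are infinitely many of them, it can be chosen outside \<open>b'\<close>.
\<close>

lemma same_bip_type_extend:
  assumes G: "is_generic_bipartite M" and st: "same_bip_type M b b'"
    and V: "set b \<subseteq> univ M" "set b' \<subseteq> univ M" "a \<in> univ M"
  shows "\<exists>a'\<in>univ M. same_bip_type M (a # b) (a' # b')"
proof -
  note f = generic_bipartite_facts[OF G]
  have len: "length b' = length b" using st by (simp add: same_bip_type_def)
  have st1: "left M (b ! i) \<longleftrightarrow> left M (b' ! i)" if "i < length b" for i
    using st that by (simp add: same_bip_type_def)
  have st2: "b ! i = b ! j \<longleftrightarrow> b' ! i = b' ! j" "bip_adj M (b ! i) (b ! j) \<longleftrightarrow> bip_adj M (b' ! i) (b' ! j)"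
    if "i < length b" "j < length b" for i j
    using st that by (simp_all add: same_bip_type_def)
  have irr: "\<not> bip_adj M x x" for x using f(3)[of x] f(6)[of x x] by blast
  have ext: "same_bip_type M (a # b) (a' # b')"
    if "left M a \<longleftrightarrow> left M a'" "\<And>i. i < length b \<Longrightarrow> a = b ! i \<longleftrightarrow> a' = b' ! i"
      "\<And>i. i < length b \<Longrightarrow> bip_adj M a (b ! i) \<longleftrightarrow> bip_adj M a' (b' ! i)" for a'
  proof -
    have s: "bip_adj M x y \<longleftrightarrow> bip_adj M y x" for x y using f(5) by blast
    have "bip_adj M (b ! i) a \<longleftrightarrow> bip_adj M (b' ! i) a'" if "i < length b" for i
      using \<open>\<And>i. i < length b \<Longrightarrow> bip_adj M a (b ! i) \<longleftrightarrow> bip_adj M a' (b' ! i)\<close>[OF that] s by blast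
    moreover have "b ! i = a \<longleftrightarrow> b' ! i = a'" if "i < length b" for i
      using \<open>\<And>i. i < length b \<Longrightarrow> a = b ! i \<longleftrightarrow> a' = b' ! i\<close>[OF that] by blast
    ultimately show ?thesis
      using that st1 st2 irr len unfolding same_bip_type_def by (simp add: All_less_Suc2)
  qed
  show ?thesis
  proof (cases "a \<in> set b")
    case True
    then obtain i where i: "i < length b" "a = b ! i" by (auto simp: in_set_conv_nth)
    have "same_bip_type M (a # b) (b' ! i # b')"
      unfolding i(2) using st1[OF i(1)] st2[OF i(1)] by (intro ext[unfolded i(2)]) auto
    moreover have "b' ! i \<in> univ M" using V(2) i(1) len by auto
    ultimately show ?thesis by blast
  next
    case False
    obtain X Y where XY: "X = Collect (left M) \<and> Y = Collect (right M) \<or> X = Collect (right M) \<and> Y = Collect (left M)"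
      and a: "a \<in> Y" using V(3) f(2) by blast
    have gen: "generic_pair (bip_adj M) X Y" using XY f(7,8) by blast
    have inf: "infinite X" using XY generic_bipartite_sides_infinite[OF G] by blast
    have Vs: "v \<in> univ M \<longleftrightarrow> v \<in> X \<or> v \<in> Y" "v \<in> X \<Longrightarrow> v \<notin> Y" for v using XY f(2,3) by auto
    have leftY: "u \<in> Y \<Longrightarrow> v \<in> Y \<Longrightarrow> left M u \<longleftrightarrow> left M v" for u v using XY f(3) by auto
    have X_iff: "b ! i \<in> X \<longleftrightarrow> b' ! i \<in> X" if "i < length b" for i
    proof -
      have "b ! i \<in> univ M" "b' ! i \<in> univ M" using V that len by auto
      then show ?thesis using st1[OF that] XY f(2,3) by blast
    qed
    \<comment> \<open>The neighbours and the nonneighbours, on the opposite side, that the image of \<open>a\<close> must have.\<close>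
    define A where "A = {b' ! i | i. i < length b \<and> b ! i \<in> X \<and> bip_adj M a (b ! i)}"
    define B where "B = {b' ! i | i. i < length b \<and> b ! i \<in> X \<and> \<not> bip_adj M a (b ! i)}"
    have "A \<subseteq> set b'" "B \<subseteq> set b'" using len by (auto simp: A_def B_def)
    then have fin: "finite A" "finite B" using finite_subset by blast+
    have AB: "A \<subseteq> X" "B \<subseteq> X" using X_iff by (auto simp: A_def B_def)
    have dis: "A \<inter> B = {}"
    proof (rule ccontr)
      assume "A \<inter> B \<noteq> {}"
      then obtain i j where "i < length b" "j < length b" "b' ! i = b' ! j" "bip_adj M a (b ! i)" "\<not> bip_adj M a (b ! j)"
        by (auto simp: A_def B_def)
      then show False using st2(1)[of i j] by simp
    qed
    have "infinite ({v \<in> Y. (\<forall>x\<in>A. bip_adj M v x) \<and> (\<forall>x\<in>B. \<not> bip_adj M v x)} - set b')"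
      using generic_pair_infinite[OF gen inf fin AB dis] by simp
    then have "{v \<in> Y. (\<forall>x\<in>A. bip_adj M v x) \<and> (\<forall>x\<in>B. \<not> bip_adj M v x)} - set b' \<noteq> {}"
      by (intro infinite_imp_nonempty)
    then obtain a' where a': "a' \<in> Y" "\<forall>x\<in>A. bip_adj M a' x" "\<forall>x\<in>B. \<not> bip_adj M a' x" "a' \<notin> set b'" by blast
    have adjY: "\<not> bip_adj M u v" if "u \<in> Y" "v \<notin> X" for u v
      using f(6)[of u v] f(3) that XY by blast
    have "same_bip_type M (a # b) (a' # b')"
    proof (rule ext)
      show "left M a \<longleftrightarrow> left M a'" by (rule leftY[OF a a'(1)])
      fix i assume i: "i < length b"
      show "a = b ! i \<longleftrightarrow> a' = b' ! i" using False a'(4) i len by auto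
      show "bip_adj M a (b ! i) \<longleftrightarrow> bip_adj M a' (b' ! i)"
      proof (cases "b ! i \<in> X")
        case True
        then have "b' ! i \<in> A \<or> b' ! i \<in> B" "bip_adj M a (b ! i) \<Longrightarrow> b' ! i \<in> A" "\<not> bip_adj M a (b ! i) \<Longrightarrow> b' ! i \<in> B"
          using i by (auto simp: A_def B_def)
        then show ?thesis using a'(2,3) by blast
      next
        case notX: False
        then have "b' ! i \<notin> X" using X_iff[OF i] by blast
        then show ?thesis using adjY[OF a notX] adjY[OF a'(1)] by blast
      qed
    qed
    moreover have "a' \<in> univ M" using a'(1) Vs by blast
    ultimately show ?thesis by blast
  qed
qed

lemma same_bip_type_sym: "same_bip_type M b b' \<Longrightarrow> same_bip_type M b' b"
  by (auto simp: same_bip_type_def)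

text \<open>
The extension property in both directions takes care of the quantifiers.
\<close>

lemma same_bip_type_sat:
  assumes G: "is_generic_bipartite M"
  shows "wff bip_ar (length b) \<phi> \<Longrightarrow> set b \<subseteq> univ M \<Longrightarrow> set b' \<subseteq> univ M \<Longrightarrow> same_bip_type M b b' \<Longrightarrow>
    sat M b \<phi> \<longleftrightarrow> sat M b' \<phi>"
proof (induction \<phi> arbitrary: b b')
  case (Eq i j)
  then show ?case by (simp add: same_bip_type_def)
next
  case (Rel r "is")
  note f = generic_bipartite_facts[OF G]
  have len: "length b' = length b" using Rel by (simp add: same_bip_type_def)
  have L: "left M (b ! i) \<longleftrightarrow> left M (b' ! i)" if "i < length b" for i
    using Rel(4) that by (simp add: same_bip_type_def)
  have R: "right M (b ! i) \<longleftrightarrow> right M (b' ! i)" if "i < length b" for i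
  proof -
    have "b ! i \<in> univ M" "b' ! i \<in> univ M" using Rel(2,3) that len by auto
    then show ?thesis using L[OF that] f(2,3) by blast
  qed
  have A: "bip_adj M (b ! i) (b ! j) \<longleftrightarrow> bip_adj M (b' ! i) (b' ! j)" if "i < length b" "j < length b" for i j
    using Rel(4) that by (simp add: same_bip_type_def)
  have two: "\<exists>i j. is = [i, j] \<and> i < length b \<and> j < length b" if "bip_ar r = 2"
    using Rel(1) that by (auto simp: length_Suc_conv numeral_2_eq_2)
  have one: "\<exists>i. is = [i] \<and> i < length b" if "bip_ar r = 1"
    using Rel(1) that by (auto simp: length_Suc_conv)
  show ?case
  proof (cases r)
    case SameSide
    then obtain i j where "is = [i, j]" "i < length b" "j < length b" using two by auto
    then show ?thesis using SameSide L R by (simp add: sat.simps(2) f(4))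
  next
    case Adj
    then obtain i j where "is = [i, j]" "i < length b" "j < length b" using two by auto
    then show ?thesis using Adj A by simp
  next
    case Left
    then obtain i where "is = [i]" "i < length b" using one by auto
    then show ?thesis using Left L by simp
  next
    case Right
    then obtain i where "is = [i]" "i < length b" using one by auto
    then show ?thesis using Right R by simp
  qed
next
  case (Neg \<phi>)
  then show ?case by simp
next
  case (Conj \<phi> \<psi>)
  then show ?case by simp
next
  case (Exists \<phi>)
  have step: "\<exists>a'\<in>univ M. sat M (a' # c') \<phi>"
    if c: "length c = length b" "set c \<subseteq> univ M" "set c' \<subseteq> univ M" "same_bip_type M c c'"
      and a: "a \<in> univ M" "sat M (a # c) \<phi>" for a c c'
  proof -
    obtain a' where a': "a' \<in> univ M" "same_bip_type M (a # c) (a' # c')"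
      using same_bip_type_extend[OF G c(4,2,3) a(1)] by blast
    have "sat M (a # c) \<phi> \<longleftrightarrow> sat M (a' # c') \<phi>"
      using Exists.prems(1) c a'(1) a(1) by (intro Exists.IH a'(2)) auto
    then show ?thesis using a(2) a'(1) by blast
  qed
  have "length b' = length b" using Exists.prems(4) by (simp add: same_bip_type_def)
  then show ?case
    using step[of b b'] step[of b' b] Exists.prems same_bip_type_sym[OF Exists.prems(4)] by auto
qed

text \<open>
For environments \<open>b @ b'\<close> with \<open>b\<close> and \<open>b'\<close> of length \<open>l\<close>: both are lists of distinct elements of the side
\<open>r\<close>. The conjunct \<open>Eq i i\<close> is a filler for the diagonal.
\<close>

definition side_form :: "bip_lang \<Rightarrow> nat \<Rightarrow> bip_lang form" where
  "side_form r l = Conj (conjs (map (\<lambda>i. Rel r [i]) [0..<l + l]))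
     (conjs (concat (map (\<lambda>i. map (\<lambda>j. if i = j then Eq i j else
        Conj (Neg (Eq i j)) (Neg (Eq (l + i) (l + j)))) [0..<l]) [0..<l])))"

definition count_form :: "bip_lang \<Rightarrow> nat \<Rightarrow> bip_lang form" where
  "count_form r l = Conj (Rel r [0]) (conjs (map (\<lambda>i. Rel Adj [Suc i, 0]) [0..<l]))"

definition side :: "(bip_lang, 'a) rel_struct \<Rightarrow> bip_lang \<Rightarrow> 'a set" where
  "side M r = {x \<in> univ M. [x] \<in> rel M r}"

lemma sat_side_form:
  assumes b: "b \<in> tuples M l" "b' \<in> tuples M l"
  shows "sat M (b @ b') (side_form r l) \<longleftrightarrow>
    set b \<subseteq> side M r \<and> set b' \<subseteq> side M r \<and> distinct b \<and> distinct b'"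
proof -
  note len = b[THEN tuples_length]
  have 1: "sat M (b @ b') (conjs (map (\<lambda>i. Rel r [i]) [0..<l + l])) \<longleftrightarrow> (\<forall>i<l + l. [(b @ b') ! i] \<in> rel M r)"
    by (auto simp: sat.simps(2))
  also have "\<dots> \<longleftrightarrow> (\<forall>x\<in>set (b @ b'). [x] \<in> rel M r)"
    using len by (simp only: all_set_conv_all_nth length_append)
  also have "\<dots> \<longleftrightarrow> set b \<subseteq> side M r \<and> set b' \<subseteq> side M r"
    using b by (auto simp: side_def tuples_def)
  finally have s: "sat M (b @ b') (conjs (map (\<lambda>i. Rel r [i]) [0..<l + l])) \<longleftrightarrow>
    set b \<subseteq> side M r \<and> set b' \<subseteq> side M r" .
  have "sat M (b @ b') (if i = j then Eq i j else Conj (Neg (Eq i j)) (Neg (Eq (l + i) (l + j)))) \<longleftrightarrow>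
      (i \<noteq> j \<longrightarrow> b ! i \<noteq> b ! j \<and> b' ! i \<noteq> b' ! j)" if "i < l" "j < l" for i j
    using that len by (auto simp: nth_append)
  then have eq: "(\<forall>i<l. \<forall>j<l. sat M (b @ b') (if i = j then Eq i j else Conj (Neg (Eq i j)) (Neg (Eq (l + i) (l + j))))) \<longleftrightarrow>
      (\<forall>i<l. \<forall>j<l. i \<noteq> j \<longrightarrow> b ! i \<noteq> b ! j \<and> b' ! i \<noteq> b' ! j)"
    by (rule all_less_cong)
  have "sat M (b @ b') (conjs (concat (map (\<lambda>i. map (\<lambda>j. if i = j then Eq i j else
        Conj (Neg (Eq i j)) (Neg (Eq (l + i) (l + j)))) [0..<l]) [0..<l]))) \<longleftrightarrow> distinct b \<and> distinct b'"
    unfolding sat_conjs ball_concat_map eq distinct_conv_nth len by (simp only: imp_conjR all_conj_distrib)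
  then show ?thesis unfolding side_form_def using s by simp
qed

lemma wff_side_form: "bip_ar r = 1 \<Longrightarrow> wff bip_ar (l + l) (side_form r l)"
  unfolding side_form_def wff.simps(4) wff_conjs ball_concat_map by simp

lemma wff_count_form: "bip_ar r = 1 \<Longrightarrow> wff bip_ar (1 + l) (count_form r l)"
  by (simp add: count_form_def)

lemma card_count_form:
  assumes "length b = l"
  shows "card {a \<in> tuples M 1. sat M (a @ b) (count_form r l)} =
    card {y \<in> side M r. \<forall>x\<in>set b. bip_adj M x y}"
proof -
  have "sat M (v # b) (count_form r l) \<longleftrightarrow> [v] \<in> rel M r \<and> (\<forall>x\<in>set b. bip_adj M x v)" for v
    using assms unfolding count_form_def all_set_conv_all_nth[of b]
    by (auto simp: sat.simps(2) bip_adj_def)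
  then have "{a \<in> tuples M 1. sat M (a @ b) (count_form r l)} =
      (\<lambda>v. [v]) ` {y \<in> side M r. \<forall>x\<in>set b. bip_adj M x y}"
    unfolding tuples_1 by (auto simp: side_def)
  then show ?thesis by (simp add: card_image inj_on_def)
qed

locale bip_ultraproduct = mec_ultraproduct bip_ar C U N M
  for C :: "(bip_lang, 'a) rel_struct set" and U :: "'i filter"
    and N :: "'i \<Rightarrow> (bip_lang, 'a) rel_struct" and M :: "(bip_lang, 'm) rel_struct"
begin

lemma eventually_side_counts:
  assumes G: "is_generic_bipartite M" and r: "r = Left \<or> r = Right" and s: "bip_ar s = 1"
  shows "eventually (\<lambda>i. \<forall>b b'. set b \<subseteq> side (N i) r \<and> set b' \<subseteq> side (N i) r \<and> distinct b \<and> distinct b' \<and>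
      length b = l \<and> length b' = l \<longrightarrow>
      card {y \<in> side (N i) s. \<forall>x\<in>set b. bip_adj (N i) x y} =
      card {y \<in> side (N i) s. \<forall>x\<in>set b'. bip_adj (N i) x y}) U"
proof -
  note f = generic_bipartite_facts[OF G]
  have r1: "bip_ar r = 1" using r by auto
  have side: "x \<in> side M r \<Longrightarrow> left M x \<longleftrightarrow> r = Left" "x \<in> side M r \<Longrightarrow> right M x \<longleftrightarrow> r = Right" for x
    using r f(3) by (auto simp: side_def left_def right_def)
  have "eventually (\<lambda>i. \<forall>b\<in>tuples (N i) l. \<forall>b'\<in>tuples (N i) l. sat (N i) (b @ b') (side_form r l) \<longrightarrow>
      card {a \<in> tuples (N i) 1. sat (N i) (a @ b) (count_form s l)} =
      card {a \<in> tuples (N i) 1. sat (N i) (a @ b') (count_form s l)}) U"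
  proof (rule equal_counts[OF wff_count_form[OF s] wff_side_form[OF r1]])
    fix b b' \<psi> assume b: "b \<in> tuples M l" "b' \<in> tuples M l" "sat M (b @ b') (side_form r l)" "wff bip_ar l \<psi>"
    note len = b(1,2)[THEN tuples_length]
    have s: "set b \<subseteq> side M r" "set b' \<subseteq> side M r" "distinct b" "distinct b'"
      using b(3) unfolding sat_side_form[OF b(1,2)] by blast+
    have noadj: "\<not> bip_adj M x y" if "x \<in> side M r" "y \<in> side M r" for x y
      using f(6)[of x y] side that r by auto
    have "same_bip_type M b b'"
      unfolding same_bip_type_def
    proof (intro conjI allI impI)
      show "length b = length b'" using len by simp
      fix i assume i: "i < length b"
      have m: "b ! i \<in> side M r" "b' ! i \<in> side M r" using s(1,2) i len by auto
      then show "left M (b ! i) \<longleftrightarrow> left M (b' ! i)" using side by blast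
      fix j assume j: "j < length b"
      have m': "b ! j \<in> side M r" "b' ! j \<in> side M r" using s(1,2) j len by auto
      show "b ! i = b ! j \<longleftrightarrow> b' ! i = b' ! j" using s(3,4) i j len by (simp add: nth_eq_iff_index_eq)
      show "bip_adj M (b ! i) (b ! j) \<longleftrightarrow> bip_adj M (b' ! i) (b' ! j)" using noadj m m' by blast
    qed
    then show "sat M b \<psi> \<longleftrightarrow> sat M b' \<psi>"
      using b(4) len s(1,2) by (intro same_bip_type_sat[OF G]) (auto simp: side_def)
  qed
  then show ?thesis
  proof eventually_elim
    case (elim i)
    show ?case
    proof (intro allI impI; elim conjE)
      fix b b' assume b: "set b \<subseteq> side (N i) r" "set b' \<subseteq> side (N i) r" "distinct b" "distinct b'"
        "length b = l" "length b' = l"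
      then have t: "b \<in> tuples (N i) l" "b' \<in> tuples (N i) l" by (auto simp: tuples_def side_def)
      have "sat (N i) (b @ b') (side_form r l)" unfolding sat_side_form[OF t] using b by blast
      from elim[rule_format, OF t this]
      show "card {y \<in> side (N i) s. \<forall>x\<in>set b. bip_adj (N i) x y} =
          card {y \<in> side (N i) s. \<forall>x\<in>set b'. bip_adj (N i) x y}"
        unfolding card_count_form[OF b(5)] card_count_form[OF b(6)] .
    qed
  qed
qed

text \<open>
A configuration that provides the vertices required by \<open>finite_generic_bipartite_False\<close>.
\<close>

definition config_form :: "bip_lang form" where
  "config_form = exs 5 (conjs [Rel Left [0], Rel Left [1], Rel Left [2], Rel Right [3], Rel Right [4],
     Neg (Eq 0 1), Neg (Eq 0 2), Neg (Eq 1 2), Rel Adj [0, 3], Rel Adj [1, 3], Neg (Rel Adj [2, 3]),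
     Neg (Rel Adj [0, 4]), Rel Adj [1, 4], Neg (Rel Adj [2, 4])])"

definition bip_sym_form :: "bip_lang form" where
  "bip_sym_form = alls 2 (Imp (Rel Adj [0, 1]) (Rel Adj [1, 0]))"

lemma sat_config_form: "sat K [] config_form \<longleftrightarrow> (\<exists>p\<in>univ K. \<exists>u\<in>univ K. \<exists>v\<in>univ K. \<exists>a\<in>univ K. \<exists>b\<in>univ K.
    left K p \<and> left K u \<and> left K v \<and> right K a \<and> right K b \<and> distinct [p, u, v] \<and>
    bip_adj K p a \<and> bip_adj K u a \<and> \<not> bip_adj K v a \<and> \<not> bip_adj K p b \<and> bip_adj K u b \<and> \<not> bip_adj K v b)"
proof -
  have "tuples K 5 = {[p, u, v, a, b] | p u v a b. p \<in> univ K \<and> u \<in> univ K \<and> v \<in> univ K \<and> a \<in> univ K \<and> b \<in> univ K}"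
    by (auto simp: tuples_def length_Suc_conv eval_nat_numeral)
  then have bex: "(\<exists>xs\<in>tuples K 5. P xs) \<longleftrightarrow>
      (\<exists>p\<in>univ K. \<exists>u\<in>univ K. \<exists>v\<in>univ K. \<exists>a\<in>univ K. \<exists>b\<in>univ K. P [p, u, v, a, b])" for P
    by (simp only:) blast
  show ?thesis unfolding config_form_def sat_exs bex
    by (intro bex_cong refl) auto
qed

lemma not_generic_bipartite:
  assumes G: "is_generic_bipartite M"
  shows False
proof -
  note f = generic_bipartite_facts[OF G]
  note inf = generic_bipartite_sides_infinite[OF G]
  have "sat M [] config_form"
  proof -
    obtain S where S: "finite S" "card S = 3" "S \<subseteq> Collect (left M)"
      using infinite_arbitrarily_large[OF inf(1)] by blast
    then obtain p u v where puv: "S = {p, u, v}" "p \<noteq> u" "p \<noteq> v" "u \<noteq> v" by (auto simp: card_3_iff)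
    then have L: "left M p" "left M u" "left M v" using S by auto
    obtain a where a: "right M a" "bip_adj M a p" "bip_adj M a u" "\<not> bip_adj M a v"
      using f(7)[unfolded generic_pair_def, rule_format, of "{p, u}" "{v}"] L puv by auto
    obtain b where b: "right M b" "bip_adj M b u" "\<not> bip_adj M b p" "\<not> bip_adj M b v"
      using f(7)[unfolded generic_pair_def, rule_format, of "{u}" "{p, v}"] L puv by auto
    have V: "p \<in> univ M" "u \<in> univ M" "v \<in> univ M" "a \<in> univ M" "b \<in> univ M"
      using f(2) L a(1) b(1) by blast+
    have "bip_adj M x y \<longleftrightarrow> bip_adj M y x" for x y using f(5) by blast
    then have adj: "bip_adj M p a" "bip_adj M u a" "\<not> bip_adj M v a" "\<not> bip_adj M p b" "bip_adj M u b" "\<not> bip_adj M v b"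
      using a b by blast+
    show ?thesis unfolding sat_config_form
      by (intro bexI[of _ p] bexI[of _ u] bexI[of _ v] bexI[of _ a] bexI[of _ b])
        (simp_all add: V adj L a(1) b(1) puv(2-4))
  qed
  moreover have "sat M [] bip_sym_form" using f(5) by (simp add: bip_sym_form_def ball_tuples_2)
  moreover have "wff bip_ar 0 config_form" "wff bip_ar 0 bip_sym_form"
    by (simp_all add: config_form_def bip_sym_form_def)
  ultimately have "eventually (\<lambda>i. sat (N i) [] config_form) U" "eventually (\<lambda>i. sat (N i) [] bip_sym_form) U"
    using sentence_iff by blast+
  moreover note eventually_side_counts[OF G, of Left Right 1, simplified]
    eventually_side_counts[OF G, of Left Right 2, simplified]
    eventually_side_counts[OF G, of Left Right 3, simplified]
    eventually_side_counts[OF G, of Right Left 1, simplified]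
    eventually_side_counts[OF G, of Right Left 2, simplified]
  ultimately have "eventually (\<lambda>i. False) U"
  proof eventually_elim
    case (elim i)
    let ?X = "side (N i) Left" and ?Y = "side (N i) Right" and ?B = "bip_adj (N i)"
    have sym: "?B x y \<longleftrightarrow> ?B y x" if "x \<in> ?X \<union> ?Y" "y \<in> ?X \<union> ?Y" for x y
      using elim(2) that by (auto simp: bip_sym_form_def ball_tuples_2 side_def)
    obtain p u v a b where *: "p \<in> ?X" "u \<in> ?X" "v \<in> ?X" "a \<in> ?Y" "b \<in> ?Y" "distinct [p, u, v]"
      "?B p a" "?B u a" "\<not> ?B v a" "\<not> ?B p b" "?B u b" "\<not> ?B v b"
      using elim(1) unfolding sat_config_form side_def left_def right_def by blast
    have flip: "{x \<in> ?X. \<forall>y\<in>set ys. ?B y x} = {x \<in> ?X. \<forall>y\<in>set ys. ?B x y}" if "set ys \<subseteq> ?Y" for ys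
      using that sym by blast
    show False
    proof (rule finite_generic_bipartite_False[where X = ?X and Y = ?Y and B = ?B and p = p and u = u
          and v = v and a = a and b = b])
      show "finite ?X" "finite ?Y" using N_finite by (auto simp: side_def)
      show "card {y \<in> ?Y. ?B x y} = card {y \<in> ?Y. ?B x' y}" if "x \<in> ?X" "x' \<in> ?X" for x x'
        using elim(3)[rule_format, of "[x]" "[x']"] that by simp
      show "card {y \<in> ?Y. ?B x1 y \<and> ?B x2 y} = card {y \<in> ?Y. ?B y1 y \<and> ?B y2 y}"
        if "{x1, x2, y1, y2} \<subseteq> ?X" "x1 \<noteq> x2" "y1 \<noteq> y2" for x1 x2 y1 y2
        using elim(4)[rule_format, of "[x1, x2]" "[y1, y2]"] that by simp
      show "card {y \<in> ?Y. ?B x1 y \<and> ?B x2 y \<and> ?B x3 y} = card {y \<in> ?Y. ?B y1 y \<and> ?B y2 y \<and> ?B y3 y}"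
        if "{x1, x2, x3, y1, y2, y3} \<subseteq> ?X" "distinct [x1, x2, x3]" "distinct [y1, y2, y3]" for x1 x2 x3 y1 y2 y3
        using elim(5)[rule_format, of "[x1, x2, x3]" "[y1, y2, y3]"] that by simp
      show "card {y \<in> ?X. ?B y x} = card {y \<in> ?X. ?B y x'}" if "x \<in> ?Y" "x' \<in> ?Y" for x x'
        using elim(6)[rule_format, of "[x]" "[x']"] that flip[of "[x]"] flip[of "[x']"] by simp
      show "card {y \<in> ?X. ?B y x1 \<and> ?B y x2} = card {y \<in> ?X. ?B y y1 \<and> ?B y y2}"
        if "{x1, x2, y1, y2} \<subseteq> ?Y" "x1 \<noteq> x2" "y1 \<noteq> y2" for x1 x2 y1 y2
        using elim(7)[rule_format, of "[x1, x2]" "[y1, y2]"] that flip[of "[x1, x2]"] flip[of "[y1, y2]"] by simp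
    qed (use * in auto)
  qed
  then show False using eventually_ex by blast
qed

end

lemma equiv_to_mec_ultraproductE:
  fixes M :: "('r, 'm) rel_struct"
  assumes "equiv_to_mec_ultraproduct TYPE('a) TYPE('i) ar M"
  obtains C :: "('r, 'a) rel_struct set" and U :: "'i filter" and N :: "'i \<Rightarrow> ('r, 'a) rel_struct"
    where "mec_ultraproduct ar C U N M"
  using assms unfolding equiv_to_mec_ultraproduct_def mec_ultraproduct_def by blast

theorem theorem4p1p6:
  fixes ar :: "'r \<Rightarrow> nat"
  shows
    "(\<forall>M :: ('r, 'm) rel_struct.
        countably_infinite_structure ar M \<and> homogeneous ar M \<and>
        strict_order_property TYPE('n) ar (theory_of ar M) \<longrightarrow>
        \<not> equiv_to_mec_ultraproduct TYPE('a) TYPE('i) ar M) \<and>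
     (\<forall>M :: (arc_lang, 'm) rel_struct.
        countably_infinite_structure arc_ar M \<and> homogeneous arc_ar M \<and>
        is_graph M \<and> unstable TYPE('n) arc_ar (theory_of arc_ar M) \<longrightarrow>
        \<not> equiv_to_mec_ultraproduct TYPE('a) TYPE('i) arc_ar M) \<and>
     (\<forall>M :: (arc_lang, 'm) rel_struct.
        countably_infinite_structure arc_ar M \<and> homogeneous arc_ar M \<and>
        is_tournament M \<longrightarrow>
        \<not> equiv_to_mec_ultraproduct TYPE('a) TYPE('i) arc_ar M) \<and>
     (\<forall>n\<ge>3. \<forall>M :: (arc_lang, 'm) rel_struct.
        countably_infinite_structure arc_ar M \<and> is_Q n M \<longrightarrow>
        \<not> equiv_to_mec_ultraproduct TYPE('a) TYPE('i) arc_ar M) \<and>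
     (\<forall>M :: (bip_lang, 'm) rel_struct.
        is_generic_bipartite M \<longrightarrow>
        \<not> equiv_to_mec_ultraproduct TYPE('a) TYPE('i) bip_ar M)"
proof (intro conjI allI impI notI; (elim conjE)?)
  fix M :: "('r, 'm) rel_struct"
  assume "strict_order_property TYPE('n) ar (theory_of ar M)" "equiv_to_mec_ultraproduct TYPE('a) TYPE('i) ar M"
  then show False
    by (elim equiv_to_mec_ultraproductE) (rule mec_ultraproduct.not_strict_order_property)
next
  fix M :: "(arc_lang, 'm) rel_struct"
  assume M: "countably_infinite_structure arc_ar M" "homogeneous arc_ar M" "is_graph M"
    "unstable TYPE('n) arc_ar (theory_of arc_ar M)" and "equiv_to_mec_ultraproduct TYPE('a) TYPE('i) arc_ar M"
  from this(5) obtain C :: "(arc_lang, 'a) rel_struct set" and U :: "'i filter" and N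
    where "mec_ultraproduct arc_ar C U N M" by (rule equiv_to_mec_ultraproductE)
  then interpret arc_ultraproduct C U N M by (simp add: arc_ultraproduct_def)
  show False using not_unstable_homogeneous_graph M by (auto simp: countably_infinite_structure_def)
next
  fix M :: "(arc_lang, 'm) rel_struct"
  assume M: "countably_infinite_structure arc_ar M" "homogeneous arc_ar M" "is_tournament M"
    and "equiv_to_mec_ultraproduct TYPE('a) TYPE('i) arc_ar M"
  from this(4) obtain C :: "(arc_lang, 'a) rel_struct set" and U :: "'i filter" and N
    where "mec_ultraproduct arc_ar C U N M" by (rule equiv_to_mec_ultraproductE)
  then interpret arc_ultraproduct C U N M by (simp add: arc_ultraproduct_def)
  show False using not_homogeneous_tournament M by (auto simp: countably_infinite_structure_def)
next
  fix n :: nat and M :: "(arc_lang, 'm) rel_struct"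
  assume n: "3 \<le> n" and Q: "is_Q n M" and "equiv_to_mec_ultraproduct TYPE('a) TYPE('i) arc_ar M"
  from this(3) obtain C :: "(arc_lang, 'a) rel_struct set" and U :: "'i filter" and N
    where "mec_ultraproduct arc_ar C U N M" by (rule equiv_to_mec_ultraproductE)
  then interpret arc_ultraproduct C U N M by (simp add: arc_ultraproduct_def)
  have "n - 2 + 2 = n" using n by simp
  then show False using not_Q[of "n - 2"] Q by simp
next
  fix M :: "(bip_lang, 'm) rel_struct"
  assume G: "is_generic_bipartite M" and "equiv_to_mec_ultraproduct TYPE('a) TYPE('i) bip_ar M"
  from this(2) obtain C :: "(bip_lang, 'a) rel_struct set" and U :: "'i filter" and N
    where "mec_ultraproduct bip_ar C U N M" by (rule equiv_to_mec_ultraproductE)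
  then interpret bip_ultraproduct C U N M by (simp add: bip_ultraproduct_def)
  show False by (rule not_generic_bipartite[OF G])
qed

end
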